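(* Let $G$ be a second countable compact abelian group and let $A:G\to G$ be a continuous surjective group homomorphism such that $\ker A$ is finite and $\bigcup_{j\in\mathbb{N}_0}\ker A^j$ is dense in $G$. Then there exists an MSF MRA $(V_j)_{j\in\mathbb{N}_0}$ of $L^2(G)$ associated with $(G,A)$.
   Context: $\mathbb{N}_0=\{0,1,2,\ldots\}$, and $A^0$ is the identity map. $m=|\ker A|$. $\widehat{G}$ is the (discrete) dual group of continuous characters of $G$; $dx$ is Haar measure on $G$ normalized to total mass $1$, functions are complex-valued, and $\widehat{f}(\chi)=\int_G f(x)\overline{\chi(x)}\,dx$ for $f\in L^1(G)$. Translation: $T_yf(x)=f(x-y)$, $y\in G$. Periodization: $Pf(x)=\sum_{a\in\ker A}f(y+a)$, where $y\in G$ is any element with $Ay=x$. A multiresolution analysis (MRA) of $L^2(G)$ associated with $(G,A)$ is a sequence $(V_j)_{j\in\mathbb{N}_0}$ of closed subspaces of $L^2(G)$ such that: MR1. $V_j\subset V_{j+1}$ for all $j\in\mathbb{N}_0$; MR2. $\overline{\bigcup_{j=0}^\infty V_j}=L^2(G)$; MR3. for all $j\in\mathbb{N}_0$ and $\gamma\in\ker A^j$, $f\in V_j$ if and only if $T_\gamma f\in V_j$; MR4. for each $j\in\mathbb{N}_0$ there exists $\varphi_j\in V_j$ such that $(T_a\varphi_j)_{a\in\ker A^j}$ is a basis of $V_j$; MR5. for all $j\in\mathbb{N}_0$: a) $f\in V_j\Rightarrow f(A(\cdot))\in V_{j+1}$, and b) $f\in V_{j+1}\Rightarrow Pf\in V_j$.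 A sequence $(\varphi_j)_{j\in\mathbb{N}_0}$ as in MR4 is called a scaling sequence of the MRA. An MRA $(V_j)_{j\in\mathbb{N}_0}$ is called MSF (minimally supported frequency) if its scaling sequence $(\varphi_j)_{j\in\mathbb{N}_0}$ satisfies $|\operatorname{supp}\widehat{\varphi}_j|=m^j$ for all $j\in\mathbb{N}_0$, where $\operatorname{supp}\widehat{\varphi}_j=\{\chi\in\widehat{G}:\widehat{\varphi}_j(\chi)\neq 0\}$. *)

theory Defs
  imports "HOL-Analysis.Analysis" "HOL-Probability.Probability_Measure"
begin

text \<open>
  Normalized Haar measure on a compact group. Regularity is not listed, because a finite Borel
  measure on a second countable compact Hausdorff space is automatically regular.
\<close>
definition normalized_haar_measure :: "'a::topological_ab_group_add measure \<Rightarrow> bool" where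
  "normalized_haar_measure M \<longleftrightarrow>
     sets M = sets borel \<and> prob_space M \<and> (\<forall>a. distr M M (\<lambda>x. a + x) = M)"

text \<open>
  Elements of \<open>L\<^sup>2\<close> are handled through representatives: a subset of \<open>L\<^sup>2\<close> is a set of
  square-integrable functions that is stable under almost-everywhere equality. For the closed
  subspaces below this stability is a consequence of closedness with respect to the seminorm.
\<close>
definition L2 :: "'a measure \<Rightarrow> ('a \<Rightarrow> complex) set" where
  "L2 M = {f \<in> borel_measurable M. integrable M (\<lambda>x. (cmod (f x))\<^sup>2)}"

definition L2_norm :: "'a measure \<Rightarrow> ('a \<Rightarrow> complex) \<Rightarrow> real" where
  "L2_norm M f = sqrt (LINT x|M. (cmod (f x))\<^sup>2)"

definition L2_closure :: "'a measure \<Rightarrow> ('a \<Rightarrow> complex) set \<Rightarrow> ('a \<Rightarrow> complex) set" where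
  "L2_closure M S = {f \<in> L2 M. \<forall>e>0. \<exists>g\<in>S. L2_norm M (\<lambda>x. f x - g x) < e}"

definition closed_L2_subspace :: "'a measure \<Rightarrow> ('a \<Rightarrow> complex) set \<Rightarrow> bool" where
  "closed_L2_subspace M W \<longleftrightarrow>
     W \<subseteq> L2 M \<and> (\<lambda>x. 0) \<in> W \<and>
     (\<forall>f\<in>W. \<forall>g\<in>W. (\<lambda>x. f x + g x) \<in> W) \<and>
     (\<forall>c. \<forall>f\<in>W. (\<lambda>x. c * f x) \<in> W) \<and>
     L2_closure M W \<subseteq> W"

text \<open>
  A finite indexed family of functions is a basis of \<open>W\<close>, all identities being read in \<open>L\<^sup>2\<close>,
  that is, almost everywhere. Independence is that of the family, so the members are in
  particular pairwise distinct.
\<close>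
definition L2_basis ::
  "'a measure \<Rightarrow> 'i set \<Rightarrow> ('i \<Rightarrow> 'a \<Rightarrow> complex) \<Rightarrow> ('a \<Rightarrow> complex) set \<Rightarrow> bool" where
  "L2_basis M I b W \<longleftrightarrow>
     finite I \<and> (\<forall>i\<in>I. b i \<in> W) \<and>
     (\<forall>c. (AE x in M. (\<Sum>i\<in>I. c i * b i x) = 0) \<longrightarrow> (\<forall>i\<in>I. c i = 0)) \<and>
     (\<forall>f\<in>W. \<exists>c. AE x in M. f x = (\<Sum>i\<in>I. c i * b i x))"

definition hom_ker :: "('a \<Rightarrow> 'a::zero) \<Rightarrow> 'a set" where
  "hom_ker A = {x. A x = 0}"

definition dual_group :: "('a::topological_ab_group_add \<Rightarrow> complex) set" where
  "dual_group = {\<xi>. continuous_on UNIV \<xi> \<and> (\<forall>x. cmod (\<xi> x) = 1) \<and>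
                    (\<forall>x y. \<xi> (x + y) = \<xi> x * \<xi> y)}"

definition fourier :: "'a measure \<Rightarrow> ('a \<Rightarrow> complex) \<Rightarrow> ('a \<Rightarrow> complex) \<Rightarrow> complex" where
  "fourier M f \<xi> = (LINT x|M. f x * cnj (\<xi> x))"

definition fourier_supp ::
  "'a::topological_ab_group_add measure \<Rightarrow> ('a \<Rightarrow> complex) \<Rightarrow> ('a \<Rightarrow> complex) set" where
  "fourier_supp M f = {\<xi> \<in> dual_group. fourier M f \<xi> \<noteq> 0}"

definition translate :: "'a::ab_group_add \<Rightarrow> ('a \<Rightarrow> complex) \<Rightarrow> 'a \<Rightarrow> complex" where
  "translate y f = (\<lambda>x. f (x - y))"

definition periodize :: "('a \<Rightarrow> 'a::ab_group_add) \<Rightarrow> ('a \<Rightarrow> complex) \<Rightarrow> 'a \<Rightarrow> complex" where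
  "periodize A f = (\<lambda>x. let y = (SOME y. A y = x) in \<Sum>a\<in>hom_ker A. f (y + a))"

text \<open>The value of \<open>periodize\<close> does not depend on the chosen preimage.\<close>
lemma periodize_eq:
  fixes A :: "'a \<Rightarrow> 'a::ab_group_add"
  assumes add: "\<And>x y. A (x + y) = A x + A y" and y: "A y = x"
  shows "periodize A f x = (\<Sum>a\<in>hom_ker A. f (y + a))"
proof -
  have A: "Modules.additive A" using add by (rule Modules.additive.intro)
  define z where "z = (SOME y. A y = x)"
  have z: "A z = x" unfolding z_def using y by (rule someI)
  have "(\<Sum>a\<in>hom_ker A. f (z + a)) = (\<Sum>a\<in>hom_ker A. f (y + a))"
    by (rule sum.reindex_bij_witness[where i = "\<lambda>a. a + (y - z)" and j = "\<lambda>a. a + (z - y)"])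
       (auto simp: hom_ker_def add Modules.additive.diff[OF A] y z algebra_simps)
  then show ?thesis unfolding periodize_def z_def Let_def .
qed

definition mra ::
  "'a::topological_ab_group_add measure \<Rightarrow> ('a \<Rightarrow> 'a) \<Rightarrow> (nat \<Rightarrow> ('a \<Rightarrow> complex) set) \<Rightarrow> bool" where
  "mra M A V \<longleftrightarrow>
     (\<forall>j. closed_L2_subspace M (V j)) \<and>
     (\<forall>j. V j \<subseteq> V (Suc j)) \<and>
     L2_closure M (\<Union>j. V j) = L2 M \<and>
     (\<forall>j. \<forall>\<gamma>\<in>hom_ker (A ^^ j). \<forall>f\<in>L2 M. f \<in> V j \<longleftrightarrow> translate \<gamma> f \<in> V j) \<and>
     (\<forall>j. \<exists>g\<in>V j. L2_basis M (hom_ker (A ^^ j)) (\<lambda>a. translate a g) (V j)) \<and>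
     (\<forall>j. (\<forall>f\<in>V j. (\<lambda>x. f (A x)) \<in> V (Suc j)) \<and>
         (\<forall>f\<in>V (Suc j). periodize A f \<in> V j))"

definition scaling_sequence ::
  "'a::topological_ab_group_add measure \<Rightarrow> ('a \<Rightarrow> 'a) \<Rightarrow> (nat \<Rightarrow> ('a \<Rightarrow> complex) set) \<Rightarrow>
   (nat \<Rightarrow> 'a \<Rightarrow> complex) \<Rightarrow> bool" where
  "scaling_sequence M A V \<phi> \<longleftrightarrow>
     (\<forall>j. \<phi> j \<in> V j \<and> L2_basis M (hom_ker (A ^^ j)) (\<lambda>a. translate a (\<phi> j)) (V j))"

text \<open>
  The support of the Fourier transform of \<open>\<phi> j\<close> depends only on \<open>V j\<close>, not on the chosen
  scaling sequence, and an MRA has at least one scaling sequence; so quantifying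
  over all scaling sequences or asking for one amounts to the same. For finite \<open>hom_ker A\<close> the
  cardinality below is positive, so the equation includes finiteness of the support.
\<close>
definition msf_mra ::
  "'a::topological_ab_group_add measure \<Rightarrow> ('a \<Rightarrow> 'a) \<Rightarrow> (nat \<Rightarrow> ('a \<Rightarrow> complex) set) \<Rightarrow> bool" where
  "msf_mra M A V \<longleftrightarrow>
     mra M A V \<and>
     (\<forall>\<phi>. scaling_sequence M A V \<phi> \<longrightarrow>
        (\<forall>j. card (fourier_supp M (\<phi> j)) = card (hom_ker A) ^ j))"

end

theory Submission
  imports Defs
begin

text \<open>
  Let \<open>X\<close> be the dual of \<open>G\<close>, let \<open>K\<^sub>j\<close> be the kernel of \<open>A\<^sup>j\<close>, a finite group with \<open>m\<^sup>j\<close> elements,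
  and let \<open>B\<close> send a character \<open>\<xi>\<close> to \<open>\<xi> \<circ> A\<close>. The spaces are
  \<open>V\<^sub>j = {f. the Fourier transform of f vanishes off S\<^sub>j}\<close> for suitable finite sets \<open>S\<^sub>j\<close> of
  characters. On the Fourier side translation multiplies by a unimodular factor, composition
  with \<open>A\<close> transports coefficients along \<open>B\<close>, and periodization restricts them to the
  range of \<open>B\<close>. The axioms therefore become combinatorial conditions on the \<open>S\<^sub>j\<close>:

  \<^item> \<open>S\<^sub>j\<close> meets each class of characters modulo equality on \<open>K\<^sub>j\<close> exactly once. Then
    \<open>|S\<^sub>j| = |K\<^sub>j|\<close>, and by the orthogonality relations of \<open>K\<^sub>j\<close> the translates of the sum of
    all members of \<open>S\<^sub>j\<close> form a basis (\<open>transversal_translates_basis\<close>).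
  \<^item> \<open>S\<^sub>j \<subseteq> S\<^bsub>j+1\<^esub>\<close>, and the union of the \<open>S\<^sub>j\<close> is \<open>X\<close>.
  \<^item> \<open>B \<xi> \<in> S\<^bsub>j+1\<^esub>\<close> if and only if \<open>\<xi> \<in> S\<^sub>j\<close>.

  Such sets exist because \<open>X\<close> is countable. The range of \<open>B\<close> consists of the characters that
  are trivial on the kernel of \<open>A\<close>, so inside the range the third condition prescribes
  \<open>S\<^bsub>j+1\<^esub>\<close> from \<open>S\<^sub>j\<close>. Outside the range one takes the element of least index in each class.
  Classes shrink as \<open>j\<close> grows, so least elements stay least. The sets exhaust \<open>X\<close> because the
  only character lying in the range of every power of \<open>B\<close> is the trivial one, by density of the
  union of the \<open>K\<^sub>j\<close> (\<open>freqs_transversal\<close>, \<open>freqs_mono\<close>, \<open>freqs_exhaust\<close>).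

  Any scaling function of such a \<open>V\<^sub>j\<close> has the whole of \<open>S\<^sub>j\<close> as the support of its Fourier
  transform, since a coefficient that vanishes for the function vanishes for all combinations of
  its translates (\<open>fourier_supp_of_basis\<close>). This gives minimality of the support.

  The analytic input is that \<open>X\<close> separates the points of \<open>G\<close>
  (\<open>characters_separate_from_zero\<close>). It is obtained from the finite groups \<open>K\<^sub>j\<close>, whose union
  is dense. On a finite group a character with a large value of a given linear functional is
  found as the maximizer of a strictly convex functional on positive definite functions
  (\<open>finite_subgroup_character_near_state\<close>). Applied to a functional made from a bump function
  \<open>f\<close>, this produces a character of \<open>K\<^sub>j\<close> whose correlation with \<open>f\<close> is bounded below
  independently of \<open>j\<close>. Such a character has the modulus of continuity of \<open>f\<close> up to a constant,
  so a cluster point of these characters for \<open>j\<close> to infinity is a continuous character of \<open>G\<close>.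
  Density of trigonometric polynomials in \<open>L\<^sup>2\<close> then follows from the Stone-Weierstrass theorem.
\<close>

section \<open>Characters of finite subgroups as extremal positive definite functions\<close>

definition finite_subgroup :: "'a::ab_group_add set \<Rightarrow> bool" where
  "finite_subgroup K \<longleftrightarrow> finite K \<and> 0 \<in> K \<and> (\<forall>x\<in>K. \<forall>y\<in>K. x - y \<in> K)"

lemma finite_subgroupD:
  assumes "finite_subgroup K"
  shows "finite K" "0 \<in> K" "x \<in> K \<Longrightarrow> - x \<in> K" "x \<in> K \<Longrightarrow> y \<in> K \<Longrightarrow> x - y \<in> K"
    "x \<in> K \<Longrightarrow> y \<in> K \<Longrightarrow> x + y \<in> K"
proof -
  have d: "\<And>x y. x \<in> K \<Longrightarrow> y \<in> K \<Longrightarrow> x - y \<in> K" and z: "0 \<in> K"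
    using assms by (auto simp: finite_subgroup_def)
  have n: "\<And>x. x \<in> K \<Longrightarrow> - x \<in> K" using d[OF z] by simp
  show "finite K" "0 \<in> K" "x \<in> K \<Longrightarrow> - x \<in> K" "x \<in> K \<Longrightarrow> y \<in> K \<Longrightarrow> x - y \<in> K"
    using assms d n by (auto simp: finite_subgroup_def)
  show "x \<in> K \<Longrightarrow> y \<in> K \<Longrightarrow> x + y \<in> K" using d[of x "-y"] n[of y] by simp
qed

lemma sum_translate:
  assumes "finite_subgroup K" "t \<in> K"
  shows "(\<Sum>x\<in>K. f (x + t)) = (\<Sum>x\<in>K. f x)"
  by (rule sum.reindex_bij_witness[where i="\<lambda>x. x - t" and j="\<lambda>x. x + t"])
     (use finite_subgroupD[OF assms(1)] assms(2) in auto)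

text \<open>
  Hermitian symmetry makes the quadratic form real, so it is enough to test its real part.
\<close>

definition pos_def_on :: "'a::ab_group_add set \<Rightarrow> ('a \<Rightarrow> complex) \<Rightarrow> bool" where
  "pos_def_on K \<phi> \<longleftrightarrow> (\<forall>x\<in>K. \<phi> (- x) = cnj (\<phi> x)) \<and>
     (\<forall>c. 0 \<le> Re (\<Sum>x\<in>K. \<Sum>y\<in>K. c x * cnj (c y) * \<phi> (x - y)))"

text \<open>
  Testing positivity with a coefficient function supported on \<open>{0, x}\<close> gives a Hermitian form in
  two variables; the phase \<open>u\<close> is chosen to make its cross term as negative as possible.
\<close>

lemma pos_def_bound:
  assumes K: "finite_subgroup K" and p: "pos_def_on K \<phi>" and x: "x \<in> K"
  shows "cmod (\<phi> x) \<le> Re (\<phi> 0)"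
proof -
  note K' = finite_subgroupD[OF K]
  have h: "\<And>x. x \<in> K \<Longrightarrow> \<phi> (- x) = cnj (\<phi> x)" using p by (auto simp: pos_def_on_def)
  define u where "u = (if \<phi> x = 0 then 1 else - cnj (\<phi> x) / cmod (\<phi> x))"
  have u: "u * cnj u = 1" "u * \<phi> x = - of_real (cmod (\<phi> x))"
  proof -
    have n: "cnj (\<phi> x) * \<phi> x = of_real (cmod (\<phi> x)) * of_real (cmod (\<phi> x))"
      using complex_norm_square[of "\<phi> x"] by (simp add: power2_eq_square mult.commute)
    show "u * cnj u = 1" using n by (cases "\<phi> x = 0") (simp_all add: u_def field_simps)
    show "u * \<phi> x = - of_real (cmod (\<phi> x))"
      using n by (cases "\<phi> x = 0") (simp_all add: u_def field_simps)
  qed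
  have im: "Im (\<phi> 0) = 0" using h[OF K'(2)] by (simp add: complex_eq_iff)
  show ?thesis
  proof (cases "x = 0")
    case True
    define c where "c = (\<lambda>z::'a. if z = 0 then 1 else (0::complex))"
    have red: "(\<Sum>z\<in>K. c z * f z) = f 0" "(\<Sum>z\<in>K. cnj (c z) * f z) = f 0" for f
    proof -
      have "(\<Sum>z\<in>K. c z * f z) = (\<Sum>z\<in>{0}. c z * f z)"
        "(\<Sum>z\<in>K. cnj (c z) * f z) = (\<Sum>z\<in>{0}. cnj (c z) * f z)"
        by (intro sum.mono_neutral_right; use K' x in \<open>auto simp: c_def\<close>)+
      then show "(\<Sum>z\<in>K. c z * f z) = f 0" "(\<Sum>z\<in>K. cnj (c z) * f z) = f 0"
        by (auto simp: c_def)
    qed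
    have "(\<Sum>x\<in>K. \<Sum>y\<in>K. c x * cnj (c y) * \<phi> (x - y)) =
          (\<Sum>x\<in>K. c x * (\<Sum>y\<in>K. cnj (c y) * \<phi> (x - y)))"
      by (simp add: sum_distrib_left mult.assoc)
    also have "\<dots> = \<phi> 0" by (simp add: red)
    finally have "(\<Sum>x\<in>K. \<Sum>y\<in>K. c x * cnj (c y) * \<phi> (x - y)) = \<phi> 0" .
    moreover have "0 \<le> Re (\<Sum>x\<in>K. \<Sum>y\<in>K. c x * cnj (c y) * \<phi> (x - y))"
      using p unfolding pos_def_on_def by blast
    ultimately show ?thesis using True im by (simp add: cmod_eq_Re)
  next
    case False
    define c where "c = (\<lambda>z::'a. if z = x then u else if z = 0 then 1 else 0)"
    have red: "(\<Sum>z\<in>K. c z * f z) = u * f x + f 0" "(\<Sum>z\<in>K. cnj (c z) * f z) = cnj u * f x + f 0" for f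
    proof -
      have "(\<Sum>z\<in>K. c z * f z) = (\<Sum>z\<in>{x,0}. c z * f z)"
        "(\<Sum>z\<in>K. cnj (c z) * f z) = (\<Sum>z\<in>{x,0}. cnj (c z) * f z)"
        by (intro sum.mono_neutral_right; use K' x in \<open>auto simp: c_def\<close>)+
      then show "(\<Sum>z\<in>K. c z * f z) = u * f x + f 0" "(\<Sum>z\<in>K. cnj (c z) * f z) = cnj u * f x + f 0"
        using False by (auto simp: c_def)
    qed
    have "(\<Sum>x\<in>K. \<Sum>y\<in>K. c x * cnj (c y) * \<phi> (x - y)) =
          (\<Sum>x\<in>K. c x * (\<Sum>y\<in>K. cnj (c y) * \<phi> (x - y)))"
      by (simp add: sum_distrib_left mult.assoc)
    also have "\<dots> = u * cnj u * \<phi> 0 + u * \<phi> x + cnj u * \<phi> (- x) + \<phi> 0"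
      by (simp only: red) (simp add: algebra_simps)
    also have "\<dots> = \<phi> 0 - cmod (\<phi> x) - cmod (\<phi> x) + \<phi> 0"
    proof -
      have "cnj u * \<phi> (- x) = cnj (u * \<phi> x)" using h[OF x] by simp
      then show ?thesis using u by simp
    qed
    finally have "Re (\<Sum>x\<in>K. \<Sum>y\<in>K. c x * cnj (c y) * \<phi> (x - y)) = 2 * Re (\<phi> 0) - 2 * cmod (\<phi> x)"
      by simp
    moreover have "0 \<le> Re (\<Sum>x\<in>K. \<Sum>y\<in>K. c x * cnj (c y) * \<phi> (x - y))"
      using p unfolding pos_def_on_def by blast
    ultimately show ?thesis by simp
  qed
qed

lemma pos_def_scale:
  assumes "pos_def_on K \<phi>" "0 \<le> r"
  shows "pos_def_on K (\<lambda>x. of_real r * \<phi> x)"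
proof -
  have "(\<Sum>x\<in>K. \<Sum>y\<in>K. c x * cnj (c y) * (of_real r * \<phi> (x - y))) =
        of_real r * (\<Sum>x\<in>K. \<Sum>y\<in>K. c x * cnj (c y) * \<phi> (x - y))" for c
    by (simp add: sum_distrib_left mult_ac)
  then show ?thesis using assms by (auto simp: pos_def_on_def)
qed

text \<open>
  If \<open>c\<close> is replaced by \<open>c + (a/2) T\<^sub>t c\<close> in the quadratic form of \<open>\<phi>\<close>, the result is the quadratic
  form of the function displayed here. The factor \<open>1/2\<close> keeps its value at \<open>0\<close>, which is
  \<open>5/4 + Re (a \<phi>(t))\<close> when \<open>\<phi>(0) = 1\<close>, away from \<open>0\<close>, so that one may normalize afterwards.
\<close>

lemma pos_def_shift:
  assumes K: "finite_subgroup K" and p: "pos_def_on K \<phi>" and t: "t \<in> K" and a: "cmod a = 1"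
  shows "pos_def_on K (\<lambda>x. 5/4 * \<phi> x + 1/2 * (a * \<phi> (x + t) + cnj a * \<phi> (x - t)))"
    (is "pos_def_on K ?\<psi>")
proof -
  note K' = finite_subgroupD[OF K]
  have h: "\<And>x. x \<in> K \<Longrightarrow> \<phi> (- x) = cnj (\<phi> x)" using p by (auto simp: pos_def_on_def)
  have "?\<psi> (- x) = cnj (?\<psi> x)" if "x \<in> K" for x
  proof -
    have "\<phi> (- x + t) = cnj (\<phi> (x - t))" "\<phi> (- x - t) = cnj (\<phi> (x + t))"
      using h[OF K'(4)[OF that t]] h[OF K'(5)[OF that t]]
      by (metis minus_diff_eq uminus_add_conv_diff, metis minus_add_distrib diff_conv_add_uminus)
    then show ?thesis using h[OF that] by (simp add: algebra_simps)
  qed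
  moreover have "0 \<le> Re (\<Sum>x\<in>K. \<Sum>y\<in>K. c x * cnj (c y) * ?\<psi> (x - y))" for c
  proof -
    define b where "b = a / 2"
    have bb: "b * cnj b = 1/4"
      using a by (simp add: b_def flip: complex_norm_square)
    define d where "d = (\<lambda>z. c z + b * c (z - t))"
    define g where "g = (\<lambda>c e. \<Sum>x\<in>K. \<Sum>y\<in>K. c x * cnj (e y) * \<phi> (x - y))"
    have tr: "(\<Sum>x\<in>K. f (x - t)) = (\<Sum>x\<in>K. f x)" for f :: "'a \<Rightarrow> complex"
      using sum_translate[OF K K'(3)[OF t], of f] by simp
    have 1: "(\<Sum>x\<in>K. \<Sum>y\<in>K. c (x - t) * cnj (c y) * \<phi> (x - y)) =
       (\<Sum>x\<in>K. \<Sum>y\<in>K. c x * cnj (c y) * \<phi> (x - y + t))"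
      using tr[of "\<lambda>x. \<Sum>y\<in>K. c x * cnj (c y) * \<phi> (x + t - y)"] by (simp add: algebra_simps)
    have 2: "(\<Sum>y\<in>K. c x * cnj (c (y - t)) * \<phi> (x - y)) =
       (\<Sum>y\<in>K. c x * cnj (c y) * \<phi> (x - y - t))" for x
      using tr[of "\<lambda>y. c x * cnj (c y) * \<phi> (x - y - t)"] by (simp add: algebra_simps)
    have 3: "(\<Sum>x\<in>K. \<Sum>y\<in>K. c (x - t) * cnj (c (y - t)) * \<phi> (x - y)) =
       (\<Sum>x\<in>K. \<Sum>y\<in>K. c x * cnj (c y) * \<phi> (x - y))"
    proof -
      have "(\<Sum>y\<in>K. c (x - t) * cnj (c (y - t)) * \<phi> (x - y)) =
        (\<Sum>y\<in>K. c (x - t) * cnj (c y) * \<phi> (x - t - y))" for x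
        using tr[of "\<lambda>y. c (x - t) * cnj (c y) * \<phi> (x - t - y)"] by (simp add: algebra_simps)
      then show ?thesis
        using tr[of "\<lambda>x. \<Sum>y\<in>K. c x * cnj (c y) * \<phi> (x - y)"] by simp
    qed
    have 4: "w * p + b * (w * q) + cnj b * (w * r) + 1/4 * (w * p) =
        w * (5/4 * p + 1/2 * (a * q + cnj a * r))" for w p q r
      by (simp add: b_def algebra_simps)
    have "(\<Sum>x\<in>K. \<Sum>y\<in>K. d x * cnj (d y) * \<phi> (x - y)) =
      (\<Sum>x\<in>K. \<Sum>y\<in>K. c x * cnj (c y) * \<phi> (x - y)) +
      b * (\<Sum>x\<in>K. \<Sum>y\<in>K. c (x - t) * cnj (c y) * \<phi> (x - y)) +
      cnj b * (\<Sum>x\<in>K. \<Sum>y\<in>K. c x * cnj (c (y - t)) * \<phi> (x - y)) +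
      b * cnj b * (\<Sum>x\<in>K. \<Sum>y\<in>K. c (x - t) * cnj (c (y - t)) * \<phi> (x - y))"
      unfolding sum_distrib_left sum.distrib[symmetric]
      by (intro sum.cong refl) (simp add: d_def algebra_simps)
    also have "\<dots> = (\<Sum>x\<in>K. \<Sum>y\<in>K. c x * cnj (c y) * ?\<psi> (x - y))"
      unfolding 1 2 3 bb sum_distrib_left sum.distrib[symmetric]
      by (intro sum.cong refl 4)
    finally have "(\<Sum>x\<in>K. \<Sum>y\<in>K. d x * cnj (d y) * \<phi> (x - y)) =
      (\<Sum>x\<in>K. \<Sum>y\<in>K. c x * cnj (c y) * ?\<psi> (x - y))" .
    moreover have "0 \<le> Re (\<Sum>x\<in>K. \<Sum>y\<in>K. d x * cnj (d y) * \<phi> (x - y))"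
      using p unfolding pos_def_on_def by blast
    ultimately show ?thesis by simp
  qed
  ultimately show ?thesis unfolding pos_def_on_def by blast
qed

text \<open>
  States vanish off \<open>K\<close>, so that they form a compact subset of the product space of all functions
  on the ambient group and no function space over \<open>K\<close> is needed.
\<close>

definition states :: "'a::ab_group_add set \<Rightarrow> ('a \<Rightarrow> complex) set" where
  "states K = {\<phi>. pos_def_on K \<phi> \<and> \<phi> 0 = 1 \<and> (\<forall>x. x \<notin> K \<longrightarrow> \<phi> x = 0)}"

lemma compact_bounded_functions: "compact {f :: 'a \<Rightarrow> complex. \<forall>x. cmod (f x) \<le> R}"
proof -
  have "compactin (product_topology (\<lambda>_. euclidean) UNIV) (PiE UNIV (\<lambda>_::'a. cball (0::complex) R))"
    by (subst compactin_PiE) auto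
  moreover have "PiE UNIV (\<lambda>_::'a. cball (0::complex) R) = {f. \<forall>x. cmod (f x) \<le> R}"
    by (auto simp: PiE_def)
  ultimately show ?thesis by (simp add: euclidean_product_topology)
qed

lemma compact_states:
  assumes K: "finite_subgroup K"
  shows "compact (states K)"
proof -
  note K' = finite_subgroupD[OF K]
  have c: "continuous_on UNIV (\<lambda>f::'a \<Rightarrow> complex. f x)" for x
    by (rule continuous_on_product_coordinates)
  have "states K = {f. \<forall>x. cmod (f x) \<le> 1} \<inter> states K"
  proof -
    have "cmod (f x) \<le> 1" if "f \<in> states K" for f x
      using pos_def_bound[OF K, of f x] that by (cases "x \<in> K") (auto simp: states_def)
    then show ?thesis by auto
  qed
  also have "\<dots> = {f. \<forall>x. cmod (f x) \<le> 1} \<inter> ((\<Inter>x\<in>K. {f. f (- x) = cnj (f x)}) \<inter>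
     (\<Inter>c. {f. 0 \<le> Re (\<Sum>x\<in>K. \<Sum>y\<in>K. c x * cnj (c y) * f (x - y))}) \<inter>
     {f. f 0 = 1} \<inter> (\<Inter>x\<in>-K. {f. f x = 0}))"
    unfolding states_def pos_def_on_def by blast
  finally have eq: "states K = {f. \<forall>x. cmod (f x) \<le> 1} \<inter> ((\<Inter>x\<in>K. {f. f (- x) = cnj (f x)}) \<inter>
     (\<Inter>c. {f. 0 \<le> Re (\<Sum>x\<in>K. \<Sum>y\<in>K. c x * cnj (c y) * f (x - y))}) \<inter>
     {f. f 0 = 1} \<inter> (\<Inter>x\<in>-K. {f. f x = 0}))" .
  have 1: "closed {f. f (- x) = cnj (f x)}" for x :: 'a
    by (intro closed_Collect_eq continuous_on_cnj c)
  have 2: "closed {f. 0 \<le> Re (\<Sum>x\<in>K. \<Sum>y\<in>K. e x * cnj (e y) * f (x - y))}" for e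
    by (intro closed_Collect_le continuous_on_const continuous_on_Re continuous_on_sum
        continuous_on_mult c)
  have 3: "closed {f. f x = r}" for x :: 'a and r :: complex
    by (intro closed_Collect_eq continuous_on_const c)
  show ?thesis
    unfolding eq
    by (intro compact_Int_closed compact_bounded_functions closed_Int closed_INT ballI 1 2 3)
qed

text \<open>
  The quantitative form of strict convexity of the squared modulus.
\<close>

lemma convex_combination_norm_square:
  fixes u v :: complex and s :: real
  shows "(cmod (of_real s * u + of_real (1 - s) * v))\<^sup>2 =
     s * (cmod u)\<^sup>2 + (1 - s) * (cmod v)\<^sup>2 - s * (1 - s) * (cmod (u - v))\<^sup>2"
  unfolding cmod_power2 by (simp add: power2_eq_square algebra_simps)

text \<open>
  A linear functional on the compact convex set of normalized positive definite functions is
  maximal at an extreme point, and extreme points are characters. Adding a small multiple of the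
  strictly convex functional \<open>N\<close> makes every maximizer extreme, at the cost of the error \<open>e\<close>.
  A maximizer \<open>\<xi>\<close> is a convex combination of the two functions obtained from it by
  \<open>pos_def_shift\<close> with \<open>a\<close> and with \<open>-a\<close> and normalization, so both coincide with \<open>\<xi>\<close>. For \<open>a = 1\<close> and
  \<open>a = \<i>\<close> these identities add up to \<open>\<xi>(x + t) = \<xi>(x) \<xi>(t)\<close>.
\<close>

proposition finite_subgroup_character_near_state:
  fixes K :: "'a::ab_group_add set" and k :: "'a \<Rightarrow> complex"
  assumes K: "finite_subgroup K" and \<phi>: "\<phi> \<in> states K" and e: "0 < e"
  obtains \<xi> where "\<And>x y. x \<in> K \<Longrightarrow> y \<in> K \<Longrightarrow> \<xi> (x + y) = \<xi> x * \<xi> y"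
    "\<And>x. x \<in> K \<Longrightarrow> cmod (\<xi> x) = 1"
    "Re (\<Sum>x\<in>K. \<phi> x * k x) - e \<le> Re (\<Sum>x\<in>K. \<xi> x * k x)"
proof -
  note K' = finite_subgroupD[OF K]
  define \<eta> where "\<eta> = e / (1 + card K)"
  have \<eta>: "0 < \<eta>" "\<eta> * card K \<le> e" using e by (auto simp: \<eta>_def field_simps)
  define L where "L = (\<lambda>f. Re (\<Sum>x\<in>K. f x * k x))"
  define N where "N = (\<lambda>f::'a \<Rightarrow> complex. \<Sum>x\<in>K. (cmod (f x))\<^sup>2)"
  have c: "continuous_on A (\<lambda>f::'a \<Rightarrow> complex. f x)" for x A
    by (rule continuous_on_subset[OF continuous_on_product_coordinates]) auto
  have "continuous_on (states K) (\<lambda>f. L f + \<eta> * N f)"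
    unfolding L_def N_def by (intro continuous_intros c)
  then obtain \<xi> where \<xi>: "\<xi> \<in> states K" and max: "\<And>f. f \<in> states K \<Longrightarrow> L f + \<eta> * N f \<le> L \<xi> + \<eta> * N \<xi>"
    using continuous_attains_sup[OF compact_states[OF K], of "\<lambda>f. L f + \<eta> * N f"] \<phi> by blast
  have p: "pos_def_on K \<xi>" and one: "\<xi> 0 = 1" and out: "\<And>x. x \<notin> K \<Longrightarrow> \<xi> x = 0"
    using \<xi> by (auto simp: states_def)
  have bnd: "cmod (\<xi> x) \<le> 1" if "x \<in> K" for x using pos_def_bound[OF K p that] one by simp
  have h: "\<And>x. x \<in> K \<Longrightarrow> \<xi> (- x) = cnj (\<xi> x)" using p by (auto simp: pos_def_on_def)
  have N0: "0 \<le> N f" for f unfolding N_def by (simp add: sum_nonneg)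
  have N1: "N \<xi> \<le> card K"
    unfolding N_def using sum_mono[of K "\<lambda>x. (cmod (\<xi> x))\<^sup>2" "\<lambda>_. 1"] bnd
    by (simp add: power_le_one)
  have key: "1/2 * (a * \<xi> (x + t) + cnj a * \<xi> (x - t)) = Re (a * \<xi> t) * \<xi> x"
    if x: "x \<in> K" and t: "t \<in> K" and a: "cmod a = 1" for x t a
  proof -
    define r where "r = Re (a * \<xi> t)"
    have r: "\<bar>r\<bar> \<le> 1"
      unfolding r_def using abs_Re_le_cmod[of "a * \<xi> t"] bnd[OF t] a by (simp add: norm_mult)
    define \<psi> where "\<psi> = (\<lambda>b x. 5/4 * \<xi> x + 1/2 * (b * \<xi> (x + t) + cnj b * \<xi> (x - t)))"
    have \<psi>0: "\<psi> b 0 = 5/4 + Re (b * \<xi> t)" for b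
      using h[OF t] one by (simp add: \<psi>_def complex_eq_iff)
    have st: "(\<lambda>x. of_real (1 / (5/4 + Re (b * \<xi> t))) * \<psi> b x) \<in> states K"
      if b: "cmod b = 1" for b
    proof -
      have rb: "\<bar>Re (b * \<xi> t)\<bar> \<le> 1"
        using abs_Re_le_cmod[of "b * \<xi> t"] bnd[OF t] b by (simp add: norm_mult)
      have "pos_def_on K (\<lambda>x. of_real (1 / (5/4 + Re (b * \<xi> t))) * \<psi> b x)"
        unfolding \<psi>_def by (intro pos_def_scale pos_def_shift K p t b) (use rb in auto)
      moreover have "of_real (1 / (5/4 + Re (b * \<xi> t))) * \<psi> b 0 = 1"
      proof -
        have "\<psi> b 0 = of_real (5/4 + Re (b * \<xi> t))" using \<psi>0[of b] by simp
        moreover have "5/4 + Re (b * \<xi> t) \<noteq> 0" using rb by linarith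
        ultimately show ?thesis by (simp only: flip: of_real_mult) simp
      qed
      moreover have "\<psi> b x = 0" if "x \<notin> K" for x
      proof -
        have "x + t \<notin> K" "x - t \<notin> K"
          using K'(4)[of "x + t" t] K'(5)[of "x - t" t] t that by auto
        then show ?thesis using that by (simp add: \<psi>_def out)
      qed
      ultimately show ?thesis by (auto simp: states_def)
    qed
    define P where "P = (\<lambda>x. of_real (1 / (5/4 + r)) * \<psi> a x)"
    define Q where "Q = (\<lambda>x. of_real (1 / (5/4 - r)) * \<psi> (- a) x)"
    have neg: "5/4 + Re (- a * \<xi> t) = 5/4 - Re (a * \<xi> t)" by simp
    have PQ: "P \<in> states K" "Q \<in> states K"
      using st[OF a] st[of "- a", unfolded neg] a unfolding P_def Q_def r_def by simp_all
    \<comment> \<open>The two values at 0 add up to 5/2, and s is the share of the first one.\<close>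
    define s where "s = (5/4 + r) / (5/2)"
    have s: "0 < s" "s < 1" using r by (auto simp: s_def)
    have "of_real s * P x + of_real (1 - s) * Q x = \<xi> x" for x
    proof -
      have "s * (1 / (5/4 + r)) = 2/5" "(1 - s) * (1 / (5/4 - r)) = 2/5"
        using r by (auto simp: s_def field_simps)
      then have "of_real s * P x = of_real (2/5) * \<psi> a x" "of_real (1 - s) * Q x = of_real (2/5) * \<psi> (- a) x"
        unfolding P_def Q_def mult.assoc[symmetric] of_real_mult[symmetric] by (simp_all only:)
      then have "of_real s * P x + of_real (1 - s) * Q x =
          of_real (2/5) * \<psi> a x + of_real (2/5) * \<psi> (- a) x" by (simp only:)
      also have "\<dots> = \<xi> x" by (simp add: \<psi>_def algebra_simps)
      finally show ?thesis .
    qed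
    then have dec: "\<xi> x = of_real s * P x + of_real (1 - s) * Q x" for x by simp
    have L: "L \<xi> = s * L P + (1 - s) * L Q"
    proof -
      have "(\<Sum>x\<in>K. \<xi> x * k x) = of_real s * (\<Sum>x\<in>K. P x * k x) + of_real (1 - s) * (\<Sum>x\<in>K. Q x * k x)"
        unfolding sum_distrib_left sum.distrib[symmetric]
        by (intro sum.cong refl) (simp add: dec distrib_right mult.assoc)
      then show ?thesis unfolding L_def by (simp only: plus_complex.sel Re_complex_of_real) simp
    qed
    have N: "N \<xi> = s * N P + (1 - s) * N Q - s * (1 - s) * N (\<lambda>x. P x - Q x)"
      unfolding N_def sum_distrib_left sum.distrib[symmetric] sum_subtractf[symmetric]
      by (intro sum.cong refl) (simp only: dec convex_combination_norm_square)
    have "L \<xi> + \<eta> * N \<xi> = s * (L P + \<eta> * N P) + (1 - s) * (L Q + \<eta> * N Q)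
        - \<eta> * (s * (1 - s) * N (\<lambda>x. P x - Q x))"
      unfolding L N by (simp add: algebra_simps)
    also have "\<dots> \<le> s * (L \<xi> + \<eta> * N \<xi>) + (1 - s) * (L \<xi> + \<eta> * N \<xi>)
        - \<eta> * (s * (1 - s) * N (\<lambda>x. P x - Q x))"
      using mult_left_mono[OF max[OF PQ(1)], of s] mult_left_mono[OF max[OF PQ(2)], of "1 - s"] s by linarith
    finally have "\<eta> * (s * (1 - s) * N (\<lambda>x. P x - Q x)) \<le> 0" by (simp add: algebra_simps)
    then have "N (\<lambda>x. P x - Q x) \<le> 0" using \<eta> s by (simp add: mult_le_0_iff)
    then have "N (\<lambda>x. P x - Q x) = 0" using N0 by (simp add: order_antisym)
    then have "P x = Q x"
      unfolding N_def using x K'(1) by (simp add: sum_nonneg_eq_0_iff)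
    then have "\<xi> x = P x" using dec[of x] by (simp add: algebra_simps)
    then have "of_real (5/4 + r) * \<xi> x = \<psi> a x"
    proof -
      have "5/4 + r \<noteq> 0" using r by linarith
      then have "of_real (5/4 + r) * P x = \<psi> a x"
        unfolding P_def mult.assoc[symmetric] of_real_mult[symmetric] by simp
      then show ?thesis using \<open>\<xi> x = P x\<close> by simp
    qed
    then show ?thesis by (simp add: \<psi>_def r_def algebra_simps)
  qed
  have mult: "\<xi> (x + t) = \<xi> x * \<xi> t" if x: "x \<in> K" and t: "t \<in> K" for x t
  proof -
    have 1: "1/2 * (\<xi> (x + t) + \<xi> (x - t)) = Re (\<xi> t) * \<xi> x"
      using key[OF x t, of 1] by simp
    have 2: "1/2 * (\<i> * \<xi> (x + t) - \<i> * \<xi> (x - t)) = - Im (\<xi> t) * \<xi> x"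
      using key[OF x t, of \<i>] by simp
    have "\<xi> (x + t) = 1/2 * (\<xi> (x + t) + \<xi> (x - t)) - \<i> * (1/2 * (\<i> * \<xi> (x + t) - \<i> * \<xi> (x - t)))"
      by (simp add: algebra_simps)
    also have "\<dots> = (Re (\<xi> t) + \<i> * Im (\<xi> t)) * \<xi> x" unfolding 1 2 by (simp add: algebra_simps)
    also have "\<dots> = \<xi> x * \<xi> t" by (simp add: complex_eq[symmetric])
    finally show ?thesis .
  qed
  have "cmod (\<xi> x) = 1" if x: "x \<in> K" for x
  proof -
    have "\<xi> x * cnj (\<xi> x) = 1" using mult[OF x K'(3)[OF x]] one h[OF x] by simp
    then have "of_real ((cmod (\<xi> x))\<^sup>2) = (1::complex)" by (simp only: complex_norm_square)
    then have "(cmod (\<xi> x))\<^sup>2 = 1" by (simp only: of_real_eq_1_iff)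
    then show ?thesis by (simp add: power2_eq_1_iff) (metis norm_ge_zero not_one_le_zero zero_le_one neg_0_le_iff_le)
  qed
  moreover have "L \<phi> - e \<le> L \<xi>"
  proof -
    have "L \<phi> \<le> L \<phi> + \<eta> * N \<phi>" using \<eta> N0[of \<phi>] by simp
    also have "\<dots> \<le> L \<xi> + \<eta> * N \<xi>" by (rule max[OF \<phi>])
    also have "\<dots> \<le> L \<xi> + \<eta> * card K" using N1 \<eta> by simp
    finally show ?thesis using \<eta> by linarith
  qed
  ultimately show thesis using mult that unfolding L_def by blast
qed

section \<open>Separating characters on finite subgroups, with uniform bounds\<close>

lemma pos_def_autocorrelation:
  fixes f :: "'a::ab_group_add \<Rightarrow> real"
  assumes K: "finite_subgroup K"
  shows "pos_def_on K (\<lambda>x. of_real (\<Sum>y\<in>K. f (x + y) * f y))"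
proof -
  note K' = finite_subgroupD[OF K]
  have "(\<Sum>y\<in>K. f (- x + y) * f y) = (\<Sum>y\<in>K. f (x + y) * f y)" if "x \<in> K" for x
    using sum_translate[OF K that, of "\<lambda>y. f (- x + y) * f y"] by (simp add: add.commute mult.commute)
  moreover have "0 \<le> Re (\<Sum>x\<in>K. \<Sum>y\<in>K. c x * cnj (c y) * of_real (\<Sum>z\<in>K. f (x - y + z) * f z))" for c
  proof -
    have "(\<Sum>x\<in>K. \<Sum>y\<in>K. c x * cnj (c y) * of_real (\<Sum>z\<in>K. f (x - y + z) * f z)) =
       (\<Sum>x\<in>K. \<Sum>y\<in>K. c x * cnj (c y) * of_real (\<Sum>z\<in>K. f (x + z) * f (y + z)))"
    proof (intro sum.cong refl)
      fix x y assume "x \<in> K" "y \<in> K"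
      then show "c x * cnj (c y) * of_real (\<Sum>z\<in>K. f (x - y + z) * f z) =
        c x * cnj (c y) * of_real (\<Sum>z\<in>K. f (x + z) * f (y + z))"
        using sum_translate[OF K, of y "\<lambda>z. f (x - y + z) * f z"] by (simp add: algebra_simps)
    qed
    also have "\<dots> = (\<Sum>x\<in>K. \<Sum>y\<in>K. \<Sum>z\<in>K. c x * f (x + z) * cnj (c y * f (y + z)))"
      by (simp add: sum_distrib_left mult_ac)
    also have "\<dots> = (\<Sum>x\<in>K. \<Sum>z\<in>K. \<Sum>y\<in>K. c x * f (x + z) * cnj (c y * f (y + z)))"
      by (intro sum.cong refl sum.swap)
    also have "\<dots> = (\<Sum>z\<in>K. \<Sum>x\<in>K. \<Sum>y\<in>K. c x * f (x + z) * cnj (c y * f (y + z)))"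
      by (rule sum.swap)
    also have "\<dots> = (\<Sum>z\<in>K. (\<Sum>x\<in>K. c x * f (x + z)) * cnj (\<Sum>y\<in>K. c y * f (y + z)))"
      by (simp only: cnj_sum sum_product)
    also have "\<dots> = of_real (\<Sum>z\<in>K. (cmod (\<Sum>x\<in>K. c x * f (x + z)))\<^sup>2)"
      by (simp only: complex_norm_square of_real_sum)
    finally show ?thesis by (simp only: Re_complex_of_real) (simp add: sum_nonneg)
  qed
  ultimately show ?thesis unfolding pos_def_on_def by simp
qed

lemma sum_square_le:
  fixes f :: "'a \<Rightarrow> real"
  assumes "finite K"
  shows "(\<Sum>x\<in>K. f x)\<^sup>2 \<le> card K * (\<Sum>x\<in>K. (f x)\<^sup>2)"
  using Cauchy_Schwarz_ineq_sum[of "\<lambda>_. 1" f K] by simp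

text \<open>
  The constants depend only on the number of translates of \<open>{f \<ge> 1/2}\<close> that cover the group, and
  not on \<open>K\<close>. With \<open>F\<close> the autocorrelation of \<open>f\<close> on \<open>K\<close> and \<open>c\<close> the correlation of \<open>f\<close> with a
  character \<open>\<eta>\<close> of \<open>K\<close>, the functional with kernel \<open>k(x) = F(x) - F(x - g)/2 - F(x + g)/2\<close> has
  the value \<open>|c|\<^sup>2 (1 - Re \<eta>(g))\<close> at \<open>\<eta>\<close>. At the normalized \<open>F\<close> it is large: \<open>g\<close> moves the support of
  \<open>F\<close> off itself, so only the sum of the squares of \<open>F\<close> remains, and the covering bounds the mean
  of \<open>f\<close> from below. Hence some \<open>\<eta>\<close> satisfies both lower bounds at once.

  The function \<open>\<xi>\<close> extends \<open>\<eta>\<close> from \<open>K\<close> to the whole group as the normalized convolution of \<open>\<eta>\<close>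
  with \<open>f\<close>, which inherits the modulus of continuity of \<open>f\<close>.
\<close>

lemma finite_subgroup_separating_function:
  fixes f :: "'a::ab_group_add \<Rightarrow> real"
  assumes K: "finite_subgroup K" and T: "T \<subseteq> K" "T \<noteq> {}" and g: "g \<in> K"
    and f01: "\<And>x. 0 \<le> f x" "\<And>x. f x \<le> 1"
    and cover: "\<And>x. \<exists>t\<in>T. 1/2 \<le> f (x - t)"
    and disj: "\<And>a b c d. f a \<noteq> 0 \<Longrightarrow> f b \<noteq> 0 \<Longrightarrow> f c \<noteq> 0 \<Longrightarrow> f d \<noteq> 0 \<Longrightarrow> a - b - (c - d) \<noteq> g"
  defines "\<delta> \<equiv> (1 / (2 * card T)) ^ 4 / 2" and "\<epsilon> \<equiv> sqrt ((1 / (2 * card T)) ^ 4 / 4)"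
  shows "\<exists>\<xi>. (\<forall>x\<in>K. \<forall>y\<in>K. \<xi> (x + y) = \<xi> x * \<xi> y) \<and> (\<forall>x\<in>K. cmod (\<xi> x) = 1) \<and>
      \<delta> \<le> 1 - Re (\<xi> g) \<and> (\<forall>x. cmod (\<xi> x) \<le> 1 / \<epsilon>) \<and>
      (\<forall>x x' w. (\<forall>y. \<bar>f (y - x) - f (y - x')\<bar> \<le> w) \<longrightarrow> cmod (\<xi> x - \<xi> x') \<le> w / \<epsilon>)"
proof -
  note K' = finite_subgroupD[OF K]
  have finT: "finite T" by (rule finite_subset[OF T(1) K'(1)])
  define n where "n = real (card K)"
  have n: "0 < n" using K'(1,2) by (auto simp: n_def card_gt_0_iff)
  define \<alpha> where "\<alpha> = 1 / (2 * real (card T))"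
  have \<alpha>: "0 < \<alpha>" using T finT by (simp add: \<alpha>_def card_gt_0_iff)
  have \<delta>: "\<delta> = \<alpha> ^ 4 / 2" "0 < \<delta>" and \<epsilon>: "\<epsilon>\<^sup>2 = \<delta> / 2" "0 < \<epsilon>"
    using \<alpha> by (simp_all add: \<delta>_def \<epsilon>_def \<alpha>_def power_divide)
  have mass: "n * \<alpha> \<le> (\<Sum>x\<in>K. f x)"
  proof -
    have "n / 2 = (\<Sum>x\<in>K. 1/2)" by (simp add: n_def)
    also have "\<dots> \<le> (\<Sum>x\<in>K. \<Sum>t\<in>T. f (x - t))"
    proof (rule sum_mono)
      fix x
      obtain t where t: "t \<in> T" "1/2 \<le> f (x - t)" using cover by blast
      note t(2)
      also have "f (x - t) \<le> (\<Sum>t\<in>T. f (x - t))"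
        by (rule member_le_sum) (use t f01 finT in auto)
      finally show "1/2 \<le> (\<Sum>t\<in>T. f (x - t))" .
    qed
    also have "\<dots> = (\<Sum>t\<in>T. \<Sum>x\<in>K. f (x - t))" by (rule sum.swap)
    also have "\<dots> = (\<Sum>t\<in>T. \<Sum>x\<in>K. f x)"
    proof (rule sum.cong[OF refl])
      fix t assume "t \<in> T"
      then show "(\<Sum>x\<in>K. f (x - t)) = (\<Sum>x\<in>K. f x)"
        using sum_translate[OF K K'(3), of t f] T by auto
    qed
    finally have "n / 2 \<le> card T * (\<Sum>x\<in>K. f x)" by simp
    then show ?thesis using T finT by (simp add: \<alpha>_def field_simps card_gt_0_iff)
  qed
  define F where "F = (\<lambda>x. \<Sum>y\<in>K. f (x + y) * f y)"
  have F0: "0 \<le> F x" for x by (auto simp: F_def f01 intro: sum_nonneg)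
  have Fn: "F 0 \<le> n"
    using sum_mono[of K "\<lambda>y. f (0 + y) * f y" "\<lambda>_. 1"] f01 by (simp add: F_def n_def mult_le_one)
  have Fsum: "(\<Sum>x\<in>K. F x) = (\<Sum>x\<in>K. f x)\<^sup>2"
  proof -
    have "(\<Sum>x\<in>K. F x) = (\<Sum>y\<in>K. \<Sum>x\<in>K. f (x + y) * f y)" unfolding F_def by (rule sum.swap)
    also have "\<dots> = (\<Sum>y\<in>K. (\<Sum>x\<in>K. f x) * f y)"
    proof (rule sum.cong[OF refl])
      fix y assume "y \<in> K"
      then show "(\<Sum>x\<in>K. f (x + y) * f y) = (\<Sum>x\<in>K. f x) * f y"
        using sum_translate[OF K, of y f] by (simp add: sum_distrib_right[symmetric])
    qed
    finally show ?thesis by (simp add: power2_eq_square sum_distrib_left[symmetric])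
  qed
  have Fsq: "n ^ 3 * \<alpha> ^ 4 \<le> (\<Sum>x\<in>K. (F x)\<^sup>2)"
  proof -
    have "n * (n ^ 3 * \<alpha> ^ 4) = (n * \<alpha>) ^ 4" by (simp add: power_mult_distrib eval_nat_numeral)
    also have "\<dots> \<le> (\<Sum>x\<in>K. f x) ^ 4" using mass n \<alpha> by (intro power_mono) auto
    also have "\<dots> = (\<Sum>x\<in>K. F x)\<^sup>2" by (simp add: Fsum)
    also have "\<dots> \<le> n * (\<Sum>x\<in>K. (F x)\<^sup>2)" unfolding n_def by (rule sum_square_le[OF K'(1)])
    finally show ?thesis using n by simp
  qed
  have F0pos: "0 < F 0"
  proof (rule ccontr)
    assume "\<not> 0 < F 0"
    then have "F 0 = 0" using F0[of 0] by simp
    then have "\<And>y. y \<in> K \<Longrightarrow> f y = 0"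
      unfolding F_def using K'(1) by (simp add: sum_nonneg_eq_0_iff f01)
    then show False using mass n \<alpha> by (simp add: mult_le_0_iff)
  qed
  define \<phi> where "\<phi> = (\<lambda>x. if x \<in> K then of_real (1 / F 0) * complex_of_real (F x) else 0)"
  have \<phi>: "\<phi> \<in> states K"
  proof -
    have "pos_def_on K (\<lambda>x. of_real (1 / F 0) * complex_of_real (F x))"
      using F0pos pos_def_scale[OF pos_def_autocorrelation[OF K, of f], of "1 / F 0"]
      by (simp add: F_def)
    then have "pos_def_on K \<phi>"
      using K'(3,4) by (simp add: pos_def_on_def \<phi>_def cong: sum.cong)
    then show ?thesis using F0pos K'(2) by (simp add: states_def \<phi>_def flip: of_real_mult)
  qed
  \<comment> \<open>F is even on K, so testing against k pairs F with the second difference of F in direction g.\<close>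
  define k where "k = (\<lambda>x. complex_of_real (F x - F (x - g) / 2 - F (x + g) / 2))"
  have Fsupp: "\<exists>a b. f a \<noteq> 0 \<and> f b \<noteq> 0 \<and> x = a - b" if Fx: "F x \<noteq> 0" for x
  proof -
    obtain y where "f (x + y) * f y \<noteq> 0"
      using Fx unfolding F_def by (rule sum.not_neutral_contains_not_neutral)
    then show ?thesis by (intro exI[of _ "x + y"] exI[of _ y]) auto
  qed
  have kF: "F x * (F x - F (x - g) / 2 - F (x + g) / 2) = (F x)\<^sup>2" for x
  proof -
    have "F x * F (x - g) = 0"
    proof (rule ccontr)
      assume "F x * F (x - g) \<noteq> 0"
      then obtain a b c d where nz: "f a \<noteq> 0" "f b \<noteq> 0" "f c \<noteq> 0" "f d \<noteq> 0"
        and eq: "x = a - b" "x - g = c - d"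
        using Fsupp[of x] Fsupp[of "x - g"] by (metis mult_zero_left mult_zero_right)
      have "a - b - (c - d) = x - (x - g)" unfolding eq(2) unfolding eq(1) ..
      also have "\<dots> = g" by simp
      finally show False using disj[OF nz] by blast
    qed
    moreover have "F x * F (x + g) = 0"
    proof (rule ccontr)
      assume "F x * F (x + g) \<noteq> 0"
      then obtain a b c d where nz: "f a \<noteq> 0" "f b \<noteq> 0" "f c \<noteq> 0" "f d \<noteq> 0"
        and eq: "x = a - b" "x + g = c - d"
        using Fsupp[of x] Fsupp[of "x + g"] by (metis mult_zero_left mult_zero_right)
      have "c - d - (a - b) = x + g - x" unfolding eq(2) unfolding eq(1) ..
      also have "\<dots> = g" by simp
      finally show False using disj[OF nz(3,4,1,2)] by blast
    qed
    ultimately show ?thesis by (auto simp: power2_eq_square right_diff_distrib)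
  qed
  have L\<phi>: "n\<^sup>2 * \<alpha> ^ 4 \<le> Re (\<Sum>x\<in>K. \<phi> x * k x)"
  proof -
    have "(\<Sum>x\<in>K. \<phi> x * k x) = (\<Sum>x\<in>K. of_real (1 / F 0 * (F x)\<^sup>2))"
      unfolding kF[symmetric] by (intro sum.cong refl) (simp add: \<phi>_def k_def)
    then have eq: "Re (\<Sum>x\<in>K. \<phi> x * k x) = 1 / F 0 * (\<Sum>x\<in>K. (F x)\<^sup>2)"
      by (simp only: sum_distrib_left Re_sum Re_complex_of_real)
    have "n\<^sup>2 * \<alpha> ^ 4 = 1 / n * (n ^ 3 * \<alpha> ^ 4)" using n by (simp add: eval_nat_numeral)
    also have "\<dots> \<le> 1 / F 0 * (\<Sum>x\<in>K. (F x)\<^sup>2)"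
      using Fsq Fn F0pos n \<alpha> by (intro mult_mono) (auto simp: frac_le)
    finally show ?thesis unfolding eq .
  qed
  have "0 < n\<^sup>2 * \<delta>" using n \<delta> by simp
  from finite_subgroup_character_near_state[OF K \<phi> this, of k]
  obtain \<eta> where \<eta>: "\<And>x y. x \<in> K \<Longrightarrow> y \<in> K \<Longrightarrow> \<eta> (x + y) = \<eta> x * \<eta> y"
    "\<And>x. x \<in> K \<Longrightarrow> cmod (\<eta> x) = 1"
    and ge: "Re (\<Sum>x\<in>K. \<phi> x * k x) - n\<^sup>2 * \<delta> \<le> Re (\<Sum>x\<in>K. \<eta> x * k x)" by blast
  have \<eta>0: "\<eta> 0 = 1"
  proof -
    have "\<eta> 0 * \<eta> 0 = \<eta> 0" "\<eta> 0 \<noteq> 0" using \<eta>(1)[of 0 0] \<eta>(2)[of 0] K'(2) by auto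
    then show ?thesis by simp
  qed
  have \<eta>m: "\<eta> (- x) = cnj (\<eta> x)" if "x \<in> K" for x
  proof -
    have "\<eta> x * \<eta> (- x) = 1" using \<eta>(1)[OF that K'(3)[OF that]] \<eta>0 by simp
    moreover have "\<eta> x * cnj (\<eta> x) = 1" using \<eta>(2)[OF that] by (simp flip: complex_norm_square)
    ultimately show ?thesis by (metis mult_cancel_left mult_zero_left zero_neq_one)
  qed
  \<comment> \<open>With f real, c is the Fourier coefficient of f at the conjugate of \<eta>.\<close>
  define c where "c = (\<Sum>y\<in>K. of_real (f y) * \<eta> y)"
  have c_le: "cmod c \<le> n"
  proof -
    have "cmod c \<le> (\<Sum>y\<in>K. 1)" unfolding c_def
      by (rule order_trans[OF norm_sum sum_mono]) (use \<eta>(2) f01 in \<open>simp add: norm_mult\<close>)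
    then show ?thesis by (simp add: n_def)
  qed
  have conv: "(\<Sum>y\<in>K. of_real (f (y - x)) * \<eta> y) = \<eta> x * c" if x: "x \<in> K" for x
  proof -
    have "(\<Sum>y\<in>K. of_real (f (y - x)) * \<eta> y) = (\<Sum>y\<in>K. of_real (f y) * \<eta> (y + x))"
      using sum_translate[OF K x, of "\<lambda>y. of_real (f (y - x)) * \<eta> y"] by simp
    also have "\<dots> = \<eta> x * c" unfolding c_def sum_distrib_left
      by (intro sum.cong refl) (simp add: \<eta>(1) x)
    finally show ?thesis .
  qed
  have FF: "(\<Sum>x\<in>K. \<eta> x * of_real (F x)) = of_real ((cmod c)\<^sup>2)"
  proof -
    have "(\<Sum>x\<in>K. \<eta> x * of_real (F x)) = (\<Sum>x\<in>K. \<Sum>y\<in>K. \<eta> x * of_real (f (x + y)) * of_real (f y))"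
      unfolding F_def by (simp add: sum_distrib_left mult_ac)
    also have "\<dots> = (\<Sum>y\<in>K. \<Sum>x\<in>K. \<eta> x * of_real (f (x + y)) * of_real (f y))" by (rule sum.swap)
    also have "\<dots> = (\<Sum>y\<in>K. c * cnj (of_real (f y) * \<eta> y))"
    proof (rule sum.cong[OF refl])
      fix y assume y: "y \<in> K"
      have "(\<Sum>x\<in>K. \<eta> x * of_real (f (x + y)) * of_real (f y)) =
          (\<Sum>x\<in>K. of_real (f (x - (- y))) * \<eta> x) * of_real (f y)"
        unfolding sum_distrib_right by (intro sum.cong refl) (simp add: mult_ac)
      also have "\<dots> = \<eta> (- y) * c * of_real (f y)" unfolding conv[OF K'(3)[OF y]] ..
      also have "\<dots> = c * cnj (of_real (f y) * \<eta> y)" by (simp add: \<eta>m[OF y])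
      finally show "(\<Sum>x\<in>K. \<eta> x * of_real (f (x + y)) * of_real (f y)) = c * cnj (of_real (f y) * \<eta> y)" .
    qed
    also have "\<dots> = c * cnj c" by (simp add: c_def sum_distrib_left)
    finally show ?thesis by (simp only: complex_norm_square)
  qed
  have shift: "(\<Sum>x\<in>K. \<eta> x * of_real (F (x - h))) = \<eta> h * of_real ((cmod c)\<^sup>2)" if h: "h \<in> K" for h
  proof -
    have "(\<Sum>x\<in>K. \<eta> x * of_real (F (x - h))) = (\<Sum>x\<in>K. \<eta> (x + h) * of_real (F x))"
      using sum_translate[OF K h, of "\<lambda>x. \<eta> x * of_real (F (x - h))"] by simp
    also have "\<dots> = \<eta> h * (\<Sum>x\<in>K. \<eta> x * of_real (F x))" unfolding sum_distrib_left
      by (intro sum.cong refl) (simp add: \<eta>(1) h)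
    finally show ?thesis unfolding FF .
  qed
  have "(\<Sum>x\<in>K. \<eta> x * k x) = (\<Sum>x\<in>K. \<eta> x * of_real (F x)) - (\<Sum>x\<in>K. \<eta> x * of_real (F (x - g))) / 2
      - (\<Sum>x\<in>K. \<eta> x * of_real (F (x - (- g)))) / 2"
    unfolding sum_divide_distrib sum_subtractf[symmetric]
    by (intro sum.cong refl) (simp add: k_def right_diff_distrib)
  also have "\<dots> = of_real ((cmod c)\<^sup>2) * (1 - (\<eta> g + cnj (\<eta> g)) / 2)"
    unfolding FF shift[OF g] shift[OF K'(3)[OF g]] \<eta>m[OF g] by (simp add: field_simps)
  also have "\<dots> = of_real ((cmod c)\<^sup>2 * (1 - Re (\<eta> g)))"
    unfolding complex_add_cnj by simp
  finally have "Re (\<Sum>x\<in>K. \<eta> x * k x) = (cmod c)\<^sup>2 * (1 - Re (\<eta> g))"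
    by (simp only: Re_complex_of_real)
  then have main: "n\<^sup>2 * \<delta> \<le> (cmod c)\<^sup>2 * (1 - Re (\<eta> g))"
  proof -
    have "n\<^sup>2 * \<alpha> ^ 4 = 2 * (n\<^sup>2 * \<delta>)" using \<delta>(1) by simp
    with \<open>Re (\<Sum>x\<in>K. \<eta> x * k x) = _\<close> ge L\<phi> show ?thesis by linarith
  qed
  have Re1: "\<bar>Re (\<eta> g)\<bar> \<le> 1" using abs_Re_le_cmod[of "\<eta> g"] \<eta>(2)[OF g] by simp
  have "(cmod c)\<^sup>2 * (1 - Re (\<eta> g)) \<le> n\<^sup>2 * (1 - Re (\<eta> g))"
    using c_le Re1 by (intro mult_right_mono power_mono) auto
  with main have "n\<^sup>2 * \<delta> \<le> n\<^sup>2 * (1 - Re (\<eta> g))" by simp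
  then have g_ge: "\<delta> \<le> 1 - Re (\<eta> g)" using n by simp
  have "(cmod c)\<^sup>2 * (1 - Re (\<eta> g)) \<le> (cmod c)\<^sup>2 * 2"
    using Re1 by (intro mult_left_mono) auto
  with main have "n\<^sup>2 * \<epsilon>\<^sup>2 \<le> (cmod c)\<^sup>2" unfolding \<epsilon>(1) by simp
  then have "(n * \<epsilon>)\<^sup>2 \<le> (cmod c)\<^sup>2" by (simp add: power_mult_distrib)
  then have c_ge: "n * \<epsilon> \<le> cmod c" by (rule power2_le_imp_le) simp
  have c0: "0 < cmod c" using c_ge n \<epsilon>(2) mult_pos_pos[OF n \<epsilon>(2)] by linarith
  define \<xi> where "\<xi> = (\<lambda>x. (\<Sum>y\<in>K. of_real (f (y - x)) * \<eta> y) / c)"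
  have \<xi>\<eta>: "\<xi> x = \<eta> x" if "x \<in> K" for x
    using conv[OF that] c0 by (simp add: \<xi>_def)
  have bound: "cmod ((\<Sum>y\<in>K. of_real (h y) * \<eta> y) / c) \<le> w / \<epsilon>"
    if "\<And>y. \<bar>h y\<bar> \<le> w" for h w
  proof -
    have w: "0 \<le> w" using that[of 0] by linarith
    have "cmod (\<Sum>y\<in>K. of_real (h y) * \<eta> y) \<le> (\<Sum>y\<in>K. w)"
      by (rule order_trans[OF norm_sum sum_mono]) (use \<eta>(2) that in \<open>simp add: norm_mult\<close>)
    then have "cmod (\<Sum>y\<in>K. of_real (h y) * \<eta> y) / cmod c \<le> n * w / (n * \<epsilon>)"
      using c_ge n \<epsilon>(2) w by (intro frac_le) (auto simp: n_def)
    then show ?thesis using n by (simp add: norm_divide)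
  qed
  show ?thesis
  proof (intro exI[of _ \<xi>] conjI ballI allI impI)
    show "\<xi> (x + y) = \<xi> x * \<xi> y" if "x \<in> K" "y \<in> K" for x y
      using \<eta>(1)[OF that] \<xi>\<eta> K'(5)[OF that] that by simp
    show "cmod (\<xi> x) = 1" if "x \<in> K" for x using \<eta>(2) \<xi>\<eta> that by simp
    show "\<delta> \<le> 1 - Re (\<xi> g)" using g_ge \<xi>\<eta> g by simp
    show "cmod (\<xi> x) \<le> 1 / \<epsilon>" for x
      unfolding \<xi>_def by (rule bound) (use f01 in \<open>simp add: abs_le_iff order_trans[OF _ f01(1)]\<close>)
    show "cmod (\<xi> x - \<xi> x') \<le> w / \<epsilon>" if "\<forall>y. \<bar>f (y - x) - f (y - x')\<bar> \<le> w" for x x' w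
    proof -
      have "\<xi> x - \<xi> x' = (\<Sum>y\<in>K. of_real (f (y - x) - f (y - x')) * \<eta> y) / c"
        by (simp add: \<xi>_def left_diff_distrib sum_subtractf diff_divide_distrib)
      then show ?thesis using bound[of "\<lambda>y. f (y - x) - f (y - x')" w] that by simp
    qed
  qed
qed

section \<open>Continuous characters separate the points of the group\<close>

text \<open>
  Every closed condition that holds eventually along a net passes to its cluster points. The limit
  of characters below is obtained by compactness of a product space that need not be metrizable,
  so filters replace subsequences.
\<close>

lemma cluster_value_in_closed:
  assumes "inf (nhds x) (filtermap s F) \<noteq> bot" "closed C" "eventually (\<lambda>j. s j \<in> C) F"
  shows "x \<in> C"
proof (rule ccontr)
  assume "x \<notin> C"
  then have "eventually (\<lambda>y. y \<in> - C) (nhds x)"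
    using assms(2) by (intro eventually_nhds_in_open) auto
  moreover have "eventually (\<lambda>y. y \<in> C) (filtermap s F)"
    using assms(3) by (simp add: eventually_filtermap)
  ultimately have "eventually (\<lambda>y. False) (inf (nhds x) (filtermap s F))"
    unfolding eventually_inf by (intro exI[of _ "\<lambda>y. y \<in> - C"] exI[of _ "\<lambda>y. y \<in> C"]) auto
  then show False using assms(1) by (simp add: trivial_limit_def)
qed

lemma exists_open_differences_subset:
  fixes W :: "'a::topological_ab_group_add set"
  assumes "open W" "0 \<in> W"
  obtains U where "open U" "0 \<in> U" "\<And>a b. a \<in> U \<Longrightarrow> b \<in> U \<Longrightarrow> a - b \<in> W"
proof -
  have "continuous_on UNIV (\<lambda>p::'a \<times> 'a. fst p - snd p)"
    by (intro continuous_intros)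
  then have "open ((\<lambda>p::'a \<times> 'a. fst p - snd p) -` W)"
    using assms(1) open_vimage by blast
  moreover have "(0, 0) \<in> (\<lambda>p::'a \<times> 'a. fst p - snd p) -` W" using assms(2) by simp
  ultimately obtain A B where AB: "open A" "open B" "(0, 0) \<in> A \<times> B"
    "A \<times> B \<subseteq> (\<lambda>p::'a \<times> 'a. fst p - snd p) -` W"
    by (rule open_prod_elim)
  show thesis
  proof (rule that[of "A \<inter> B"])
    show "a - b \<in> W" if "a \<in> A \<inter> B" "b \<in> A \<inter> B" for a b
      using AB(4) that by auto
  qed (use AB in auto)
qed

lemma open_translate:
  fixes U :: "'a::topological_ab_group_add set"
  assumes "open U"
  shows "open {x. a + x \<in> U}" "open {x. x + a \<in> U}" "open {x. x - a \<in> U}" "open {x. a - x \<in> U}"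
proof -
  have "open (f -` U)" if "continuous_on UNIV f" for f :: "'a \<Rightarrow> 'a"
    using assms that open_vimage by blast
  from this[of "\<lambda>x. a + x"] this[of "\<lambda>x. x + a"] this[of "\<lambda>x. x - a"] this[of "\<lambda>x. a - x"]
  show "open {x. a + x \<in> U}" "open {x. x + a \<in> U}" "open {x. x - a \<in> U}" "open {x. a - x \<in> U}"
    by (simp_all add: vimage_def continuous_intros)
qed

lemma finite_subset_increasing_Union:
  fixes K :: "nat \<Rightarrow> 'b set"
  assumes "\<And>j. K j \<subseteq> K (Suc j)" "finite T" "T \<subseteq> (\<Union>j. K j)"
  obtains j where "T \<subseteq> K j"
proof -
  have le: "i \<le> j \<Longrightarrow> K i \<subseteq> K j" for i j by (rule lift_Suc_mono_le[of K, OF assms(1)])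
  have "\<forall>t\<in>T. \<exists>i. t \<in> K i" using assms(3) by auto
  then obtain i where i: "\<And>t. t \<in> T \<Longrightarrow> t \<in> K (i t)" by metis
  have "t \<in> K (Max (i ` T))" if "t \<in> T" for t
    using i[OF that] le[of "i t" "Max (i ` T)"] assms(2) that by auto
  then show thesis using that by blast
qed

lemma uniformly_continuous_on_compact_group:
  fixes f :: "'a::topological_ab_group_add \<Rightarrow> 'b::metric_space"
  assumes "compact (UNIV :: 'a set)" "continuous_on UNIV f" "0 < e"
  obtains W where "open W" "0 \<in> W" "\<And>t x. t \<in> W \<Longrightarrow> dist (f (x + t)) (f x) \<le> e"
proof -
  have "continuous_on (UNIV \<times> UNIV) (\<lambda>p::'a \<times> 'a. f (snd p + fst p))"
    by (rule continuous_on_compose2[OF assms(2)]) (auto intro!: continuous_intros)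
  then obtain W where W: "0 \<in> W" "open W" and le: "\<forall>x\<in>W \<inter> UNIV. \<forall>t\<in>UNIV.
      dist (f (snd (x, t) + fst (x, t))) (f (snd (0::'a, t) + fst (0::'a, t))) \<le> e"
    by (rule continuous_on_prod_compactE[OF _ assms(1) UNIV_I[of 0] assms(3)])
  show thesis using that[OF W(2,1)] le by simp
qed

lemma compact_group_bump_function:
  fixes U :: "'a::{topological_ab_group_add, t2_space} set"
  assumes "compact (UNIV :: 'a set)" "closed C" "open U" "C \<subseteq> U"
  obtains f :: "'a \<Rightarrow> real" where "continuous_on UNIV f" "\<And>x. 0 \<le> f x" "\<And>x. f x \<le> 1"
    "\<And>x. x \<in> C \<Longrightarrow> f x = 1" "\<And>x. f x \<noteq> 0 \<Longrightarrow> x \<in> U"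
proof -
  have "compact_space (euclidean :: 'a topology)" using assms(1) by (simp add: compact_space_def)
  moreover have "Hausdorff_space (euclidean :: 'a topology)"
    unfolding Hausdorff_space_def using hausdorff[where 'a='a] by (auto simp: disjnt_def)
  ultimately have "normal_space (euclidean :: 'a topology)"
    by (intro compact_Hausdorff_or_regular_imp_normal_space) auto
  then obtain f where f: "continuous_map euclidean (top_of_set {0..1::real}) f"
    "f ` (- U) \<subseteq> {0}" "f ` C \<subseteq> {1}"
    using Urysohn_lemma[of "euclidean :: 'a topology" "- U" C 0 1] assms
    by (auto simp: disjnt_def)
  show thesis
  proof (rule that[of f])
    show "continuous_on UNIV f" using f(1) by (simp add: continuous_map_in_subtopology)
    show "0 \<le> f x" "f x \<le> 1" for x using f(1) by (auto simp: continuous_map_in_subtopology)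
  qed (use f in auto)
qed

text \<open>
  The functions of \<open>finite_subgroup_separating_function\<close> for \<open>K\<^sub>j\<close> are uniformly bounded, so they
  have a pointwise cluster point \<open>\<xi>\<close> by Tychonoff's theorem. Their common modulus of continuity makes
  \<open>\<xi>\<close> continuous, and \<open>\<xi>\<close> is multiplicative on the dense subgroup \<open>\<Union>K\<^sub>j\<close>, hence everywhere. The
  point \<open>g\<close> itself need not lie in this subgroup. It is approximated by a point \<open>g'\<close> of it, chosen
  so close that \<open>\<xi>\<close> changes by at most \<open>\<delta>/2\<close> between them, whereas \<open>|1 - \<xi>(g')| \<ge> \<delta>\<close>.
\<close>

proposition characters_separate_from_zero:
  fixes K :: "nat \<Rightarrow> 'a::{topological_ab_group_add, t2_space} set" and g :: 'a
  assumes comp: "compact (UNIV :: 'a set)" and K: "\<And>j. finite_subgroup (K j)"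
    and mono: "\<And>j. K j \<subseteq> K (Suc j)" and dense: "closure (\<Union>j. K j) = UNIV" and g: "g \<noteq> 0"
  obtains \<xi> where "\<xi> \<in> dual_group" "\<xi> g \<noteq> 1"
proof -
  have le: "i \<le> j \<Longrightarrow> K i \<subseteq> K j" for i j by (rule lift_Suc_mono_le[of K, OF mono])
  have meets: "\<exists>h\<in>(\<Union>j. K j). h \<in> O'" if "open O'" "O' \<noteq> {}" for O'
    using open_Int_closure_eq_empty[OF that(1), of "\<Union>j. K j"] that(2) unfolding dense by auto
  obtain O0 Og where O: "open O0" "open Og" "0 \<in> O0" "g \<in> Og" "O0 \<inter> Og = {}"
    using hausdorff[of 0 g] g by metis
  obtain U1 where U1: "open U1" "0 \<in> U1" "\<And>a b. a \<in> U1 \<Longrightarrow> b \<in> U1 \<Longrightarrow> a - b \<in> O0"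
    using exists_open_differences_subset[OF O(1,3)] by blast
  obtain U where U: "open U" "0 \<in> U" "\<And>a b. a \<in> U \<Longrightarrow> b \<in> U \<Longrightarrow> a - b \<in> U1"
    using exists_open_differences_subset[OF U1(1,2)] by blast
  obtain f :: "'a \<Rightarrow> real" where f: "continuous_on UNIV f" "\<And>x. 0 \<le> f x" "\<And>x. f x \<le> 1"
    "f 0 = 1" "\<And>x. f x \<noteq> 0 \<Longrightarrow> x \<in> U"
    using compact_group_bump_function[OF comp closed_singleton[of 0] U(1)] U(2)
    by (metis empty_subsetI insert_subset singletonI)
  obtain T where T: "T \<subseteq> (\<Union>j. K j)" "finite T" "T \<noteq> {}" "\<And>x. \<exists>t\<in>T. 1/2 \<le> f (x - t)"
  proof -
    define O2 where "O2 = {x. 1/2 < f x}"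
    have O2: "open O2" "0 \<in> O2"
      unfolding O2_def using f by (auto intro!: open_Collect_less continuous_intros)
    have "UNIV \<subseteq> (\<Union>h\<in>(\<Union>j. K j). {x. x - h \<in> O2})"
    proof
      fix x
      have "open {h. x - h \<in> O2}" "{h. x - h \<in> O2} \<noteq> {}"
        using open_translate(4)[OF O2(1), of x] O2(2) by (auto intro!: exI[of _ x])
      from meets[OF this] show "x \<in> (\<Union>h\<in>(\<Union>j. K j). {x. x - h \<in> O2})" by auto
    qed
    then obtain T where T: "T \<subseteq> (\<Union>j. K j)" "finite T" "UNIV \<subseteq> (\<Union>h\<in>T. {x. x - h \<in> O2})"
      by (rule compactE_image[OF comp, rotated]) (use open_translate(3)[OF O2(1)] in auto)
    show thesis
    proof (rule that[OF T(1,2)])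
      show "T \<noteq> {}" using T(3) by auto
      show "\<exists>t\<in>T. 1/2 \<le> f (x - t)" for x using T(3) unfolding O2_def by (auto simp: subset_eq) (metis less_imp_le)
    qed
  qed
  define \<delta> where "\<delta> = (1 / real (2 * card T)) ^ 4 / 2"
  define \<epsilon> where "\<epsilon> = sqrt ((1 / real (2 * card T)) ^ 4 / 4)"
  have pos: "0 < \<delta>" "0 < \<epsilon>" using T by (simp_all add: \<delta>_def \<epsilon>_def card_gt_0_iff)
  obtain W where W: "open W" "0 \<in> W" "\<And>t x. t \<in> W \<Longrightarrow> dist (f (x + t)) (f x) \<le> \<epsilon> * \<delta> / 2"
    by (rule uniformly_continuous_on_compact_group[OF comp f(1), of "\<epsilon> * \<delta> / 2"]) (use pos in auto)
  \<comment> \<open>The constants \<delta> and \<epsilon>, and with them W, are fixed before g' is chosen.\<close>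
  have "open (Og \<inter> {h. h - g \<in> W})" "Og \<inter> {h. h - g \<in> W} \<noteq> {}"
    using open_translate(3)[OF W(1), of g] O W(2) by (auto intro!: exI[of _ g])
  from meets[OF this] obtain g' j1 where g': "g' \<in> K j1" "g' \<in> Og" "g' - g \<in> W" by auto
  obtain j2 where j2: "T \<subseteq> K j2"
    using finite_subset_increasing_Union[OF mono T(2,1)] by blast
  define J where "J = max j1 j2"
  have disj: "a - b - (c - d) \<noteq> g'" if "f a \<noteq> 0" "f b \<noteq> 0" "f c \<noteq> 0" "f d \<noteq> 0" for a b c d
    using U1(3)[OF U(3) U(3), of a b c d] f(5)[OF that(1)] f(5)[OF that(2)] f(5)[OF that(3)] f(5)[OF that(4)]
      O(5) g'(2) by auto
  have "\<exists>\<xi>. (\<forall>x\<in>K j. \<forall>y\<in>K j. \<xi> (x + y) = \<xi> x * \<xi> y) \<and> (\<forall>x\<in>K j. cmod (\<xi> x) = 1) \<and>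
      \<delta> \<le> 1 - Re (\<xi> g') \<and> (\<forall>x. cmod (\<xi> x) \<le> 1 / \<epsilon>) \<and>
      (\<forall>x x' w. (\<forall>y. \<bar>f (y - x) - f (y - x')\<bar> \<le> w) \<longrightarrow> cmod (\<xi> x - \<xi> x') \<le> w / \<epsilon>)"
    if "J \<le> j" for j
  proof -
    have "T \<subseteq> K j" "g' \<in> K j" using le[of j1 j] le[of j2 j] that j2 g' by (auto simp: J_def)
    show ?thesis
      using finite_subgroup_separating_function[OF K \<open>T \<subseteq> K j\<close> T(3) \<open>g' \<in> K j\<close> f(2,3) T(4) disj]
      unfolding \<delta>_def \<epsilon>_def .
  qed
  then have "\<forall>j. \<exists>\<xi>. J \<le> j \<longrightarrow> (\<forall>x\<in>K j. \<forall>y\<in>K j. \<xi> (x + y) = \<xi> x * \<xi> y) \<and>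
      (\<forall>x\<in>K j. cmod (\<xi> x) = 1) \<and> \<delta> \<le> 1 - Re (\<xi> g') \<and> (\<forall>x. cmod (\<xi> x) \<le> 1 / \<epsilon>) \<and>
      (\<forall>x x' w. (\<forall>y. \<bar>f (y - x) - f (y - x')\<bar> \<le> w) \<longrightarrow> cmod (\<xi> x - \<xi> x') \<le> w / \<epsilon>)"
    by simp
  from choice[OF this] obtain s where s_all: "\<forall>j. J \<le> j \<longrightarrow>
      (\<forall>x\<in>K j. \<forall>y\<in>K j. s j (x + y) = s j x * s j y) \<and>
      (\<forall>x\<in>K j. cmod (s j x) = 1) \<and> \<delta> \<le> 1 - Re (s j g') \<and> (\<forall>x. cmod (s j x) \<le> 1 / \<epsilon>) \<and>
      (\<forall>x x' w. (\<forall>y. \<bar>f (y - x) - f (y - x')\<bar> \<le> w) \<longrightarrow> cmod (s j x - s j x') \<le> w / \<epsilon>)" ..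
  then have s: "\<And>j x y. J \<le> j \<Longrightarrow> x \<in> K j \<Longrightarrow> y \<in> K j \<Longrightarrow> s j (x + y) = s j x * s j y"
    "\<And>j x. J \<le> j \<Longrightarrow> x \<in> K j \<Longrightarrow> cmod (s j x) = 1"
    "\<And>j. J \<le> j \<Longrightarrow> \<delta> \<le> 1 - Re (s j g')"
    "\<And>j x. J \<le> j \<Longrightarrow> cmod (s j x) \<le> 1 / \<epsilon>"
    "\<And>j x x' w. J \<le> j \<Longrightarrow> (\<forall>y. \<bar>f (y - x) - f (y - x')\<bar> \<le> w) \<Longrightarrow> cmod (s j x - s j x') \<le> w / \<epsilon>"
    by simp_all
  have ev: "eventually (\<lambda>j. J \<le> j) sequentially" by (rule eventually_ge_at_top)
  obtain \<xi> where cl: "inf (nhds \<xi>) (filtermap s sequentially) \<noteq> bot"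
  proof -
    have "filtermap s sequentially \<noteq> bot" by (simp add: filtermap_bot_iff)
    moreover have "eventually (\<lambda>x. x \<in> {f. \<forall>x. cmod (f x) \<le> 1 / \<epsilon>}) (filtermap s sequentially)"
      unfolding eventually_filtermap using ev by eventually_elim (use s(4) in auto)
    ultimately show thesis
      using compact_bounded_functions[of "1 / \<epsilon>", unfolded compact_filter] that by blast
  qed
  have coord: "continuous_on UNIV (\<lambda>f::'a \<Rightarrow> complex. f x)" for x
    by (rule continuous_on_product_coordinates)
  have lim: "P \<xi>" if "closed {\<xi>. P \<xi>}" "\<And>j. i \<le> j \<Longrightarrow> J \<le> j \<Longrightarrow> P (s j)" for P i
  proof -
    have "eventually (\<lambda>j. P (s j)) sequentially"
      using ev eventually_ge_at_top[of i] by eventually_elim (rule that(2))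
    then show ?thesis using cluster_value_in_closed[OF cl that(1)] by simp
  qed
  have mod: "cmod (\<xi> x - \<xi> x') \<le> w / \<epsilon>" if "\<And>y. \<bar>f (y - x) - f (y - x')\<bar> \<le> w" for x x' w
  proof (rule lim[where P = "\<lambda>\<xi>. cmod (\<xi> x - \<xi> x') \<le> w / \<epsilon>" and i = 0])
    show "closed {\<xi>. cmod (\<xi> x - \<xi> x') \<le> w / \<epsilon>}"
      by (intro closed_Collect_le continuous_on_norm continuous_on_diff continuous_on_const coord)
  qed (use s(5) that in simp)
  have cont: "continuous_on UNIV \<xi>"
  proof (rule continuous_at_imp_continuous_on, rule ballI)
    fix x
    show "isCont \<xi> x" unfolding continuous_at tendsto_iff
    proof (intro allI impI)
      fix e :: real assume e: "0 < e"
      obtain V where V: "open V" "0 \<in> V" "\<And>t x. t \<in> V \<Longrightarrow> dist (f (x + t)) (f x) \<le> \<epsilon> * e / 2"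
        by (rule uniformly_continuous_on_compact_group[OF comp f(1), of "\<epsilon> * e / 2"]) (use pos e in auto)
      have "eventually (\<lambda>x'. x' \<in> {x'. x - x' \<in> V}) (nhds x)"
        using open_translate(4)[OF V(1), of x] V(2) by (intro eventually_nhds_in_open) auto
      then have "eventually (\<lambda>x'. x - x' \<in> V) (at x)" by (simp add: eventually_nhds_conv_at)
      then show "eventually (\<lambda>x'. dist (\<xi> x') (\<xi> x) < e) (at x)"
      proof eventually_elim
        case (elim x')
        have "\<bar>f (y - x') - f (y - x)\<bar> \<le> \<epsilon> * e / 2" for y
          using V(3)[OF elim, of "y - x"] by (simp add: dist_real_def)
        from mod[OF this] show ?case using pos e by (simp add: dist_norm)
      qed
    qed
  qed
  have multH: "\<xi> (x + y) = \<xi> x * \<xi> y" if "x \<in> (\<Union>j. K j)" "y \<in> (\<Union>j. K j)" for x y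
  proof -
    from that obtain i i' where "x \<in> K i" "y \<in> K i'" by auto
    then have "x \<in> K j" "y \<in> K j" if "max i i' \<le> j" for j
      using le[of i j] le[of i' j] that by auto
    note in_K = this
    show ?thesis
    proof (rule lim[where P = "\<lambda>\<xi>. \<xi> (x + y) = \<xi> x * \<xi> y" and i = "max i i'"])
      show "closed {\<xi>::'a \<Rightarrow> complex. \<xi> (x + y) = \<xi> x * \<xi> y}"
        by (intro closed_Collect_eq continuous_on_mult coord)
    qed (use s(1) in_K in simp)
  qed
  have normH: "cmod (\<xi> x) = 1" if "x \<in> (\<Union>j. K j)" for x
  proof -
    from that obtain i where "x \<in> K i" by auto
    then have "x \<in> K j" if "i \<le> j" for j
      using le[of i j] that by auto
    note in_K = this
    show ?thesis
    proof (rule lim[where P = "\<lambda>\<xi>. cmod (\<xi> x) = 1" and i = i])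
      show "closed {\<xi>. cmod (\<xi> x) = 1}"
        by (intro closed_Collect_eq continuous_on_norm continuous_on_const coord)
    qed (use s(2) in_K in simp)
  qed
  have "\<xi> \<in> dual_group" unfolding dual_group_def mem_Collect_eq
  proof (intro conjI allI cont)
    have "closed {x. cmod (\<xi> x) = 1}"
      by (intro closed_Collect_eq continuous_intros cont)
    then have "closure (\<Union>j. K j) \<subseteq> {x. cmod (\<xi> x) = 1}"
      by (intro closure_minimal) (use normH in auto)
    then show "cmod (\<xi> x) = 1" for x using dense by auto
    have "closed {p. \<xi> (fst p + snd p) = \<xi> (fst p) * \<xi> (snd p)}"
      by (intro closed_Collect_eq continuous_intros continuous_on_compose2[OF cont]) auto
    then have "closure ((\<Union>j. K j) \<times> (\<Union>j. K j)) \<subseteq> {p. \<xi> (fst p + snd p) = \<xi> (fst p) * \<xi> (snd p)}"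
      by (intro closure_minimal subsetI) (simp_all add: mem_Times_iff multH del: UN_iff)
    then have "UNIV \<subseteq> {p. \<xi> (fst p + snd p) = \<xi> (fst p) * \<xi> (snd p)}"
      unfolding closure_Times dense by simp
    then have "(x, y) \<in> {p. \<xi> (fst p + snd p) = \<xi> (fst p) * \<xi> (snd p)}" for x y by blast
    then show "\<xi> (x + y) = \<xi> x * \<xi> y" for x y by simp
  qed
  moreover have "\<xi> g \<noteq> 1"
  proof
    assume 1: "\<xi> g = 1"
    have "\<bar>f (y - g) - f (y - g')\<bar> \<le> \<epsilon> * \<delta> / 2" for y
      using W(3)[OF g'(3), of "y - g'"] by (simp add: dist_real_def)
    from mod[OF this] have "cmod (1 - \<xi> g') \<le> \<delta> / 2" using pos 1 by simp
    moreover have "\<delta> \<le> 1 - Re (\<xi> g')"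
    proof (rule lim[where P = "\<lambda>\<xi>. \<delta> \<le> 1 - Re (\<xi> g')" and i = 0])
      show "closed {\<xi>. \<delta> \<le> 1 - Re (\<xi> g')}"
        by (intro closed_Collect_le continuous_on_diff continuous_on_Re continuous_on_const coord)
    qed (use s(3) in simp)
    moreover have "1 - Re (\<xi> g') \<le> cmod (1 - \<xi> g')"
      using complex_Re_le_cmod[of "1 - \<xi> g'"] by simp
    ultimately show False using pos by linarith
  qed
  ultimately show thesis by (rule that)
qed

section \<open>Square-integrable functions and uniqueness of Haar measure\<close>

locale compact_group_haar =
  fixes M :: "'a::{topological_ab_group_add, second_countable_topology, t2_space} measure"
  assumes compact_group: "compact (UNIV :: 'a set)" and haar: "normalized_haar_measure M"
begin

lemma sets_M [measurable_cong, simp]: "sets M = sets borel"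
  and prob_M: "prob_space M"
  and distr_translate: "distr M M (\<lambda>x. a + x) = M"
  using haar by (auto simp: normalized_haar_measure_def)

lemma space_M [simp]: "space M = UNIV"
  using sets_eq_imp_space_eq[OF sets_M] by simp

sublocale prob_space M by (rule prob_M)

lemma prob_UNIV [simp]: "prob UNIV = 1"
  using prob_space by simp

lemma measurable_M [simp]: "borel_measurable M = borel_measurable borel"
  by (rule measurable_cong_sets) simp_all

lemma continuous_measurable: "continuous_on UNIV f \<Longrightarrow> f \<in> borel_measurable M"
  for f :: "'a \<Rightarrow> 'b::topological_space"
  using borel_measurable_continuous_onI by simp

lemma translate_measurable [measurable]: "(\<lambda>x. a + x) \<in> measurable M M"
  by (simp add: measurable_cong_sets[OF sets_M sets_M] borel_measurable_continuous_onI continuous_intros)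

lemma integral_translate:
  fixes f :: "'a \<Rightarrow> 'b::{banach, second_countable_topology}"
  assumes "f \<in> borel_measurable M"
  shows "(LINT x|M. f (a + x)) = (LINT x|M. f x)"
  using integral_distr[OF translate_measurable assms, of a] by (simp add: distr_translate)

lemma integrable_translate:
  fixes f :: "'a \<Rightarrow> 'b::{banach, second_countable_topology}"
  assumes "integrable M f"
  shows "integrable M (\<lambda>x. f (a + x))"
  using integrable_distr[OF translate_measurable, of a f] assms by (simp add: distr_translate)

lemma bounded_integrable:
  fixes f :: "'a \<Rightarrow> 'b::{banach, second_countable_topology}"
  assumes "f \<in> borel_measurable M" "\<And>x. norm (f x) \<le> B"
  shows "integrable M f"
  by (rule integrable_const_bound[of _ B]) (use assms in auto)

lemma L2_iff: "f \<in> L2 M \<longleftrightarrow> f \<in> borel_measurable borel \<and> integrable M (\<lambda>x. (cmod (f x))\<^sup>2)"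
  by (simp add: L2_def)

lemma L2_bounded:
  assumes "f \<in> borel_measurable M" "\<And>x. cmod (f x) \<le> B"
  shows "f \<in> L2 M"
  unfolding L2_iff
proof
  show "integrable M (\<lambda>x. (cmod (f x))\<^sup>2)"
    by (rule bounded_integrable[where B = "B\<^sup>2"]) (use assms in \<open>auto intro!: power_mono\<close>)
qed (use assms in simp)

lemma L2_dominated:
  assumes "g \<in> L2 M" "f \<in> borel_measurable M" "\<And>x. cmod (f x) \<le> cmod (g x)"
  shows "f \<in> L2 M"
  unfolding L2_iff
proof
  show "integrable M (\<lambda>x. (cmod (f x))\<^sup>2)"
    by (rule Bochner_Integration.integrable_bound[of _ "\<lambda>x. (cmod (g x))\<^sup>2"])
       (use assms in \<open>auto simp: L2_iff intro!: power_mono\<close>)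
qed (use assms in simp)

lemma L2_mult_integrable:
  assumes "f \<in> L2 M" "g \<in> L2 M"
  shows "integrable M (\<lambda>x. f x * g x)"
proof (rule Bochner_Integration.integrable_bound[of _ "\<lambda>x. (cmod (f x))\<^sup>2 + (cmod (g x))\<^sup>2"])
  show "integrable M (\<lambda>x. (cmod (f x))\<^sup>2 + (cmod (g x))\<^sup>2)" using assms by (auto simp: L2_iff)
  have "cmod (f x * g x) \<le> (cmod (f x))\<^sup>2 + (cmod (g x))\<^sup>2" for x
  proof -
    have "2 * (cmod (f x) * cmod (g x)) \<le> (cmod (f x))\<^sup>2 + (cmod (g x))\<^sup>2"
      using sum_squares_bound[of "cmod (f x)" "cmod (g x)"] by simp
    moreover have "0 \<le> cmod (f x) * cmod (g x)" by simp
    ultimately show ?thesis unfolding norm_mult by linarith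
  qed
  then show "AE x in M. norm (f x * g x) \<le> norm ((cmod (f x))\<^sup>2 + (cmod (g x))\<^sup>2)" by simp
qed (use assms in \<open>auto simp: L2_iff\<close>)

lemma L2_scale: "f \<in> L2 M \<Longrightarrow> (\<lambda>x. c * f x) \<in> L2 M"
  by (auto simp: L2_iff norm_mult power_mult_distrib)

lemma L2_cnj: "f \<in> L2 M \<Longrightarrow> (\<lambda>x. cnj (f x)) \<in> L2 M"
  by (simp add: L2_iff borel_measurable_continuous_on[OF linear_continuous_on[OF bounded_linear_cnj]])

lemma L2_add:
  assumes "f \<in> L2 M" "g \<in> L2 M"
  shows "(\<lambda>x. f x + g x) \<in> L2 M"
  unfolding L2_iff
proof
  show "integrable M (\<lambda>x. (cmod (f x + g x))\<^sup>2)"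
  proof (rule Bochner_Integration.integrable_bound[of _ "\<lambda>x. 2 * (cmod (f x))\<^sup>2 + 2 * (cmod (g x))\<^sup>2"])
    show "integrable M (\<lambda>x. 2 * (cmod (f x))\<^sup>2 + 2 * (cmod (g x))\<^sup>2)" using assms by (auto simp: L2_iff)
    have "(cmod (f x + g x))\<^sup>2 \<le> 2 * (cmod (f x))\<^sup>2 + 2 * (cmod (g x))\<^sup>2" for x
    proof -
      have "(cmod (f x + g x))\<^sup>2 \<le> (cmod (f x) + cmod (g x))\<^sup>2"
        by (intro power_mono norm_triangle_ineq) simp
      then show ?thesis
        using sum_squares_bound[of "cmod (f x)" "cmod (g x)"] by (simp add: power2_sum)
    qed
    then show "AE x in M. norm ((cmod (f x + g x))\<^sup>2) \<le> norm (2 * (cmod (f x))\<^sup>2 + 2 * (cmod (g x))\<^sup>2)"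
      by simp
  qed (use assms in \<open>auto simp: L2_iff\<close>)
qed (use assms in \<open>auto simp: L2_iff\<close>)

lemma L2_diff: "f \<in> L2 M \<Longrightarrow> g \<in> L2 M \<Longrightarrow> (\<lambda>x. f x - g x) \<in> L2 M"
  using L2_add[of f "\<lambda>x. - 1 * g x"] L2_scale[of g "-1"] by simp

lemma L2_norm_nonneg: "0 \<le> L2_norm M f"
  by (simp add: L2_norm_def)

lemma L2_norm_sq: "(L2_norm M f)\<^sup>2 = (LINT x|M. (cmod (f x))\<^sup>2)"
  by (simp add: L2_norm_def)

lemma Cauchy_Schwarz_L2:
  assumes f: "f \<in> L2 M" and g: "g \<in> L2 M"
  shows "(LINT x|M. cmod (f x) * cmod (g x)) \<le> L2_norm M f * L2_norm M g"
proof -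
  define A where "A = (LINT x|M. (cmod (f x))\<^sup>2)"
  define B where "B = (LINT x|M. cmod (f x) * cmod (g x))"
  define C where "C = (LINT x|M. (cmod (g x))\<^sup>2)"
  have int: "integrable M (\<lambda>x. (cmod (f x))\<^sup>2)" "integrable M (\<lambda>x. (cmod (g x))\<^sup>2)"
    "integrable M (\<lambda>x. cmod (f x) * cmod (g x))"
    using f g integrable_norm[OF L2_mult_integrable[OF f g]] by (auto simp: L2_iff norm_mult)
  have AC: "0 \<le> A" "0 \<le> C" by (simp_all add: A_def C_def)
  have quad: "0 \<le> t\<^sup>2 * A - 2 * t * B + C" for t
  proof -
    have "0 \<le> (LINT x|M. (t * cmod (f x) - cmod (g x))\<^sup>2)" by simp
    also have "\<dots> = (LINT x|M. t\<^sup>2 * (cmod (f x))\<^sup>2 - 2 * t * (cmod (f x) * cmod (g x)) + (cmod (g x))\<^sup>2)"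
      by (simp add: power2_diff power_mult_distrib algebra_simps)
    also have "\<dots> = t\<^sup>2 * A - 2 * t * B + C"
      using int by (simp add: A_def B_def C_def)
    finally show ?thesis .
  qed
  have "B\<^sup>2 \<le> A * C"
  proof (cases "A = 0")
    case True
    have "B \<le> 0"
    proof (rule ccontr)
      assume "\<not> B \<le> 0"
      then show False using quad[of "(C + 1) / (2 * B)"] AC by (simp add: True)
    qed
    moreover have "0 \<le> B" by (simp add: B_def)
    ultimately show ?thesis using True by simp
  next
    case False
    have "0 \<le> A * ((B / A)\<^sup>2 * A - 2 * (B / A) * B + C)"
      using AC by (intro mult_nonneg_nonneg quad)
    also have "\<dots> = A * C - B\<^sup>2" using False by (simp add: field_simps power2_eq_square)
    finally show ?thesis by simp
  qed
  then have "B \<le> sqrt (A * C)" by (rule real_le_rsqrt)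
  then show ?thesis by (simp add: real_sqrt_mult L2_norm_def A_def B_def C_def)
qed

lemma L2_inner_le:
  assumes "f \<in> L2 M" "g \<in> L2 M"
  shows "cmod (LINT x|M. f x * g x) \<le> L2_norm M f * L2_norm M g"
  using integral_norm_bound[of M "\<lambda>x. f x * g x"] Cauchy_Schwarz_L2[OF assms]
  by (simp add: norm_mult)

lemma L2_norm_triangle:
  assumes f: "f \<in> L2 M" and g: "g \<in> L2 M"
  shows "L2_norm M (\<lambda>x. f x + g x) \<le> L2_norm M f + L2_norm M g"
proof (rule power2_le_imp_le)
  have int: "integrable M (\<lambda>x. (cmod (f x))\<^sup>2)" "integrable M (\<lambda>x. (cmod (g x))\<^sup>2)"
    "integrable M (\<lambda>x. cmod (f x) * cmod (g x))" "integrable M (\<lambda>x. (cmod (f x + g x))\<^sup>2)"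
    using f g L2_add[OF f g] integrable_norm[OF L2_mult_integrable[OF f g]] by (auto simp: L2_iff norm_mult)
  have "(L2_norm M (\<lambda>x. f x + g x))\<^sup>2 = (LINT x|M. (cmod (f x + g x))\<^sup>2)" by (rule L2_norm_sq)
  also have "\<dots> \<le> (LINT x|M. (cmod (f x))\<^sup>2 + 2 * (cmod (f x) * cmod (g x)) + (cmod (g x))\<^sup>2)"
  proof (rule integral_mono)
    show "(cmod (f x + g x))\<^sup>2 \<le> (cmod (f x))\<^sup>2 + 2 * (cmod (f x) * cmod (g x)) + (cmod (g x))\<^sup>2" for x
      using power_mono[OF norm_triangle_ineq[of "f x" "g x"], of 2] by (simp add: power2_sum)
  qed (use int in auto)
  also have "\<dots> = (L2_norm M f)\<^sup>2 + 2 * (LINT x|M. cmod (f x) * cmod (g x)) + (L2_norm M g)\<^sup>2"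
    using int by (simp add: L2_norm_sq)
  also have "\<dots> \<le> (L2_norm M f + L2_norm M g)\<^sup>2"
    using Cauchy_Schwarz_L2[OF f g] by (simp add: power2_sum)
  finally show "(L2_norm M (\<lambda>x. f x + g x))\<^sup>2 \<le> (L2_norm M f + L2_norm M g)\<^sup>2" .
qed (simp add: L2_norm_nonneg)

lemma L2_norm_scale: "L2_norm M (\<lambda>x. c * f x) = cmod c * L2_norm M f"
  by (simp add: L2_norm_def norm_mult power_mult_distrib real_sqrt_mult)

lemma L2_norm_le_sup:
  assumes "f \<in> borel_measurable M" "\<And>x. cmod (f x) \<le> B"
  shows "L2_norm M f \<le> B"
proof -
  have B: "0 \<le> B" using norm_ge_zero assms(2) by (rule order_trans)
  have "(LINT x|M. (cmod (f x))\<^sup>2) \<le> (LINT x|M. B\<^sup>2)"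
    by (intro integral_mono) (use L2_bounded[OF assms] assms in \<open>auto simp: L2_iff intro!: power_mono\<close>)
  then have "(LINT x|M. (cmod (f x))\<^sup>2) \<le> B\<^sup>2" by (simp add: prob_space)
  then show ?thesis unfolding L2_norm_def using B by (simp add: real_le_lsqrt)
qed

lemma L2_dominated_convergence:
  assumes f: "f \<in> L2 M" and s: "\<And>i. s i \<in> borel_measurable M" and g: "g \<in> L2 M"
    and lim: "\<And>x. (\<lambda>i. s i x) \<longlonglongrightarrow> f x" and bd: "\<And>i x. cmod (f x - s i x) \<le> cmod (g x)"
  shows "(\<lambda>i. L2_norm M (\<lambda>x. f x - s i x)) \<longlonglongrightarrow> 0"
proof -
  have "(\<lambda>i. LINT x|M. (cmod (f x - s i x))\<^sup>2) \<longlonglongrightarrow> (LINT x|M. 0)"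
  proof (rule integral_dominated_convergence[where w = "\<lambda>x. (cmod (g x))\<^sup>2"])
    show "AE x in M. (\<lambda>i. (cmod (f x - s i x))\<^sup>2) \<longlonglongrightarrow> 0"
    proof (rule AE_I2)
      fix x
      have "(\<lambda>i. (cmod (f x - s i x))\<^sup>2) \<longlonglongrightarrow> (cmod (f x - f x))\<^sup>2"
        by (intro tendsto_intros lim)
      then show "(\<lambda>i. (cmod (f x - s i x))\<^sup>2) \<longlonglongrightarrow> 0" by simp
    qed
    show "(\<lambda>x. (cmod (f x - s i x))\<^sup>2) \<in> borel_measurable M" for i
      using f s[of i] by (auto simp: L2_iff)
    show "integrable M (\<lambda>x. (cmod (g x))\<^sup>2)" using g by (simp add: L2_iff)
    show "AE x in M. norm ((cmod (f x - s i x))\<^sup>2) \<le> (cmod (g x))\<^sup>2" for i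
      using bd by (auto intro!: power_mono)
  qed simp
  then have "(\<lambda>i. sqrt (LINT x|M. (cmod (f x - s i x))\<^sup>2)) \<longlonglongrightarrow> sqrt 0"
    by (intro tendsto_real_sqrt) simp
  then show ?thesis by (simp add: L2_norm_def)
qed

lemma L2_closure_idem:
  assumes S: "S \<subseteq> L2 M" and f: "f \<in> L2 M"
    and ap: "\<And>e. 0 < e \<Longrightarrow> \<exists>g\<in>L2_closure M S. L2_norm M (\<lambda>x. f x - g x) < e"
  shows "f \<in> L2_closure M S"
  unfolding L2_closure_def
proof (intro CollectI conjI f allI impI)
  fix e :: real assume "0 < e"
  then obtain g where g: "g \<in> L2_closure M S" "L2_norm M (\<lambda>x. f x - g x) < e / 2"
    using ap[of "e / 2"] by auto
  then obtain h where h: "h \<in> S" "L2_norm M (\<lambda>x. g x - h x) < e / 2"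
    using \<open>0 < e\<close> unfolding L2_closure_def by (auto dest!: spec[of _ "e / 2"])
  have gL: "g \<in> L2 M" and hL: "h \<in> L2 M" using g h S by (auto simp: L2_closure_def)
  have "L2_norm M (\<lambda>x. (f x - g x) + (g x - h x)) \<le> L2_norm M (\<lambda>x. f x - g x) + L2_norm M (\<lambda>x. g x - h x)"
    by (intro L2_norm_triangle L2_diff f gL hL)
  then show "\<exists>h\<in>S. L2_norm M (\<lambda>x. f x - h x) < e" using g(2) h by (intro bexI[of _ h]) auto
qed

end

text \<open>
  Integrating the indicator of \<open>B\<close> at \<open>x + y\<close> against both measures, in either order, gives the
  measure of \<open>B\<close> under one of them and under the other.
\<close>

lemma normalized_haar_unique:
  fixes M N :: "'a::{topological_ab_group_add, second_countable_topology, t2_space} measure"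
  assumes M: "normalized_haar_measure M" and N: "normalized_haar_measure N"
  shows "M = N"
proof (rule measure_eqI)
  have sM: "sets M = sets borel" and sN: "sets N = sets borel"
    using M N by (auto simp: normalized_haar_measure_def)
  show "sets M = sets N" using sM sN by simp
  interpret M: prob_space M using M by (simp add: normalized_haar_measure_def)
  interpret N: prob_space N using N by (simp add: normalized_haar_measure_def)
  interpret pair_sigma_finite M N ..
  fix B assume "B \<in> sets M"
  then have B: "B \<in> sets borel" using sM by simp
  note [measurable_cong] = sM sN
  have [measurable]: "B \<in> sets borel" by (rule B)
  have vB: "(\<lambda>x. a + x) -` B \<in> sets borel" for a
  proof -
    have "(\<lambda>x. a + x) \<in> borel_measurable borel"
      by (intro borel_measurable_continuous_onI continuous_intros)
    from measurable_sets[OF this B] show ?thesis by simp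
  qed
  have inv: "emeasure L ((\<lambda>x. a + x) -` B) = emeasure L B"
    if L: "normalized_haar_measure L" for L :: "'a measure" and a
  proof -
    have sL: "sets L = sets borel" and d: "distr L L (\<lambda>x. a + x) = L"
      using L by (auto simp: normalized_haar_measure_def)
    have "(\<lambda>x. a + x) \<in> measurable L L"
      by (simp add: measurable_cong_sets[OF sL sL] borel_measurable_continuous_onI continuous_intros)
    then have "emeasure (distr L L (\<lambda>x. a + x)) B = emeasure L ((\<lambda>x. a + x) -` B \<inter> space L)"
      using B sL by (intro emeasure_distr) auto
    moreover have "space L = UNIV" using sets_eq_imp_space_eq[OF sL] by simp
    ultimately show ?thesis unfolding d by simp
  qed
  have m: "(\<lambda>p::'a \<times> 'a. indicator B (fst p + snd p) :: ennreal) \<in> borel_measurable (M \<Otimes>\<^sub>M N)"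
    by measurable
  have "emeasure M B = (\<integral>\<^sup>+ y. emeasure M B \<partial>N)" by (simp add: N.emeasure_space_1)
  also have "\<dots> = (\<integral>\<^sup>+ y. \<integral>\<^sup>+ x. indicator B (x + y) \<partial>M \<partial>N)"
  proof (rule nn_integral_cong)
    fix y
    have "(\<integral>\<^sup>+ x. indicator B (x + y) \<partial>M) = (\<integral>\<^sup>+ x. indicator ((\<lambda>x. y + x) -` B) x \<partial>M)"
      by (intro nn_integral_cong) (simp add: indicator_def add.commute)
    also have "\<dots> = emeasure M ((\<lambda>x. y + x) -` B)"
      by (intro nn_integral_indicator) (simp add: sM vB)
    finally show "emeasure M B = (\<integral>\<^sup>+ x. indicator B (x + y) \<partial>M)" using inv[OF M] by simp
  qed
  also have "\<dots> = (\<integral>\<^sup>+ x. \<integral>\<^sup>+ y. indicator B (x + y) \<partial>N \<partial>M)"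
    using Fubini'[of "\<lambda>x y. indicator B (x + y)"] m by (simp add: case_prod_beta)
  also have "\<dots> = (\<integral>\<^sup>+ x. emeasure N B \<partial>M)"
  proof (rule nn_integral_cong)
    fix x
    have "(\<integral>\<^sup>+ y. indicator B (x + y) \<partial>N) = (\<integral>\<^sup>+ y. indicator ((\<lambda>y. x + y) -` B) y \<partial>N)"
      by (intro nn_integral_cong) (simp add: indicator_def)
    also have "\<dots> = emeasure N ((\<lambda>y. x + y) -` B)"
      by (intro nn_integral_indicator) (simp add: sN vB)
    finally show "(\<integral>\<^sup>+ y. indicator B (x + y) \<partial>N) = emeasure N B" using inv[OF N] by simp
  qed
  also have "\<dots> = emeasure N B" by (simp add: M.emeasure_space_1)
  finally show "emeasure M B = emeasure N B" .
qed

section \<open>Trigonometric polynomials are dense\<close>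

lemma dual_groupD:
  assumes "\<xi> \<in> dual_group"
  shows "continuous_on UNIV \<xi>" "cmod (\<xi> x) = 1" "\<xi> (x + y) = \<xi> x * \<xi> y"
  using assms by (auto simp: dual_group_def)

lemma dual_unit: "\<xi> \<in> dual_group \<Longrightarrow> \<xi> x * cnj (\<xi> x) = 1"
  using dual_groupD(2)[of \<xi> x] by (simp flip: complex_norm_square)

lemma dual_zero: assumes "\<xi> \<in> dual_group" shows "\<xi> 0 = 1"
proof -
  have "\<xi> 0 * \<xi> 0 = \<xi> 0" "\<xi> 0 \<noteq> 0"
    using dual_groupD(3)[OF assms, of 0 0] dual_groupD(2)[OF assms, of 0] by auto
  then show ?thesis by simp
qed

lemma dual_minus: assumes "\<xi> \<in> dual_group" shows "\<xi> (- x) = cnj (\<xi> x)"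
proof -
  have "\<xi> x * \<xi> (- x) = \<xi> x * cnj (\<xi> x)" "\<xi> x \<noteq> 0"
    using dual_groupD(3)[OF assms, of x "- x"] dual_zero[OF assms] dual_unit[OF assms, of x]
      dual_groupD(2)[OF assms, of x] by auto
  then show ?thesis by simp
qed

lemma dual_diff: "\<xi> \<in> dual_group \<Longrightarrow> \<xi> (x - y) = \<xi> x * cnj (\<xi> y)"
  using dual_groupD(3)[of \<xi> x "- y"] dual_minus[of \<xi> y] by simp

lemma dual_one: "(\<lambda>_. 1) \<in> dual_group"
  by (simp add: dual_group_def)

lemma dual_mult: "\<xi> \<in> dual_group \<Longrightarrow> \<eta> \<in> dual_group \<Longrightarrow> (\<lambda>x. \<xi> x * \<eta> x) \<in> dual_group"
  by (auto simp: dual_group_def norm_mult intro!: continuous_intros)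

lemma dual_cnj: "\<xi> \<in> dual_group \<Longrightarrow> (\<lambda>x. cnj (\<xi> x)) \<in> dual_group"
  by (auto simp: dual_group_def intro!: continuous_intros)

text \<open>
  The linear span of the characters is given inductively, so that closure under products and
  membership in the approximating spaces follow by rule induction without collecting coefficients.
\<close>
inductive_set trig :: "('a::topological_ab_group_add \<Rightarrow> complex) set" where
  trig_char: "\<xi> \<in> dual_group \<Longrightarrow> \<xi> \<in> trig"
| trig_add: "p \<in> trig \<Longrightarrow> q \<in> trig \<Longrightarrow> (\<lambda>x. p x + q x) \<in> trig"
| trig_scale: "p \<in> trig \<Longrightarrow> (\<lambda>x. c * p x) \<in> trig"

lemma trig_const: "(\<lambda>_. c) \<in> trig"
  using trig_scale[OF trig_char[OF dual_one], of c] by simp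

lemma trig_mult_char:
  assumes "\<xi> \<in> dual_group" "q \<in> trig" shows "(\<lambda>x. \<xi> x * q x) \<in> trig"
  using assms(2)
proof induction
  case (trig_char \<eta>)
  then show ?case using assms(1) by (intro trig.trig_char dual_mult)
next
  case (trig_add p q)
  then show ?case using trig.trig_add[OF trig_add.IH] by (simp add: distrib_left)
next
  case (trig_scale p c)
  then show ?case using trig.trig_scale[OF trig_scale.IH, of c] by (simp add: mult.left_commute)
qed

lemma trig_mult:
  assumes "p \<in> trig" "q \<in> trig" shows "(\<lambda>x. p x * q x) \<in> trig"
  using assms(1)
proof induction
  case (trig_char \<eta>)
  then show ?case using assms(2) by (rule trig_mult_char)
next
  case (trig_add p r)
  then show ?case using trig.trig_add[OF trig_add.IH] by (simp add: distrib_right)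
next
  case (trig_scale p c)
  then show ?case using trig.trig_scale[OF trig_scale.IH, of c] by (simp add: mult.assoc)
qed

lemma trig_continuous: "p \<in> trig \<Longrightarrow> continuous_on UNIV p"
  by (induction rule: trig.induct)
     (auto intro: dual_groupD(1) continuous_on_add continuous_on_mult continuous_on_const)

text \<open>
  Stone-Weierstrass concerns real algebras. The real-valued trigonometric polynomials qualify: they
  contain \<open>Re \<xi>\<close> and \<open>Im \<xi>\<close> for each character \<open>\<xi>\<close>, and these separate points when the
  characters do.
\<close>

lemma trig_uniformly_dense_real:
  fixes f :: "'a::{topological_ab_group_add, t2_space} \<Rightarrow> real"
  assumes comp: "compact (UNIV :: 'a set)"
    and sep: "\<And>g::'a. g \<noteq> 0 \<Longrightarrow> \<exists>\<xi>\<in>dual_group. \<xi> g \<noteq> 1"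
    and f: "continuous_on UNIV f" and e: "0 < e"
  obtains p where "p \<in> trig" "\<And>x. cmod (of_real (f x) - p x) < e"
proof -
  define R where "R = {r :: 'a \<Rightarrow> real. (\<lambda>x. complex_of_real (r x)) \<in> trig}"
  have "function_ring_on R UNIV"
  proof
    show "compact (UNIV :: 'a set)" by (rule comp)
    show "continuous_on UNIV r" if "r \<in> R" for r
    proof -
      have "continuous_on UNIV (\<lambda>x. Re (complex_of_real (r x)))"
        using that unfolding R_def by (intro continuous_on_Re trig_continuous) simp
      then show ?thesis by simp
    qed
    show "(\<lambda>x. r x + s x) \<in> R" "(\<lambda>x. r x * s x) \<in> R" if "r \<in> R" "s \<in> R" for r s
      using that trig_add[of "\<lambda>x. complex_of_real (r x)" "\<lambda>x. complex_of_real (s x)"]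
        trig_mult[of "\<lambda>x. complex_of_real (r x)" "\<lambda>x. complex_of_real (s x)"]
      by (simp_all add: R_def)
    show "(\<lambda>_. c) \<in> R" for c by (simp add: R_def trig_const)
    show "\<exists>r\<in>R. r x \<noteq> r y" if "x \<noteq> y" for x y
    proof -
      from \<open>x \<noteq> y\<close> obtain \<xi> where \<xi>: "\<xi> \<in> dual_group" "\<xi> (x - y) \<noteq> 1"
        using sep[of "x - y"] by auto
      have "\<xi> x \<noteq> \<xi> y" using \<xi>(2) dual_diff[OF \<xi>(1), of x y] dual_unit[OF \<xi>(1), of y] by auto
      then have ne: "Re (\<xi> x) \<noteq> Re (\<xi> y) \<or> Im (\<xi> x) \<noteq> Im (\<xi> y)" by (simp add: complex_eq_iff)
      have c: "\<xi> \<in> trig" "(\<lambda>x. cnj (\<xi> x)) \<in> trig" using \<xi>(1) by (auto intro: trig_char dual_cnj)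
      have "(\<lambda>x. 1/2 * (\<xi> x + cnj (\<xi> x))) \<in> trig" "(\<lambda>x. - \<i>/2 * (\<xi> x + -1 * cnj (\<xi> x))) \<in> trig"
        by (intro trig_scale trig_add c)+
      moreover have "(\<lambda>x. 1/2 * (\<xi> x + cnj (\<xi> x))) = (\<lambda>x. complex_of_real (Re (\<xi> x)))"
        "(\<lambda>x. - \<i>/2 * (\<xi> x + -1 * cnj (\<xi> x))) = (\<lambda>x. complex_of_real (Im (\<xi> x)))"
        by (auto simp: complex_eq_iff)
      ultimately have R: "(\<lambda>x. Re (\<xi> x)) \<in> R" "(\<lambda>x. Im (\<xi> x)) \<in> R" by (simp_all add: R_def)
      from ne show ?thesis
      proof
        assume "Re (\<xi> x) \<noteq> Re (\<xi> y)"
        then show ?thesis by (intro bexI[OF _ R(1)])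
      next
        assume "Im (\<xi> x) \<noteq> Im (\<xi> y)"
        then show ?thesis by (intro bexI[OF _ R(2)])
      qed
    qed
  qed
  then interpret function_ring_on R UNIV .
  obtain g where g: "g \<in> R" "\<And>x. \<bar>f x - g x\<bar> < e"
    using Stone_Weierstrass_basic[OF f e] by auto
  show thesis
  proof (rule that[of "\<lambda>x. complex_of_real (g x)"])
    show "(\<lambda>x. complex_of_real (g x)) \<in> trig" using g(1) by (simp add: R_def)
    show "cmod (of_real (f x) - of_real (g x)) < e" for x
      using g(2)[of x] by (simp only: norm_of_real flip: of_real_diff)
  qed
qed

context compact_group_haar
begin

lemma dual_L2: "\<xi> \<in> dual_group \<Longrightarrow> \<xi> \<in> L2 M"
  using dual_groupD[of \<xi>] by (intro L2_bounded[of _ 1] continuous_measurable) auto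

lemma trig_L2: "p \<in> trig \<Longrightarrow> p \<in> L2 M"
  by (induction rule: trig.induct) (auto intro: dual_L2 L2_add L2_scale)

lemma integral_character:
  assumes \<xi>: "\<xi> \<in> dual_group" and "\<xi> \<noteq> (\<lambda>_. 1)"
  shows "(LINT x|M. \<xi> x) = 0"
proof -
  obtain a where a: "\<xi> a \<noteq> 1" using assms(2) by auto
  have "(LINT x|M. \<xi> x) = (LINT x|M. \<xi> (a + x))"
    using integral_translate[OF continuous_measurable[OF dual_groupD(1)[OF \<xi>]], of a] by simp
  also have "\<dots> = \<xi> a * (LINT x|M. \<xi> x)" by (simp add: dual_groupD(3)[OF \<xi>])
  finally show ?thesis using a by simp
qed

lemma fourier_character:
  assumes \<xi>: "\<xi> \<in> dual_group" and \<eta>: "\<eta> \<in> dual_group"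
  shows "fourier M \<xi> \<eta> = (if \<xi> = \<eta> then 1 else 0)"
proof (cases "\<xi> = \<eta>")
  case True
  then show ?thesis using dual_unit[OF \<eta>] by (simp add: fourier_def)
next
  case False
  have "(\<lambda>x. \<xi> x * cnj (\<eta> x)) \<noteq> (\<lambda>_. 1)"
  proof
    assume "(\<lambda>x. \<xi> x * cnj (\<eta> x)) = (\<lambda>_. 1)"
    then have "\<xi> x * cnj (\<eta> x) = \<eta> x * cnj (\<eta> x)" for x
      using dual_unit[OF \<eta>, of x] by (simp add: fun_eq_iff)
    moreover have "cnj (\<eta> x) \<noteq> 0" for x using dual_groupD(2)[OF \<eta>, of x] by auto
    ultimately show False using False by (simp add: fun_eq_iff)
  qed
  from integral_character[OF dual_mult[OF \<xi> dual_cnj[OF \<eta>]] this]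
  show ?thesis using False by (simp add: fourier_def)
qed

lemma L2_mult_cnj_integrable:
  "f \<in> L2 M \<Longrightarrow> \<xi> \<in> dual_group \<Longrightarrow> integrable M (\<lambda>x. f x * cnj (\<xi> x))"
  by (rule L2_mult_integrable[OF _ L2_cnj[OF dual_L2]])

lemma fourier_add:
  "f \<in> L2 M \<Longrightarrow> g \<in> L2 M \<Longrightarrow> \<xi> \<in> dual_group \<Longrightarrow>
   fourier M (\<lambda>x. f x + g x) \<xi> = fourier M f \<xi> + fourier M g \<xi>"
  unfolding fourier_def distrib_right
  by (intro Bochner_Integration.integral_add L2_mult_cnj_integrable)

lemma fourier_diff:
  "f \<in> L2 M \<Longrightarrow> g \<in> L2 M \<Longrightarrow> \<xi> \<in> dual_group \<Longrightarrow>
   fourier M (\<lambda>x. f x - g x) \<xi> = fourier M f \<xi> - fourier M g \<xi>"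
  unfolding fourier_def left_diff_distrib
  by (intro Bochner_Integration.integral_diff L2_mult_cnj_integrable)

lemma fourier_scale: "fourier M (\<lambda>x. c * f x) \<xi> = c * fourier M f \<xi>"
  by (simp add: fourier_def mult.assoc)

lemma fourier_sum:
  assumes "finite I" "\<And>i. i \<in> I \<Longrightarrow> f i \<in> L2 M" "\<xi> \<in> dual_group"
  shows "(\<lambda>x. \<Sum>i\<in>I. f i x) \<in> L2 M \<and> fourier M (\<lambda>x. \<Sum>i\<in>I. f i x) \<xi> = (\<Sum>i\<in>I. fourier M (f i) \<xi>)"
  using assms(1,2)
proof (induction I rule: finite_induct)
  case empty
  then show ?case using L2_bounded[of "\<lambda>_. 0" 0] by (simp add: fourier_def)
next
  case (insert i I)
  then show ?case using fourier_add[of "f i" "\<lambda>x. \<Sum>i\<in>I. f i x" \<xi>] assms(3) by (simp add: L2_add)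
qed

lemma fourier_le: "f \<in> L2 M \<Longrightarrow> \<xi> \<in> dual_group \<Longrightarrow> cmod (fourier M f \<xi>) \<le> L2_norm M f"
proof -
  assume f: "f \<in> L2 M" and \<xi>: "\<xi> \<in> dual_group"
  have "L2_norm M (\<lambda>x. cnj (\<xi> x)) = 1"
    by (simp add: L2_norm_def dual_groupD(2)[OF \<xi>])
  then show ?thesis
    using L2_inner_le[OF f L2_cnj[OF dual_L2[OF \<xi>]]] by (simp add: fourier_def)
qed

text \<open>
  The closure \<open>W\<close> of the trigonometric polynomials contains the continuous functions. By Urysohn
  functions and a countable basis it contains the indicators of open sets, as bounded pointwise
  limits of continuous functions; by Dynkin's theorem it contains those of all Borel sets, and by
  monotone approximation all of \<open>L\<^sup>2\<close>.
\<close>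

lemma trig_dense:
  assumes sep: "\<And>g::'a. g \<noteq> 0 \<Longrightarrow> \<exists>\<xi>\<in>dual_group. \<xi> g \<noteq> 1"
  shows "L2_closure M trig = L2 M"
proof
  show "L2_closure M trig \<subseteq> L2 M" by (auto simp: L2_closure_def)
  define W where "W = L2_closure M trig"
  have trigL2: "trig \<subseteq> L2 M" using trig_L2 by auto
  have WL: "f \<in> L2 M" if "f \<in> W" for f using that by (simp add: W_def L2_closure_def)
  have Wap: "\<exists>p\<in>trig. L2_norm M (\<lambda>x. f x - p x) < e" if "f \<in> W" "0 < e" for f e
    using that by (simp add: W_def L2_closure_def)
  have WI: "f \<in> W" if "f \<in> L2 M" "\<And>e. 0 < e \<Longrightarrow> \<exists>p\<in>trig. L2_norm M (\<lambda>x. f x - p x) < e" for f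
    using that by (simp add: W_def L2_closure_def)
  have Wadd: "(\<lambda>x. f x + g x) \<in> W" if f: "f \<in> W" and g: "g \<in> W" for f g
  proof (rule WI)
    show "(\<lambda>x. f x + g x) \<in> L2 M" using f g by (intro L2_add WL)
    fix e :: real assume e: "0 < e"
    obtain p q where p: "p \<in> trig" "L2_norm M (\<lambda>x. f x - p x) < e / 2"
      and q: "q \<in> trig" "L2_norm M (\<lambda>x. g x - q x) < e / 2"
      using Wap[OF f, of "e / 2"] Wap[OF g, of "e / 2"] e by auto
    have "L2_norm M (\<lambda>x. (f x - p x) + (g x - q x)) \<le> L2_norm M (\<lambda>x. f x - p x) + L2_norm M (\<lambda>x. g x - q x)"
      by (intro L2_norm_triangle L2_diff WL[OF f] WL[OF g] trig_L2[OF p(1)] trig_L2[OF q(1)])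
    then have "L2_norm M (\<lambda>x. f x + g x - (p x + q x)) < e"
      using p(2) q(2) by (simp add: algebra_simps)
    then show "\<exists>p\<in>trig. L2_norm M (\<lambda>x. f x + g x - p x) < e"
      by (rule bexI[OF _ trig_add[OF p(1) q(1)]])
  qed
  have Wscale: "(\<lambda>x. c * f x) \<in> W" if f: "f \<in> W" for f c
  proof (rule WI)
    show "(\<lambda>x. c * f x) \<in> L2 M" using f by (intro L2_scale WL)
    fix e :: real assume e: "0 < e"
    then have "0 < e / (cmod c + 1)" by (simp add: add_nonneg_pos)
    then obtain p where p: "p \<in> trig" "L2_norm M (\<lambda>x. f x - p x) < e / (cmod c + 1)"
      using Wap[OF f] by blast
    have "L2_norm M (\<lambda>x. c * f x - c * p x) = cmod c * L2_norm M (\<lambda>x. f x - p x)"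
      unfolding right_diff_distrib[symmetric] by (rule L2_norm_scale)
    also have "\<dots> \<le> (cmod c + 1) * L2_norm M (\<lambda>x. f x - p x)"
      by (intro mult_right_mono) (simp_all add: L2_norm_nonneg)
    also have "\<dots> < e" using p(2) by (simp add: pos_less_divide_eq add_nonneg_pos mult.commute)
    finally show "\<exists>q\<in>trig. L2_norm M (\<lambda>x. c * f x - q x) < e"
      by (rule bexI[OF _ trig_scale[OF p(1), of c]])
  qed
  have Wlim: "f \<in> W" if f: "f \<in> L2 M" and s: "\<And>i. s i \<in> W"
    and lim: "(\<lambda>i. L2_norm M (\<lambda>x. f x - s i x)) \<longlonglongrightarrow> 0" for f s
    unfolding W_def
  proof (rule L2_closure_idem[OF trigL2 f])
    fix e :: real assume "0 < e"
    from order_tendstoD(2)[OF lim this] obtain i where "L2_norm M (\<lambda>x. f x - s i x) < e"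
      by (auto simp: eventually_sequentially)
    then show "\<exists>g\<in>L2_closure M trig. L2_norm M (\<lambda>x. f x - g x) < e"
      using s[of i, unfolded W_def] by (rule bexI)
  qed
  have Wcont: "(\<lambda>x. complex_of_real (f x)) \<in> W" if f: "continuous_on UNIV f" for f :: "'a \<Rightarrow> real"
  proof (rule WI)
    have meas: "(\<lambda>x. complex_of_real (f x)) \<in> borel_measurable M"
      using f by (intro continuous_measurable continuous_intros)
    have "compact (range f)" by (rule compact_continuous_image[OF f compact_group])
    then have "\<exists>B. \<forall>x. \<bar>f x\<bar> \<le> B"
      by (auto simp: bounded_iff dest!: compact_imp_bounded)
    then obtain B where "\<forall>x. \<bar>f x\<bar> \<le> B" ..
    then show "(\<lambda>x. complex_of_real (f x)) \<in> L2 M" by (intro L2_bounded[OF meas, of B]) simp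
    fix e :: real assume "0 < e"
    then obtain p where p: "p \<in> trig" "\<And>x. cmod (of_real (f x) - p x) < e / 2"
      using trig_uniformly_dense_real[OF compact_group sep f, of "e / 2"] by auto
    have "L2_norm M (\<lambda>x. of_real (f x) - p x) \<le> e / 2"
    proof (rule L2_norm_le_sup)
      show "(\<lambda>x. of_real (f x) - p x) \<in> borel_measurable M"
        using f by (intro continuous_measurable continuous_intros trig_continuous p)
    qed (use p(2) in \<open>simp add: less_imp_le\<close>)
    then show "\<exists>p\<in>trig. L2_norm M (\<lambda>x. complex_of_real (f x) - p x) < e"
      using p(1) \<open>0 < e\<close> by (intro bexI[of _ p]) auto
  qed
  have W1: "(\<lambda>_. 1) \<in> W" using Wcont[of "\<lambda>_. 1"] by simp
  have W0: "(\<lambda>_. 0) \<in> W" using Wcont[of "\<lambda>_. 0"] by simp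
  have Wopen: "(\<lambda>x. of_real (indicator U x)) \<in> W" if U: "open U" for U :: "'a set"
  proof -
    obtain B :: "'a set set" where B: "countable B" "topological_basis B"
      using ex_countable_basis by blast
    define D where "D = {b \<in> B. closure b \<subseteq> U}"
    have cover: "\<exists>b\<in>D. x \<in> b" if x: "x \<in> U" for x
    proof -
      obtain f :: "'a \<Rightarrow> real" where f: "continuous_on UNIV f" "f x = 1" "\<And>y. f y \<noteq> 0 \<Longrightarrow> y \<in> U"
        using compact_group_bump_function[OF compact_group closed_singleton[of x] U] x
        by (metis empty_subsetI insert_subset singletonI)
      have "open {y. 1/2 < f y}" "x \<in> {y. 1/2 < f y}"
        using f by (auto intro!: open_Collect_less continuous_intros)
      then obtain b where b: "b \<in> B" "x \<in> b" "b \<subseteq> {y. 1/2 < f y}"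
        using topological_basisE[OF B(2)] by blast
      have "closure b \<subseteq> {y. 1/2 \<le> f y}"
        using b(3) by (intro closure_minimal closed_Collect_le continuous_intros f) auto
      also have "\<dots> \<subseteq> U" using f(3) by force
      finally show ?thesis using b by (auto simp: D_def)
    qed
    show ?thesis
    proof (cases "D = {}")
      case True
      then have "U = {}" using cover by auto
      then show ?thesis using W0 by simp
    next
      case False
      have "countable D" using B(1) by (auto simp: D_def intro: countable_subset)
      then obtain d :: "nat \<Rightarrow> 'a set" where d: "range d = D"
        using False by (metis range_from_nat_into)
      have "\<forall>i. \<exists>h. continuous_on UNIV h \<and> (\<forall>x. 0 \<le> h x \<and> h x \<le> 1) \<and> (\<forall>x\<in>closure (d i). h x = (1::real)) \<and>
          (\<forall>x. h x \<noteq> 0 \<longrightarrow> x \<in> U)"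
      proof
        fix i
        have "closure (d i) \<subseteq> U" using d by (auto simp: D_def)
        then show "\<exists>h. continuous_on UNIV h \<and> (\<forall>x. 0 \<le> h x \<and> h x \<le> 1) \<and> (\<forall>x\<in>closure (d i). h x = (1::real)) \<and>
          (\<forall>x. h x \<noteq> 0 \<longrightarrow> x \<in> U)"
          using compact_group_bump_function[OF compact_group closed_closure U] by metis
      qed
      from choice[OF this] obtain h where h_all: "\<forall>i. continuous_on UNIV (h i) \<and>
          (\<forall>x. 0 \<le> h i x \<and> h i x \<le> 1) \<and> (\<forall>x\<in>closure (d i). h i x = (1::real)) \<and>
          (\<forall>x. h i x \<noteq> 0 \<longrightarrow> x \<in> U)" ..
      then have h: "\<And>i. continuous_on UNIV (h i)" "\<And>i x. 0 \<le> h i x" "\<And>i x. h i x \<le> 1"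
        "\<And>i x. x \<in> closure (d i) \<Longrightarrow> h i x = 1" "\<And>i x. x \<notin> U \<Longrightarrow> h i x = 0" by auto
      \<comment> \<open>s n x reaches 1 as soon as one of the first n Urysohn functions equals 1 at x.\<close>
      define s where "s = (\<lambda>n x. 1 - (\<Prod>i<n. 1 - h i x))"
      have s01: "0 \<le> s n x" "s n x \<le> 1" for n x
        using h(2,3) by (auto simp: s_def intro!: prod_nonneg prod_le_1)
      have slim: "(\<lambda>n. s n x) \<longlonglongrightarrow> indicator U x" for x
      proof (cases "x \<in> U")
        case True
        then obtain k where "x \<in> d k" using cover d by (metis imageE)
        then have "h k x = 1" using h(4) closure_subset by blast
        then have "s n x = 1" if "k < n" for n
          using that by (auto simp: s_def intro!: bexI[of _ k])
        then show ?thesis using True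
          by (intro tendsto_eventually) (auto simp: eventually_sequentially intro!: exI[of _ "Suc k"])
      next
        case False
        then show ?thesis by (simp add: s_def h(5))
      qed
      show ?thesis
      proof (rule Wlim)
        show ind: "(\<lambda>x. complex_of_real (indicator U x)) \<in> L2 M"
        proof (rule L2_bounded[of _ 1])
          have "U \<in> sets borel" using U by simp
          then show "(\<lambda>x. complex_of_real (indicator U x)) \<in> borel_measurable M" by simp
        qed (simp add: indicator_def)
        show sW: "(\<lambda>x. complex_of_real (s n x)) \<in> W" for n
          unfolding s_def by (intro Wcont continuous_intros h)
        show "(\<lambda>n. L2_norm M (\<lambda>x. complex_of_real (indicator U x) - complex_of_real (s n x))) \<longlonglongrightarrow> 0"
        proof (rule L2_dominated_convergence[OF ind _ WL[OF W1]])
          show "(\<lambda>x. complex_of_real (s n x)) \<in> borel_measurable M" for n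
            using WL[OF sW, of n] by (simp add: L2_iff)
          show "(\<lambda>n. complex_of_real (s n x)) \<longlonglongrightarrow> complex_of_real (indicator U x)" for x
            by (intro tendsto_of_real slim)
          show "cmod (complex_of_real (indicator U x) - complex_of_real (s n x)) \<le> cmod 1" for n x
            using s01[of n x] by (simp add: indicator_def flip: of_real_diff)
        qed
      qed
    qed
  qed
  have Wset: "(\<lambda>x. complex_of_real (indicator B x)) \<in> W" if "B \<in> sets borel" for B :: "'a set"
  proof -
    have "Int_stable {U :: 'a set. open U}" "{U :: 'a set. open U} \<subseteq> Pow UNIV"
      by (auto simp: Int_stable_def)
    moreover have "B \<in> sigma_sets UNIV {U. open U}" using that by (simp add: borel_def)
    ultimately show ?thesis
    proof (induction rule: sigma_sets_induct_disjoint)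
      case (basic A)
      then show ?case using Wopen by simp
    next
      case empty
      then show ?case using W0 by simp
    next
      case (compl A)
      have "(\<lambda>x. 1 + (- 1) * complex_of_real (indicator A x)) \<in> W"
        by (intro Wadd Wscale W1 compl)
      moreover have "(\<lambda>x. 1 + (- 1) * complex_of_real (indicator A x)) = (\<lambda>x. complex_of_real (indicator (UNIV - A) x))"
        by (auto simp: indicator_def)
      ultimately show ?case by simp
    next
      case (union A)
      define s where "s = (\<lambda>n x. \<Sum>i<n. complex_of_real (indicator (A i) x))"
      have s_eq: "s n x = of_real (indicator (\<Union>i<n. A i) x)" for n x
      proof -
        have "indicator (\<Union>i<n. A i) x = (\<Sum>i<n. indicator (A i) x :: real)"
          by (intro indicator_UN_disjoint) (use union(1) in \<open>auto intro: disjoint_family_on_mono\<close>)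
        then show ?thesis by (simp add: s_def)
      qed
      have sW: "s n \<in> W" for n
      proof (induction n)
        case 0
        then show ?case using W0 by (simp add: s_def)
      next
        case (Suc n)
        have "s (Suc n) = (\<lambda>x. s n x + complex_of_real (indicator (A n) x))" by (simp add: s_def)
        then show ?case using Wadd[OF Suc union(3)] by simp
      qed
      have Ab: "A i \<in> sets borel" for i using union(2) by (auto simp: borel_def)
      show ?case
      proof (rule Wlim)
        show ind: "(\<lambda>x. complex_of_real (indicator (\<Union>i. A i) x)) \<in> L2 M"
        proof (rule L2_bounded[of _ 1])
          have "(\<Union>i. A i) \<in> sets borel" using Ab by auto
          then show "(\<lambda>x. complex_of_real (indicator (\<Union>i. A i) x)) \<in> borel_measurable M" by simp
        qed (simp add: indicator_def)
        show "s n \<in> W" for n by (rule sW)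
        show "(\<lambda>n. L2_norm M (\<lambda>x. complex_of_real (indicator (\<Union>i. A i) x) - s n x)) \<longlonglongrightarrow> 0"
        proof (rule L2_dominated_convergence[OF ind _ WL[OF W1]])
          show "s n \<in> borel_measurable M" for n using WL[OF sW, of n] by (simp add: L2_iff)
          show "(\<lambda>n. s n x) \<longlonglongrightarrow> complex_of_real (indicator (\<Union>i. A i) x)" for x
            unfolding s_eq by (intro tendsto_of_real LIMSEQ_indicator_UN)
          show "cmod (complex_of_real (indicator (\<Union>i. A i) x) - s n x) \<le> cmod 1" for n x
            unfolding s_eq by (auto simp: indicator_def)
        qed
      qed
    qed
  qed
  have Wpos: "(\<lambda>x. complex_of_real (u x)) \<in> L2 M \<longrightarrow> (\<lambda>x. complex_of_real (u x)) \<in> W"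
    if "u \<in> borel_measurable M" "\<And>x. 0 \<le> u x" for u :: "'a \<Rightarrow> real"
    using that
  proof (induction rule: borel_measurable_induct_real)
    case (set A)
    then show ?case using Wset by simp
  next
    case (mult u c)
    show ?case
    proof (cases "c = 0")
      case True
      then show ?thesis using W0 by simp
    next
      case False
      show ?thesis
      proof
        assume "(\<lambda>x. complex_of_real (c * u x)) \<in> L2 M"
        from L2_scale[OF this, of "1 / c"] have "(\<lambda>x. complex_of_real (u x)) \<in> L2 M"
          using False by simp
        then show "(\<lambda>x. complex_of_real (c * u x)) \<in> W"
          using mult.IH Wscale[of "\<lambda>x. complex_of_real (u x)" "of_real c"] by simp
      qed
    qed
  next
    case (add u v)
    show ?case
    proof
      assume sum: "(\<lambda>x. complex_of_real (v x + u x)) \<in> L2 M"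
      have "(\<lambda>x. complex_of_real (u x)) \<in> L2 M" "(\<lambda>x. complex_of_real (v x)) \<in> L2 M"
        using add.hyps by (auto intro!: L2_dominated[OF sum] simp del: of_real_add)
      then show "(\<lambda>x. complex_of_real (v x + u x)) \<in> W"
        using Wadd add.IH by simp
    qed
  next
    case (seq U)
    show ?case
    proof
      assume uL: "(\<lambda>x. complex_of_real (u x)) \<in> L2 M"
      have le: "U i x \<le> u x" for i x
      proof (rule incseq_le)
        show "incseq (\<lambda>i. U i x)" using seq.hyps(3) by (auto simp: incseq_def le_fun_def)
      qed (use seq.hyps(4) in simp)
      have UL: "(\<lambda>x. complex_of_real (U i x)) \<in> L2 M" for i
        by (rule L2_dominated[OF uL])
           (use seq.hyps(1,2) le order_trans[OF seq.hyps(2) le] in auto)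
      show "(\<lambda>x. complex_of_real (u x)) \<in> W"
      proof (rule Wlim[OF uL])
        show "(\<lambda>x. complex_of_real (U i x)) \<in> W" for i using seq.IH UL by blast
        show "(\<lambda>i. L2_norm M (\<lambda>x. complex_of_real (u x) - complex_of_real (U i x))) \<longlonglongrightarrow> 0"
        proof (rule L2_dominated_convergence[OF uL _ uL])
          show "(\<lambda>x. complex_of_real (U i x)) \<in> borel_measurable M" for i
            using UL by (simp add: L2_iff)
          show "(\<lambda>i. complex_of_real (U i x)) \<longlonglongrightarrow> complex_of_real (u x)" for x
            using seq.hyps(4) by (intro tendsto_of_real) simp
          show "cmod (complex_of_real (u x) - complex_of_real (U i x)) \<le> cmod (complex_of_real (u x))" for i x
            using le[of i x] seq.hyps(2)[of i x] by (simp flip: of_real_diff)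
        qed
      qed
    qed
  qed
  have Wreal: "(\<lambda>x. complex_of_real (u x)) \<in> W" if u: "(\<lambda>x. complex_of_real (u x)) \<in> L2 M" for u
  proof -
    have "(\<lambda>x. Re (complex_of_real (u x))) \<in> borel_measurable borel"
      using u by (intro measurable_compose[OF _ borel_measurable_Re]) (simp add: L2_iff)
    then have um: "u \<in> borel_measurable M" by simp
    have pm: "(\<lambda>x. complex_of_real (max 0 (u x))) \<in> L2 M" "(\<lambda>x. complex_of_real (max 0 (- u x))) \<in> L2 M"
      using um by (auto intro!: L2_dominated[OF u])
    then have "(\<lambda>x. complex_of_real (max 0 (u x)) + (-1) * complex_of_real (max 0 (- u x))) \<in> W"
      using um by (intro Wadd Wscale) (auto intro!: Wpos[rule_format])
    moreover have "complex_of_real (max 0 (u x)) + (-1) * complex_of_real (max 0 (- u x)) = u x" for x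
      by (simp add: max_def)
    ultimately show ?thesis by simp
  qed
  show "L2 M \<subseteq> L2_closure M trig"
  proof
    fix f assume f: "f \<in> L2 M"
    have fm: "f \<in> borel_measurable borel" using f by (simp add: L2_iff)
    have "(\<lambda>x. complex_of_real (Re (f x))) \<in> L2 M" "(\<lambda>x. complex_of_real (Im (f x))) \<in> L2 M"
      using fm by (auto intro!: L2_dominated[OF f] simp: abs_Re_le_cmod abs_Im_le_cmod)
    then have "(\<lambda>x. complex_of_real (Re (f x)) + \<i> * complex_of_real (Im (f x))) \<in> W"
      by (intro Wadd Wscale Wreal)
    then show "f \<in> L2_closure M trig" by (simp add: W_def flip: complex_eq)
  qed
qed

text \<open>
  Such an \<open>h\<close> is orthogonal to the trigonometric polynomials, hence to its own approximations by
  them.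
\<close>

lemma fourier_uniqueness:
  assumes sep: "\<And>g::'a. g \<noteq> 0 \<Longrightarrow> \<exists>\<xi>\<in>dual_group. \<xi> g \<noteq> 1"
    and h: "h \<in> L2 M" and zero: "\<And>\<xi>. \<xi> \<in> dual_group \<Longrightarrow> fourier M h \<xi> = 0"
  shows "AE x in M. h x = 0"
proof -
  have orth: "(LINT x|M. h x * cnj (p x)) = 0" if "p \<in> trig" for p
    using that
  proof induction
    case (trig_char \<xi>)
    then show ?case using zero by (simp add: fourier_def)
  next
    case (trig_add p q)
    have "(LINT x|M. h x * cnj (p x) + h x * cnj (q x)) = (LINT x|M. h x * cnj (p x)) + (LINT x|M. h x * cnj (q x))"
      by (intro Bochner_Integration.integral_add L2_mult_integrable L2_cnj h trig_L2 trig_add)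
    then show ?case using trig_add.IH by (simp add: distrib_left)
  next
    case (trig_scale p c)
    then show ?case by (simp add: mult.left_commute)
  qed
  have small: "(L2_norm M h)\<^sup>2 \<le> L2_norm M h * e" if "0 < e" for e
  proof -
    obtain p where p: "p \<in> trig" "L2_norm M (\<lambda>x. h x - p x) < e"
      using h trig_dense[OF sep] \<open>0 < e\<close> by (auto simp: L2_closure_def)
    have pL: "p \<in> L2 M" by (rule trig_L2[OF p(1)])
    have "complex_of_real ((L2_norm M h)\<^sup>2) = (LINT x|M. complex_of_real ((cmod (h x))\<^sup>2))"
      by (simp only: L2_norm_sq integral_complex_of_real)
    also have "\<dots> = (LINT x|M. h x * cnj (h x - p x) + h x * cnj (p x))"
      by (simp only: complex_norm_square) (simp add: algebra_simps)
    also have "\<dots> = (LINT x|M. h x * cnj (h x - p x)) + (LINT x|M. h x * cnj (p x))"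
      by (intro Bochner_Integration.integral_add L2_mult_integrable L2_cnj L2_diff h pL)
    finally have eq: "complex_of_real ((L2_norm M h)\<^sup>2) = (LINT x|M. h x * cnj (h x - p x))"
      by (simp only: orth[OF p(1)] add_0_right)
    have "(L2_norm M h)\<^sup>2 = cmod (complex_of_real ((L2_norm M h)\<^sup>2))"
      by (simp only: norm_of_real) simp
    also have "\<dots> \<le> L2_norm M h * L2_norm M (\<lambda>x. cnj (h x - p x))"
      unfolding eq by (intro L2_inner_le L2_cnj L2_diff h pL)
    also have "\<dots> \<le> L2_norm M h * e"
      using p(2) by (intro mult_left_mono) (auto simp: L2_norm_def simp flip: complex_cnj_diff)
    finally show ?thesis .
  qed
  have "L2_norm M h = 0"
  proof (rule ccontr)
    assume "L2_norm M h \<noteq> 0"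
    then have pos: "0 < L2_norm M h" using L2_norm_nonneg[of h] by simp
    then show False using small[of "L2_norm M h / 2"] by (simp add: power2_eq_square)
  qed
  then have "(LINT x|M. (cmod (h x))\<^sup>2) = 0" by (simp add: L2_norm_def)
  then have "AE x in M. (cmod (h x))\<^sup>2 = 0"
    using h by (subst (asm) integral_nonneg_eq_0_iff_AE) (auto simp: L2_iff)
  then show ?thesis by simp
qed

end

section \<open>Characters modulo a finite subgroup\<close>

definition agree_on :: "'a set \<Rightarrow> ('a \<Rightarrow> complex) \<Rightarrow> ('a \<Rightarrow> complex) \<Rightarrow> bool" where
  "agree_on K \<xi> \<eta> \<longleftrightarrow> (\<forall>x\<in>K. \<xi> x = \<eta> x)"

definition transversal :: "'a set \<Rightarrow> ('a::topological_ab_group_add \<Rightarrow> complex) set \<Rightarrow> bool" where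
  "transversal K S \<longleftrightarrow> S \<subseteq> dual_group \<and> (\<forall>\<xi>\<in>dual_group. \<exists>!\<eta>. \<eta> \<in> S \<and> agree_on K \<xi> \<eta>)"

lemma agree_on_refl [simp]: "agree_on K \<xi> \<xi>"
  and agree_on_sym: "agree_on K \<xi> \<eta> \<Longrightarrow> agree_on K \<eta> \<xi>"
  and agree_on_trans: "agree_on K \<xi> \<eta> \<Longrightarrow> agree_on K \<eta> \<theta> \<Longrightarrow> agree_on K \<xi> \<theta>"
  by (auto simp: agree_on_def)

lemma agree_on_mono: "agree_on K' \<xi> \<eta> \<Longrightarrow> K \<subseteq> K' \<Longrightarrow> agree_on K \<xi> \<eta>"
  by (auto simp: agree_on_def)

lemma transversal_unique:
  assumes "transversal K S" "\<xi> \<in> S" "\<eta> \<in> S" "agree_on K \<xi> \<eta>"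
  shows "\<xi> = \<eta>"
proof -
  have "\<xi> \<in> dual_group" using assms by (auto simp: transversal_def)
  then show ?thesis using assms agree_on_refl unfolding transversal_def by blast
qed

lemma sum_character_finite_subgroup:
  assumes K: "finite_subgroup K" and \<xi>: "\<xi> \<in> dual_group" and a: "a \<in> K" "\<xi> a \<noteq> 1"
  shows "(\<Sum>x\<in>K. \<xi> x) = 0"
proof -
  have "(\<Sum>x\<in>K. \<xi> x) = (\<Sum>x\<in>K. \<xi> (x + a))" using sum_translate[OF K a(1), of \<xi>] by simp
  also have "\<dots> = (\<Sum>x\<in>K. \<xi> x) * \<xi> a" by (simp add: dual_groupD(3)[OF \<xi>] sum_distrib_right)
  finally show ?thesis using a(2) by simp
qed

lemma sum_character_mult_cnj:
  assumes K: "finite_subgroup K" and \<xi>: "\<xi> \<in> dual_group" and \<eta>: "\<eta> \<in> dual_group"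
  shows "(\<Sum>x\<in>K. \<xi> x * cnj (\<eta> x)) = (if agree_on K \<xi> \<eta> then of_nat (card K) else 0)"
proof (cases "agree_on K \<xi> \<eta>")
  case True
  then have "(\<Sum>x\<in>K. \<xi> x * cnj (\<eta> x)) = (\<Sum>x\<in>K. 1)"
    by (intro sum.cong refl) (simp add: agree_on_def dual_unit[OF \<eta>])
  then show ?thesis using True by simp
next
  case False
  then obtain a where a: "a \<in> K" "\<xi> a \<noteq> \<eta> a" by (auto simp: agree_on_def)
  have "\<xi> a * cnj (\<eta> a) \<noteq> 1"
  proof
    assume "\<xi> a * cnj (\<eta> a) = 1"
    then have "\<xi> a * cnj (\<eta> a) = \<eta> a * cnj (\<eta> a)" by (simp add: dual_unit[OF \<eta>])
    moreover have "cnj (\<eta> a) \<noteq> 0" using dual_groupD(2)[OF \<eta>, of a] by auto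
    ultimately show False using a(2) by simp
  qed
  then show ?thesis
    using sum_character_finite_subgroup[OF K dual_mult[OF \<xi> dual_cnj[OF \<eta>]] a(1)] False by simp
qed

text \<open>
  By orthogonality the sum over \<open>K\<close> of the squared modulus of \<open>\<Sum>F\<close> is \<open>|F| |K|\<close>, and the point \<open>0\<close>
  alone contributes \<open>|F|\<^sup>2\<close>.
\<close>

lemma card_distinct_characters_le:
  assumes K: "finite_subgroup K" and F: "finite F" "F \<subseteq> dual_group"
    and dist: "\<And>\<xi> \<eta>. \<xi> \<in> F \<Longrightarrow> \<eta> \<in> F \<Longrightarrow> agree_on K \<xi> \<eta> \<Longrightarrow> \<xi> = \<eta>"
  shows "card F \<le> card K"
proof -
  note K' = finite_subgroupD[OF K]
  have "(\<Sum>x\<in>K. of_real ((cmod (\<Sum>\<xi>\<in>F. \<xi> x))\<^sup>2)) = (\<Sum>x\<in>K. \<Sum>\<xi>\<in>F. \<Sum>\<eta>\<in>F. \<xi> x * cnj (\<eta> x))"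
    by (intro sum.cong refl) (simp only: complex_norm_square cnj_sum sum_product)
  also have "\<dots> = (\<Sum>\<xi>\<in>F. \<Sum>x\<in>K. \<Sum>\<eta>\<in>F. \<xi> x * cnj (\<eta> x))" by (rule sum.swap)
  also have "\<dots> = (\<Sum>\<xi>\<in>F. \<Sum>\<eta>\<in>F. \<Sum>x\<in>K. \<xi> x * cnj (\<eta> x))"
    by (intro sum.cong refl sum.swap)
  also have "\<dots> = (\<Sum>\<xi>\<in>F. \<Sum>\<eta>\<in>F. if \<xi> = \<eta> then of_nat (card K) else 0)"
  proof (intro sum.cong refl)
    fix \<xi> \<eta> assume *: "\<xi> \<in> F" "\<eta> \<in> F"
    then have "\<xi> \<in> dual_group" "\<eta> \<in> dual_group" "agree_on K \<xi> \<eta> \<longleftrightarrow> \<xi> = \<eta>"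
      using F(2) dist[OF *] by auto
    then show "(\<Sum>x\<in>K. \<xi> x * cnj (\<eta> x)) = (if \<xi> = \<eta> then of_nat (card K) else 0)"
      using sum_character_mult_cnj[OF K, of \<xi> \<eta>] by simp
  qed
  also have "\<dots> = of_nat (card F * card K)" using F(1) by simp
  finally have "complex_of_real (\<Sum>x\<in>K. (cmod (\<Sum>\<xi>\<in>F. \<xi> x))\<^sup>2) = complex_of_real (card F * card K)"
    by simp
  then have eq: "(\<Sum>x\<in>K. (cmod (\<Sum>\<xi>\<in>F. \<xi> x))\<^sup>2) = card F * card K" by (simp only: of_real_eq_iff)
  have "(cmod (\<Sum>\<xi>\<in>F. \<xi> 0))\<^sup>2 \<le> (\<Sum>x\<in>K. (cmod (\<Sum>\<xi>\<in>F. \<xi> x))\<^sup>2)"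
    by (rule member_le_sum) (use K'(1,2) in auto)
  moreover have "(\<Sum>\<xi>\<in>F. \<xi> 0) = of_nat (card F)"
    using sum.cong[OF refl, of F "\<lambda>\<xi>. \<xi> 0" "\<lambda>_. 1"] F(2) dual_zero by auto
  ultimately have "real (card F * card F) \<le> real (card F * card K)"
    unfolding eq by (simp add: power2_eq_square)
  then have "card F * card F \<le> card F * card K" by (simp only: of_nat_le_iff)
  then show ?thesis by (cases "card F = 0") auto
qed

lemma transversal_finite:
  assumes "finite_subgroup K" "transversal K S"
  shows "finite S"
proof -
  have "finite S \<and> card S \<le> card K"
  proof (rule finite_if_finite_subsets_card_bdd)
    fix F assume F: "F \<subseteq> S" "finite F"
    show "card F \<le> card K"
    proof (rule card_distinct_characters_le[OF assms(1) F(2)])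
      show "F \<subseteq> dual_group" using F assms(2) by (auto simp: transversal_def)
      show "\<xi> = \<eta>" if "\<xi> \<in> F" "\<eta> \<in> F" "agree_on K \<xi> \<eta>" for \<xi> \<eta>
      proof -
        have "\<xi> \<in> dual_group" "\<xi> \<in> S" "\<eta> \<in> S" using that F assms(2) by (auto simp: transversal_def)
        then show ?thesis using that(3) assms(2) agree_on_refl unfolding transversal_def by blast
      qed
    qed
  qed
  then show ?thesis by simp
qed

text \<open>
  Multiplication by a character \<open>\<psi>\<close> permutes the classes modulo equality on \<open>K\<close>, and therefore
  the representatives. The sum is thus unchanged by the factor \<open>\<psi>(a) \<noteq> 1\<close>.
\<close>

lemma transversal_column_sum:
  assumes K: "finite_subgroup K" and S: "transversal K S"
    and sep: "\<exists>\<psi>\<in>dual_group. \<psi> a \<noteq> 1" and a: "a \<in> K"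
  shows "(\<Sum>\<xi>\<in>S. \<xi> a) = 0"
proof -
  obtain \<psi> where \<psi>: "\<psi> \<in> dual_group" "\<psi> a \<noteq> 1" using sep by blast
  have Sd: "S \<subseteq> dual_group" using S by (simp add: transversal_def)
  have ex: "\<forall>\<xi>\<in>S. \<exists>\<eta>. \<eta> \<in> S \<and> agree_on K (\<lambda>x. \<xi> x * \<psi> x) \<eta>"
  proof
    fix \<xi> assume "\<xi> \<in> S"
    then have "(\<lambda>x. \<xi> x * \<psi> x) \<in> dual_group" using Sd \<psi>(1) by (intro dual_mult) auto
    then show "\<exists>\<eta>. \<eta> \<in> S \<and> agree_on K (\<lambda>x. \<xi> x * \<psi> x) \<eta>" using S unfolding transversal_def by blast
  qed
  obtain r where r: "\<forall>\<xi>\<in>S. r \<xi> \<in> S \<and> agree_on K (\<lambda>x. \<xi> x * \<psi> x) (r \<xi>)"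
    using bchoice[OF ex] by blast
  have "inj_on r S"
  proof (rule inj_onI)
    fix \<xi> \<eta> assume *: "\<xi> \<in> S" "\<eta> \<in> S" "r \<xi> = r \<eta>"
    have "agree_on K (\<lambda>x. \<xi> x * \<psi> x) (\<lambda>x. \<eta> x * \<psi> x)"
      using r * by (metis agree_on_sym agree_on_trans)
    moreover have "\<psi> x \<noteq> 0" for x using dual_groupD(2)[OF \<psi>(1), of x] by auto
    ultimately have "agree_on K \<xi> \<eta>" by (simp add: agree_on_def)
    moreover have "\<xi> \<in> dual_group" using Sd * by auto
    ultimately show "\<xi> = \<eta>" using S * agree_on_refl unfolding transversal_def by blast
  qed
  moreover have "r ` S \<subseteq> S" using r by auto
  ultimately have "bij_betw r S S"
    using endo_inj_surj[OF transversal_finite[OF K S]] by (simp add: bij_betw_def)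
  then have "(\<Sum>\<xi>\<in>S. \<xi> a) = (\<Sum>\<xi>\<in>S. r \<xi> a)" by (rule sum.reindex_bij_betw[symmetric])
  also have "\<dots> = (\<Sum>\<xi>\<in>S. \<xi> a * \<psi> a)"
    using r a by (intro sum.cong refl) (auto simp: agree_on_def)
  also have "\<dots> = (\<Sum>\<xi>\<in>S. \<xi> a) * \<psi> a" by (simp add: sum_distrib_right)
  finally show ?thesis using \<psi>(2) by simp
qed

text \<open>
  Double counting of the sum of \<open>\<xi>(a)\<close> over all \<open>\<xi> \<in> S\<close> and \<open>a \<in> K\<close>: only \<open>a = 0\<close> contributes when
  summing over \<open>\<xi>\<close> first, and only the representative of the trivial class contributes when
  summing over \<open>a\<close> first.
\<close>

lemma transversal_card:
  fixes K :: "'a::topological_ab_group_add set"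
  assumes K: "finite_subgroup K" and S: "transversal K S"
    and sep: "\<And>a::'a. a \<noteq> 0 \<Longrightarrow> \<exists>\<psi>\<in>dual_group. \<psi> a \<noteq> 1"
  shows "card S = card K"
proof -
  note K' = finite_subgroupD[OF K]
  have Sd: "S \<subseteq> dual_group" using S by (simp add: transversal_def)
  have fin: "finite S" by (rule transversal_finite[OF K S])
  obtain \<theta> where \<theta>: "\<theta> \<in> S" "agree_on K (\<lambda>_. 1) \<theta>" "\<And>\<eta>. \<eta> \<in> S \<Longrightarrow> agree_on K (\<lambda>_. 1) \<eta> \<Longrightarrow> \<eta> = \<theta>"
    using S dual_one unfolding transversal_def by blast
  have "(\<Sum>a\<in>K. \<Sum>\<xi>\<in>S. \<xi> a) = (\<Sum>a\<in>K. if a = 0 then of_nat (card S) else 0)"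
  proof (rule sum.cong[OF refl])
    fix a assume a: "a \<in> K"
    have "(\<Sum>\<xi>\<in>S. \<xi> 0) = of_nat (card S)"
      using sum.cong[OF refl, of S "\<lambda>\<xi>. \<xi> 0" "\<lambda>_. 1"] Sd dual_zero by auto
    then show "(\<Sum>\<xi>\<in>S. \<xi> a) = (if a = 0 then of_nat (card S) else 0)"
      using transversal_column_sum[OF K S _ a] sep[of a] by (cases "a = 0") simp_all
  qed
  then have 1: "(\<Sum>a\<in>K. \<Sum>\<xi>\<in>S. \<xi> a) = of_nat (card S)" using K'(1,2) by simp
  have "(\<Sum>\<xi>\<in>S. \<Sum>a\<in>K. \<xi> a) = (\<Sum>\<xi>\<in>S. if \<xi> = \<theta> then of_nat (card K) else 0)"
  proof (rule sum.cong[OF refl])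
    fix \<xi> assume \<xi>: "\<xi> \<in> S"
    have "agree_on K \<xi> (\<lambda>_. 1) \<longleftrightarrow> \<xi> = \<theta>" using \<theta> \<xi> agree_on_sym by blast
    then show "(\<Sum>a\<in>K. \<xi> a) = (if \<xi> = \<theta> then of_nat (card K) else 0)"
      using sum_character_mult_cnj[OF K _ dual_one, of \<xi>] Sd \<xi> by auto
  qed
  then have 2: "(\<Sum>\<xi>\<in>S. \<Sum>a\<in>K. \<xi> a) = of_nat (card K)" using fin \<theta>(1) by simp
  have "complex_of_nat (card S) = of_nat (card K)" using 1 2 sum.swap[of "\<lambda>a \<xi>. \<xi> a" S K] by simp
  then show ?thesis by (simp only: of_nat_eq_iff)
qed

text \<open>
  A nontrivial character has integral \<open>0\<close>, which its real part forbids here.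
\<close>

lemma (in compact_group_haar) character_near_one_trivial:
  fixes \<psi> :: "'a \<Rightarrow> complex"
  assumes \<psi>: "\<psi> \<in> dual_group" and re: "\<And>x. 1/2 \<le> Re (\<psi> x)"
  shows "\<psi> = (\<lambda>_. 1)"
proof (rule ccontr)
  assume "\<psi> \<noteq> (\<lambda>_. 1)"
  then have 0: "(LINT x|M. \<psi> x) = 0" by (rule integral_character[OF \<psi>])
  have int: "integrable M \<psi>"
    by (rule bounded_integrable[of _ 1])
       (use dual_groupD[OF \<psi>] continuous_measurable in auto)
  have "(LINT x|M. 1/2) \<le> (LINT x|M. Re (\<psi> x))"
    by (intro integral_mono integrable_Re int) (use re in auto)
  also have "\<dots> = Re (LINT x|M. \<psi> x)" using int by simp
  finally show False unfolding 0 by simp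
qed

text \<open>
  Every character is within \<open>1/4\<close> of \<open>1\<close> on some neighbourhood \<open>b\<close> of \<open>0\<close> from a countable basis,
  so it suffices that each \<open>b\<close> admits finitely many such characters. Finitely many translates of
  \<open>b\<close> by elements of one \<open>K\<^sub>j\<close> cover the group. If two such characters agree on \<open>K\<^sub>j\<close>, their quotient
  is therefore everywhere within \<open>1/2\<close> of \<open>1\<close>, hence trivial. So they are determined by their
  restrictions to the finite group \<open>K\<^sub>j\<close>.
\<close>

lemma (in compact_group_haar) countable_dual_group:
  fixes K :: "nat \<Rightarrow> 'a set"
  assumes K: "\<And>j. finite_subgroup (K j)" and mono: "\<And>j. K j \<subseteq> K (Suc j)"
    and dense: "closure (\<Union>j. K j) = UNIV"
  shows "countable (dual_group :: ('a \<Rightarrow> complex) set)"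
proof -
  obtain B :: "'a set set" where B: "countable B" "topological_basis B"
    using ex_countable_basis by blast
  define X where "X = (\<lambda>b :: 'a set. {\<xi>\<in>dual_group. \<forall>x\<in>b. cmod (\<xi> x - 1) \<le> 1/4})"
  have finX: "finite (X b)" if b: "b \<in> B" "0 \<in> b" for b
  proof -
    have ob: "open b" using topological_basis_open[OF B(2) b(1)] .
    have "UNIV \<subseteq> (\<Union>h\<in>(\<Union>j. K j). {x. x - h \<in> b})"
    proof
      fix x
      have o: "open {h. x - h \<in> b}" "{h. x - h \<in> b} \<noteq> {}"
        using open_translate(4)[OF ob, of x] b(2) by (auto intro!: exI[of _ x])
      have "{h. x - h \<in> b} \<inter> (\<Union>j. K j) \<noteq> {}"
        using open_Int_closure_eq_empty[OF o(1), of "\<Union>j. K j"] o(2) unfolding dense by auto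
      then show "x \<in> (\<Union>h\<in>(\<Union>j. K j). {x. x - h \<in> b})" by auto
    qed
    then obtain T where T: "T \<subseteq> (\<Union>j. K j)" "finite T" "UNIV \<subseteq> (\<Union>h\<in>T. {x. x - h \<in> b})"
      by (rule compactE_image[OF compact_group, rotated]) (use open_translate(3)[OF ob] in auto)
    obtain j where j: "T \<subseteq> K j" using finite_subset_increasing_Union[OF mono T(2,1)] by blast
    have "finite (X b) \<and> card (X b) \<le> card (K j)"
    proof (rule finite_if_finite_subsets_card_bdd)
      fix F assume F: "F \<subseteq> X b" "finite F"
      show "card F \<le> card (K j)"
      proof (rule card_distinct_characters_le[OF K F(2)])
        show "F \<subseteq> dual_group" using F by (auto simp: X_def)
        fix \<xi> \<eta> assume \<xi>: "\<xi> \<in> F" and \<eta>: "\<eta> \<in> F" and ag: "agree_on (K j) \<xi> \<eta>"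
        have d: "\<xi> \<in> dual_group" "\<eta> \<in> dual_group" using F \<xi> \<eta> by (auto simp: X_def)
        have small: "cmod (\<xi> x - 1) \<le> 1/4" "cmod (\<eta> x - 1) \<le> 1/4" if "x \<in> b" for x
          using F \<xi> \<eta> that by (auto simp: X_def)
        define \<psi> where "\<psi> = (\<lambda>x. \<xi> x * cnj (\<eta> x))"
        have \<psi>: "\<psi> \<in> dual_group" unfolding \<psi>_def by (intro dual_mult dual_cnj d)
        have "1/2 \<le> Re (\<psi> x)" for x
        proof -
          obtain h where h: "h \<in> T" "x - h \<in> b" using T(3) by auto
          define y where "y = x - h"
          have y: "y \<in> b" using h by (simp add: y_def)
          have "\<psi> h = 1" using ag h(1) j dual_unit[OF d(2)] by (auto simp: \<psi>_def agree_on_def)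
          then have "\<psi> x = \<psi> y" using dual_groupD(3)[OF \<psi>, of "x - h" h] by (simp add: y_def)
          moreover have "cmod (\<psi> y - 1) \<le> 1/2"
          proof -
            have "\<psi> y - 1 = (\<xi> y - 1) * cnj (\<eta> y) + cnj (\<eta> y - 1)"
              by (simp add: \<psi>_def algebra_simps)
            then have "cmod (\<psi> y - 1) \<le> cmod ((\<xi> y - 1) * cnj (\<eta> y)) + cmod (cnj (\<eta> y - 1))"
              by (simp only: norm_triangle_ineq)
            also have "\<dots> \<le> 1/4 + 1/4"
              unfolding norm_mult complex_mod_cnj dual_groupD(2)[OF d(2)] using small[OF y] by simp
            finally show ?thesis by simp
          qed
          ultimately show ?thesis using abs_Re_le_cmod[of "\<psi> y - 1"] by simp
        qed
        from character_near_one_trivial[OF \<psi> this] have "\<xi> x * cnj (\<eta> x) = 1" for x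
          by (simp add: \<psi>_def fun_eq_iff)
        then have "\<xi> x * cnj (\<eta> x) = \<eta> x * cnj (\<eta> x)" for x using dual_unit[OF d(2)] by simp
        moreover have "cnj (\<eta> x) \<noteq> 0" for x using dual_groupD(2)[OF d(2), of x] by auto
        ultimately show "\<xi> = \<eta>" by (simp add: fun_eq_iff)
      qed
    qed
    then show ?thesis by simp
  qed
  have "dual_group \<subseteq> (\<Union>b\<in>{b\<in>B. 0 \<in> b}. X b)"
  proof
    fix \<xi> :: "'a \<Rightarrow> complex" assume \<xi>: "\<xi> \<in> dual_group"
    have "open {x. cmod (\<xi> x - 1) < 1/4}" "0 \<in> {x. cmod (\<xi> x - 1) < 1/4}"
      by (auto intro!: open_Collect_less continuous_intros dual_groupD(1)[OF \<xi>] simp: dual_zero[OF \<xi>])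
    then obtain b where "b \<in> B" "0 \<in> b" "b \<subseteq> {x. cmod (\<xi> x - 1) < 1/4}"
      by (rule topological_basisE[OF B(2)])
    then show "\<xi> \<in> (\<Union>b\<in>{b\<in>B. 0 \<in> b}. X b)" using \<xi> by (force simp: X_def)
  qed
  moreover have "countable (\<Union>b\<in>{b\<in>B. 0 \<in> b}. X b)"
  proof (rule countable_UN)
    show "countable {b\<in>B. 0 \<in> b}" by (rule countable_subset[OF _ B(1)]) auto
  qed (auto intro: countable_finite finX)
  ultimately show ?thesis by (rule countable_subset)
qed

section \<open>The dilation, its iterated kernels, and the Fourier transform\<close>

locale dilation = compact_group_haar M
  for M :: "'a::{topological_ab_group_add, second_countable_topology, t2_space} measure" +
  fixes A :: "'a \<Rightarrow> 'a"
  assumes A_add: "A (x + y) = A x + A y" and A_cont: "continuous_on UNIV A" and A_surj: "surj A"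
    and ker_finite: "finite (hom_ker A)" and ker_dense: "closure (\<Union>j. hom_ker (A ^^ j)) = UNIV"
begin

abbreviation K :: "nat \<Rightarrow> 'a set" where "K j \<equiv> hom_ker (A ^^ j)"

lemma A_zero [simp]: "A 0 = 0"
  using A_add[of 0 0] by simp

lemma A_diff: "A (x - y) = A x - A y"
  using A_add[of "x - y" y] by simp

lemma funpow_diff: "(A ^^ j) (x - y) = (A ^^ j) x - (A ^^ j) y"
  by (induction j) (simp_all add: A_diff)

lemma funpow_zero [simp]: "(A ^^ j) 0 = 0"
  by (induction j) simp_all

lemma K_Suc_iff: "x \<in> K (Suc j) \<longleftrightarrow> A x \<in> K j"
  by (simp add: hom_ker_def funpow_swap1)

lemma K_0: "K 0 = {0}"
  by (simp add: hom_ker_def)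

lemma K_1: "K (Suc 0) = hom_ker A"
  by (simp add: hom_ker_def)

lemma K_mono: "K j \<subseteq> K (Suc j)"
  by (auto simp: hom_ker_def)

lemma K_le: "i \<le> j \<Longrightarrow> K i \<subseteq> K j"
  by (rule lift_Suc_mono_le[of K, OF K_mono])

text \<open>
  A set-theoretic section of \<open>A\<close> identifies \<open>K\<^bsub>j+1\<^esub>\<close> with \<open>K\<^sub>j\<close> times the kernel of \<open>A\<close>.
\<close>

lemma K_finite_card: "finite (K j) \<and> card (K j) = card (hom_ker A) ^ j"
proof (induction j)
  case 0
  show ?case unfolding K_0 by simp
next
  case (Suc j)
  define s where "s = inv A"
  have s: "A (s x) = x" for x unfolding s_def by (rule surj_f_inv_f[OF A_surj])
  have bij: "bij_betw (\<lambda>(x, a). s x + a) (K j \<times> hom_ker A) (K (Suc j))"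
  proof (rule bij_betw_byWitness[where f' = "\<lambda>z. (A z, z - s (A z))"])
    show "\<forall>p\<in>K j \<times> hom_ker A. (\<lambda>z. (A z, z - s (A z))) ((\<lambda>(x, a). s x + a) p) = p"
      by (auto simp: A_add s hom_ker_def)
    show "(\<lambda>(x, a). s x + a) ` (K j \<times> hom_ker A) \<subseteq> K (Suc j)"
    proof clarify
      fix x a assume x: "x \<in> K j" "a \<in> hom_ker A"
      then have "A (s x + a) = x" by (simp add: A_add s hom_ker_def)
      then show "s x + a \<in> K (Suc j)" unfolding K_Suc_iff using x(1) by simp
    qed
    show "(\<lambda>z. (A z, z - s (A z))) ` K (Suc j) \<subseteq> K j \<times> hom_ker A"
    proof clarify
      fix z assume "z \<in> K (Suc j)"
      then show "A z \<in> K j \<and> z - s (A z) \<in> hom_ker A"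
        unfolding K_Suc_iff by (simp add: hom_ker_def A_diff s)
    qed
  qed simp
  then show ?case
    using Suc ker_finite bij_betw_finite[OF bij] bij_betw_same_card[OF bij]
    by (simp add: card_cartesian_product mult.commute del: funpow.simps)
qed

lemma K_subgroup: "finite_subgroup (K j)"
  using K_finite_card[of j] by (auto simp: finite_subgroup_def hom_ker_def funpow_diff)

lemma separates: "g \<noteq> 0 \<Longrightarrow> \<exists>\<xi>\<in>dual_group. \<xi> g \<noteq> 1" for g :: 'a
  using characters_separate_from_zero[OF compact_group K_subgroup K_mono ker_dense, of g] by blast

lemma countable_dual: "countable (dual_group :: ('a \<Rightarrow> complex) set)"
  by (rule countable_dual_group[OF K_subgroup K_mono ker_dense])

lemma dual_pullback: "\<xi> \<in> dual_group \<Longrightarrow> (\<lambda>x. \<xi> (A x)) \<in> dual_group"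
  by (auto simp: dual_group_def A_add intro: continuous_on_compose2[OF _ A_cont])

lemma dual_pullback_inj: "(\<lambda>x. \<xi> (A x)) = (\<lambda>x. \<eta> (A x)) \<Longrightarrow> \<xi> = \<eta>"
  using A_surj by (metis surj_f_inv_f ext)

text \<open>
  A character that is trivial on the kernel factors through \<open>A\<close> as a homomorphism; the factor is
  continuous because \<open>A\<close>, a continuous map between compact Hausdorff spaces, is closed.
\<close>

lemma dual_pullback_iff:
  assumes \<xi>: "\<xi> \<in> dual_group"
  shows "(\<exists>\<psi>\<in>dual_group. \<xi> = (\<lambda>x. \<psi> (A x))) \<longleftrightarrow> (\<forall>a\<in>hom_ker A. \<xi> a = 1)"
proof
  assume "\<exists>\<psi>\<in>dual_group. \<xi> = (\<lambda>x. \<psi> (A x))"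
  then show "\<forall>a\<in>hom_ker A. \<xi> a = 1" by (auto simp: hom_ker_def dual_zero)
next
  assume tr: "\<forall>a\<in>hom_ker A. \<xi> a = 1"
  define s where "s = inv A"
  have s: "A (s x) = x" for x unfolding s_def by (rule surj_f_inv_f[OF A_surj])
  define \<psi> where "\<psi> = (\<lambda>x. \<xi> (s x))"
  have fibre: "\<xi> x = \<xi> y" if "A x = A y" for x y
  proof -
    have "\<xi> (x - y) = 1" using tr that by (simp add: hom_ker_def A_diff)
    then show ?thesis using dual_groupD(3)[OF \<xi>, of "x - y" y] by simp
  qed
  have eq: "\<xi> = (\<lambda>x. \<psi> (A x))"
    unfolding \<psi>_def by (rule ext, rule fibre) (simp add: s)
  have "\<psi> \<in> dual_group" unfolding dual_group_def mem_Collect_eq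
  proof (intro conjI allI)
    show "cmod (\<psi> x) = 1" for x by (simp add: \<psi>_def dual_groupD(2)[OF \<xi>])
    show "\<psi> (x + y) = \<psi> x * \<psi> y" for x y
      unfolding \<psi>_def dual_groupD(3)[OF \<xi>, symmetric] by (rule fibre) (simp add: A_add s)
    have "closed (\<psi> -` C)" if C: "closed C" for C
    proof -
      have "closed (\<xi> -` C)"
        by (rule closed_vimage[OF C dual_groupD(1)[OF \<xi>]])
      then have "compact (\<xi> -` C)"
        using compact_group compact_Int_closed[of UNIV "\<xi> -` C"] by simp
      then have "compact (A ` (\<xi> -` C))"
        by (rule compact_continuous_image[OF continuous_on_subset[OF A_cont subset_UNIV]])
      moreover have "A ` (\<xi> -` C) = \<psi> -` C"
      proof
        show "A ` (\<xi> -` C) \<subseteq> \<psi> -` C" using eq by (auto simp: fun_eq_iff)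
        show "\<psi> -` C \<subseteq> A ` (\<xi> -` C)"
          by (auto simp: \<psi>_def intro!: image_eqI[of _ A "s _"] s[symmetric])
      qed
      ultimately show ?thesis by (simp add: compact_imp_closed)
    qed
    then show "continuous_on UNIV \<psi>" by (simp add: continuous_on_closed_vimage)
  qed
  then show "\<exists>\<psi>\<in>dual_group. \<xi> = (\<lambda>x. \<psi> (A x))" using eq by blast
qed

lemma A_measurable [measurable]: "A \<in> measurable M M"
  using A_cont by (simp add: measurable_cong_sets[OF sets_M sets_M] borel_measurable_continuous_onI)

text \<open>
  The image of Haar measure under \<open>A\<close> is invariant under translations by elements of the range of
  \<open>A\<close>, that is, under all translations.
\<close>

lemma distr_A: "distr M M A = M"
proof (rule normalized_haar_unique[OF _ haar])
  show "normalized_haar_measure (distr M M A)" unfolding normalized_haar_measure_def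
  proof (intro conjI allI)
    show "prob_space (distr M M A)" by (rule prob_space_distr[OF A_measurable])
    show "distr (distr M M A) (distr M M A) (\<lambda>x. a + x) = distr M M A" for a
    proof -
      obtain b where b: "A b = a" using A_surj by (metis surjD)
      have "distr (distr M M A) (distr M M A) (\<lambda>x. a + x) = distr (distr M M A) M (\<lambda>x. a + x)"
        by (rule distr_cong) simp_all
      also have "\<dots> = distr M M ((\<lambda>x. a + x) \<circ> A)"
        by (rule distr_distr) simp_all
      also have "\<dots> = distr M M (A \<circ> (\<lambda>x. b + x))"
        by (rule distr_cong) (simp_all add: A_add b)
      also have "\<dots> = distr (distr M M (\<lambda>x. b + x)) M A"
        by (rule distr_distr[symmetric]) simp_all
      finally show ?thesis by (simp add: distr_translate)
    qed
  qed simp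
qed

lemma integral_A:
  fixes f :: "'a \<Rightarrow> 'b::{banach, second_countable_topology}"
  assumes "f \<in> borel_measurable M"
  shows "(LINT x|M. f (A x)) = (LINT x|M. f x)"
  using integral_distr[OF A_measurable assms] by (simp add: distr_A)

lemma integrable_A_iff:
  fixes f :: "'a \<Rightarrow> 'b::{banach, second_countable_topology}"
  assumes "f \<in> borel_measurable M"
  shows "integrable M (\<lambda>x. f (A x)) \<longleftrightarrow> integrable M f"
  using integrable_distr_eq[OF A_measurable assms] by (simp add: distr_A)

text \<open>
  Because the kernel of \<open>A\<close> is finite, \<open>A\<close> is injective on small compact sets, where its inverse
  is continuous. Finitely many of these sets cover the group, and the inverses are pasted together.
  The section makes periodizations measurable: they are only known to be measurable after
  composition with \<open>A\<close>.
\<close>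

lemma measurable_section:
  "\<exists>s. s \<in> measurable borel borel \<and> (\<forall>x. A (s x) = x)"
proof -
  have "closed (hom_ker A - {0})" using ker_finite by (intro finite_imp_closed) auto
  then have W: "open (- (hom_ker A - {0}))" "0 \<in> - (hom_ker A - {0})"
    unfolding closed_def by simp_all
  obtain U where U: "open U" "0 \<in> U" "\<And>a b. a \<in> U \<Longrightarrow> b \<in> U \<Longrightarrow> a - b \<in> - (hom_ker A - {0})"
    using exists_open_differences_subset[OF W] by blast
  obtain f :: "'a \<Rightarrow> real" where f: "continuous_on UNIV f" "f 0 = 1" "\<And>x. f x \<noteq> 0 \<Longrightarrow> x \<in> U"
    using compact_group_bump_function[OF compact_group closed_singleton[of 0] U(1)] U(2)
    by (metis empty_subsetI insert_subset singletonI)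
  define C where "C = (\<lambda>t. {x. 1/2 \<le> f (x - t)})"
  have contf: "continuous_on UNIV (\<lambda>x. f (x - t))" for t
    by (rule continuous_on_compose2[OF f(1)]) (auto intro!: continuous_intros)
  have compC: "compact (C t)" for t
  proof -
    have "closed (C t)" unfolding C_def by (intro closed_Collect_le continuous_intros contf)
    then show ?thesis using compact_Int_closed[OF compact_group, of "C t"] by simp
  qed
  have injC: "inj_on A (C t)" for t
  proof (rule inj_onI)
    fix x y assume "x \<in> C t" "y \<in> C t" "A x = A y"
    then have "(x - t) - (y - t) \<in> - (hom_ker A - {0})" by (intro U(3) f(3)) (auto simp: C_def)
    moreover have "x - y \<in> hom_ker A" using \<open>A x = A y\<close> by (simp add: hom_ker_def A_diff)
    ultimately show "x = y" by simp
  qed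
  have "UNIV \<subseteq> (\<Union>t\<in>UNIV. {x. 1/2 < f (x - t)})" using f(2) by (auto intro!: exI[of _ "_ :: 'a"])
  then obtain T where T: "finite T" "UNIV \<subseteq> (\<Union>t\<in>T. {x. 1/2 < f (x - t)})"
    by (rule compactE_image[OF compact_group, rotated])
       (auto intro!: open_Collect_less continuous_intros contf)
  have contA: "continuous_on (C t) A" for t by (rule continuous_on_subset[OF A_cont subset_UNIV])
  have "\<exists>s. s \<in> measurable borel borel \<and> (\<forall>x\<in>(\<Union>t\<in>T'. A ` C t). A (s x) = x)" if "finite T'" for T'
    using that
  proof (induction T')
    case empty
    then show ?case by (intro exI[of _ "\<lambda>_. 0"]) simp
  next
    case (insert t T')
    then obtain s where s: "s \<in> measurable borel borel" "\<forall>x\<in>(\<Union>t\<in>T'. A ` C t). A (s x) = x" by blast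
    define g where "g = the_inv_into (C t) A"
    have g: "continuous_on (A ` C t) g"
      unfolding g_def by (rule continuous_on_inv_into[OF contA compC injC])
    have "closed (A ` C t)" by (intro compact_imp_closed compact_continuous_image contA compC)
    then have D: "{x\<in>space borel. x \<in> A ` C t} \<in> sets borel" by simp
    have "(\<lambda>x. if x \<in> A ` C t then g x else s x) \<in> measurable borel borel"
      unfolding measurable_If_restrict_space_iff[OF D]
      using borel_measurable_continuous_on_restrict[OF g] measurable_restrict_space1[OF s(1)] by simp
    moreover have "\<forall>x\<in>(\<Union>t\<in>insert t T'. A ` C t). A (if x \<in> A ` C t then g x else s x) = x"
      using s(2) f_the_inv_into_f[OF injC] by (auto simp: g_def)
    ultimately show ?case by blast
  qed
  from this[OF T(1)] obtain s where s: "s \<in> measurable borel borel"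
    "\<forall>x\<in>(\<Union>t\<in>T. A ` C t). A (s x) = x" by blast
  have "x \<in> (\<Union>t\<in>T. A ` C t)" for x
  proof -
    obtain y where y: "A y = x" using A_surj by (metis surjD)
    then obtain t where "t \<in> T" "1/2 < f (y - t)" using T(2) by auto
    then show ?thesis using y by (auto simp: C_def intro!: bexI[of _ t] image_eqI[of _ A y])
  qed
  then show ?thesis using s by blast
qed

lemma L2_translate: "f \<in> L2 M \<Longrightarrow> translate \<gamma> f \<in> L2 M"
proof -
  assume f: "f \<in> L2 M"
  have eq: "translate \<gamma> f = (\<lambda>x. f (- \<gamma> + x))" by (simp add: translate_def)
  have "(\<lambda>x. f (- \<gamma> + x)) \<in> borel_measurable M"
    by (rule measurable_compose[OF translate_measurable]) (use f in \<open>simp add: L2_iff\<close>)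
  then show ?thesis
    using integrable_translate[of "\<lambda>x. (cmod (f x))\<^sup>2" "- \<gamma>"] f unfolding eq by (simp add: L2_iff)
qed

lemma fourier_translate:
  assumes f: "f \<in> L2 M" and \<xi>: "\<xi> \<in> dual_group"
  shows "fourier M (translate \<gamma> f) \<xi> = cnj (\<xi> \<gamma>) * fourier M f \<xi>"
proof -
  have "fourier M (translate \<gamma> f) \<xi> = (LINT x|M. translate \<gamma> f (\<gamma> + x) * cnj (\<xi> (\<gamma> + x)))"
    unfolding fourier_def
    by (rule integral_translate[symmetric, of "\<lambda>x. translate \<gamma> f x * cnj (\<xi> x)"])
       (rule borel_measurable_integrable[OF L2_mult_cnj_integrable[OF L2_translate[OF f] \<xi>]])
  also have "\<dots> = (LINT x|M. cnj (\<xi> \<gamma>) * (f x * cnj (\<xi> x)))"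
    by (simp add: translate_def dual_groupD(3)[OF \<xi>] mult_ac)
  finally show ?thesis by (simp add: fourier_def)
qed

lemma L2_pullback_iff:
  assumes "f \<in> borel_measurable M"
  shows "(\<lambda>x. f (A x)) \<in> L2 M \<longleftrightarrow> f \<in> L2 M"
proof -
  have "(\<lambda>x. (cmod (f x))\<^sup>2) \<in> borel_measurable M" using assms by simp
  from integrable_A_iff[OF this] show ?thesis
    using measurable_compose[OF A_measurable assms] assms unfolding L2_def mem_Collect_eq by blast
qed

lemma L2_pullback: "f \<in> L2 M \<Longrightarrow> (\<lambda>x. f (A x)) \<in> L2 M"
  using L2_pullback_iff[of f] by (simp add: L2_iff)

lemma fourier_pullback:
  assumes f: "f \<in> L2 M" and \<psi>: "\<psi> \<in> dual_group"
  shows "fourier M (\<lambda>x. f (A x)) (\<lambda>x. \<psi> (A x)) = fourier M f \<psi>"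
  unfolding fourier_def
  by (rule integral_A[of "\<lambda>x. f x * cnj (\<psi> x)"])
     (rule borel_measurable_integrable[OF L2_mult_cnj_integrable[OF f \<psi>]])

text \<open>
  The function \<open>f \<circ> A\<close> is invariant under translation by \<open>a\<close>, which multiplies the coefficient by
  a number different from \<open>1\<close>.
\<close>

lemma fourier_pullback_eq_0:
  assumes f: "f \<in> L2 M" and \<xi>: "\<xi> \<in> dual_group" and a: "a \<in> hom_ker A" "\<xi> a \<noteq> 1"
  shows "fourier M (\<lambda>x. f (A x)) \<xi> = 0"
proof -
  have "translate a (\<lambda>x. f (A x)) = (\<lambda>x. f (A x))"
    using a(1) by (simp add: translate_def A_diff hom_ker_def)
  then have "fourier M (\<lambda>x. f (A x)) \<xi> = cnj (\<xi> a) * fourier M (\<lambda>x. f (A x)) \<xi>"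
    using fourier_translate[OF L2_pullback[OF f] \<xi>, of a] by simp
  moreover have "cnj (\<xi> a) \<noteq> 1" using a(2) by (metis complex_cnj_cnj complex_cnj_one)
  ultimately show ?thesis by simp
qed

lemma periodize_A: "periodize A f (A y) = (\<Sum>a\<in>hom_ker A. translate (- a) f y)"
  using periodize_eq[of A, OF A_add refl] by (simp add: translate_def)

lemma periodize_pullback:
  assumes f: "f \<in> L2 M" and \<xi>: "\<xi> \<in> dual_group"
  shows "(\<lambda>y. periodize A f (A y)) \<in> L2 M"
    and "fourier M (\<lambda>y. periodize A f (A y)) \<xi> = (\<Sum>a\<in>hom_ker A. \<xi> a) * fourier M f \<xi>"
  unfolding periodize_A
  using fourier_sum[OF ker_finite L2_translate[OF f] \<xi>, of uminus]
  by (simp_all add: fourier_translate[OF f \<xi>] dual_minus[OF \<xi>] sum_distrib_right)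

lemma L2_periodize:
  assumes f: "f \<in> L2 M"
  shows "periodize A f \<in> L2 M"
proof -
  obtain s where s: "s \<in> measurable borel borel" "\<forall>x. A (s x) = x"
    using measurable_section by blast
  have pb: "(\<lambda>y. periodize A f (A y)) \<in> L2 M" by (rule periodize_pullback(1)[OF f dual_one])
  have "(\<lambda>x. periodize A f (A (s x))) \<in> borel_measurable borel"
    using measurable_compose[OF s(1), of "\<lambda>y. periodize A f (A y)" borel] pb by (simp add: L2_iff)
  then have "periodize A f \<in> borel_measurable M" by (simp add: s(2))
  from L2_pullback_iff[OF this] show ?thesis using pb by simp
qed

lemma fourier_periodize:
  assumes f: "f \<in> L2 M" and \<psi>: "\<psi> \<in> dual_group"
  shows "fourier M (periodize A f) \<psi> = of_nat (card (hom_ker A)) * fourier M f (\<lambda>x. \<psi> (A x))"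
proof -
  have "fourier M (periodize A f) \<psi> = fourier M (\<lambda>y. periodize A f (A y)) (\<lambda>x. \<psi> (A x))"
    by (rule fourier_pullback[OF L2_periodize[OF f] \<psi>, symmetric])
  also have "\<dots> = (\<Sum>a\<in>hom_ker A. \<psi> (A a)) * fourier M f (\<lambda>x. \<psi> (A x))"
    by (rule periodize_pullback(2)[OF f dual_pullback[OF \<psi>]])
  also have "(\<Sum>a\<in>hom_ker A. \<psi> (A a)) = (\<Sum>a\<in>hom_ker A. 1)"
    by (intro sum.cong refl) (simp add: hom_ker_def dual_zero[OF \<psi>])
  finally show ?thesis by simp
qed

section \<open>Nested transversals and the multiresolution analysis\<close>


declare funpow.simps(2) [simp del]

text \<open>
  Taking least elements for one enumeration of the dual group, the same for all \<open>j\<close>, makes these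
  sets increase with \<open>j\<close>: the classes modulo equality on \<open>K\<^sub>j\<close> shrink, so least elements stay least.
\<close>

definition least_reps :: "nat \<Rightarrow> ('a \<Rightarrow> complex) set" where
  "least_reps j = {\<xi>\<in>dual_group. \<forall>\<eta>\<in>dual_group. agree_on (K j) \<xi> \<eta> \<longrightarrow>
     to_nat_on dual_group \<xi> \<le> to_nat_on dual_group \<eta>}"

text \<open>
  Within the range of the pullback, compatibility with the dilation dictates the choice. The
  characters outside this range are those nontrivial on the kernel of \<open>A\<close>; this set is a union of
  classes modulo equality on \<open>K\<^bsub>j+1\<^esub>\<close>, and there the least elements are taken.
\<close>

primrec freqs :: "nat \<Rightarrow> ('a \<Rightarrow> complex) set" where
  "freqs 0 = {\<lambda>_. 1}"
| "freqs (Suc j) = (\<lambda>\<psi> x. \<psi> (A x)) ` freqs j \<union> {\<xi>\<in>least_reps (Suc j). \<exists>a\<in>hom_ker A. \<xi> a \<noteq> 1}"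

lemma enum_inj: "inj_on (to_nat_on dual_group) (dual_group :: ('a \<Rightarrow> complex) set)"
  by (rule inj_on_to_nat_on[OF countable_dual])

lemma freqs_dual: "freqs j \<subseteq> dual_group"
  by (induction j) (auto simp: dual_one dual_pullback least_reps_def)

lemma agree_on_pullback: "agree_on (K (Suc j)) (\<lambda>x. \<psi> (A x)) (\<lambda>x. \<eta> (A x)) \<longleftrightarrow> agree_on (K j) \<psi> \<eta>"
proof
  assume *: "agree_on (K (Suc j)) (\<lambda>x. \<psi> (A x)) (\<lambda>x. \<eta> (A x))"
  show "agree_on (K j) \<psi> \<eta>" unfolding agree_on_def
  proof
    fix y assume y: "y \<in> K j"
    obtain x where x: "A x = y" using A_surj by (metis surjD)
    then have "x \<in> K (Suc j)" using y unfolding K_Suc_iff by simp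
    with * have "\<psi> (A x) = \<eta> (A x)" unfolding agree_on_def by (rule bspec)
    then show "\<psi> y = \<eta> y" using x by simp
  qed
next
  assume "agree_on (K j) \<psi> \<eta>"
  then show "agree_on (K (Suc j)) (\<lambda>x. \<psi> (A x)) (\<lambda>x. \<eta> (A x))"
    unfolding agree_on_def by (blast dest: K_Suc_iff[THEN iffD1])
qed

lemma ker_subset_K: "hom_ker A \<subseteq> K (Suc j)"
  using K_le[of "Suc 0" "Suc j"] unfolding K_1 by simp

lemma ex_least_rep:
  assumes \<xi>: "\<xi> \<in> dual_group"
  shows "\<exists>\<theta>\<in>least_reps j. agree_on (K j) \<xi> \<theta>"
proof -
  \<comment> \<open>The least index occurring in the class of \<xi>.\<close>
  define n where "n = (LEAST n. \<exists>\<eta>\<in>dual_group. agree_on (K j) \<xi> \<eta> \<and> to_nat_on dual_group \<eta> = n)"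
  have "\<exists>n. \<exists>\<eta>\<in>dual_group. agree_on (K j) \<xi> \<eta> \<and> to_nat_on dual_group \<eta> = n"
    using \<xi> agree_on_refl by blast
  from LeastI_ex[OF this] obtain \<theta> where \<theta>: "\<theta> \<in> dual_group" "agree_on (K j) \<xi> \<theta>"
    "to_nat_on dual_group \<theta> = n" unfolding n_def by blast
  have "\<theta> \<in> least_reps j" unfolding least_reps_def
  proof (intro CollectI conjI ballI impI \<theta>(1))
    fix \<eta> :: "'a \<Rightarrow> complex" assume "\<eta> \<in> dual_group" "agree_on (K j) \<theta> \<eta>"
    then have "\<exists>\<eta>'\<in>dual_group. agree_on (K j) \<xi> \<eta>' \<and> to_nat_on dual_group \<eta>' = to_nat_on dual_group \<eta>"
      using agree_on_trans[OF \<theta>(2)] by blast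
    then show "to_nat_on dual_group \<theta> \<le> to_nat_on dual_group \<eta>"
      unfolding \<theta>(3) n_def by (rule Least_le)
  qed
  then show ?thesis using \<theta>(2) by blast
qed

text \<open>
  The characters trivial on the kernel of \<open>A\<close> are the pullbacks \<open>\<psi> \<circ> A\<close>, and two pullbacks agree
  on \<open>K\<^bsub>j+1\<^esub>\<close> exactly when the original characters agree on \<open>K\<^sub>j\<close>; these classes are handled by
  induction. Each remaining class consists of characters nontrivial on the kernel and has a least
  element.
\<close>

lemma freqs_transversal: "transversal (K j) (freqs j)"
proof (induction j)
  case 0
  have "agree_on (K 0) \<xi> (\<lambda>_. 1)" if "\<xi> \<in> dual_group" for \<xi>
    unfolding K_0 agree_on_def using dual_zero[OF that] by simp
  then show ?case using dual_one unfolding transversal_def freqs.simps(1) by blast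
next
  case (Suc j)
  have "\<exists>!\<eta>. \<eta> \<in> freqs (Suc j) \<and> agree_on (K (Suc j)) \<xi> \<eta>" if \<xi>: "\<xi> \<in> dual_group" for \<xi>
  proof (cases "\<forall>a\<in>hom_ker A. \<xi> a = 1")
    case True
    then obtain \<psi> where \<psi>: "\<psi> \<in> dual_group" "\<xi> = (\<lambda>x. \<psi> (A x))"
      using dual_pullback_iff[OF \<xi>] by blast
    obtain \<eta> where \<eta>: "\<eta> \<in> freqs j" "agree_on (K j) \<psi> \<eta>"
      "\<And>\<eta>'. \<eta>' \<in> freqs j \<Longrightarrow> agree_on (K j) \<psi> \<eta>' \<Longrightarrow> \<eta>' = \<eta>"
      using Suc \<psi>(1) unfolding transversal_def by blast
    show ?thesis
    proof (rule ex1I[of _ "\<lambda>x. \<eta> (A x)"])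
      show "(\<lambda>x. \<eta> (A x)) \<in> freqs (Suc j) \<and> agree_on (K (Suc j)) \<xi> (\<lambda>x. \<eta> (A x))"
        unfolding \<psi>(2) agree_on_pullback using \<eta>(1,2) by auto
      fix \<theta> assume \<theta>: "\<theta> \<in> freqs (Suc j) \<and> agree_on (K (Suc j)) \<xi> \<theta>"
      then have "\<forall>a\<in>hom_ker A. \<theta> a = 1"
        using True ker_subset_K[of j] unfolding agree_on_def by (metis subsetD)
      then obtain \<eta>' where \<eta>': "\<eta>' \<in> freqs j" "\<theta> = (\<lambda>x. \<eta>' (A x))" using \<theta> by auto
      then have "agree_on (K j) \<psi> \<eta>'"
        using \<theta> unfolding \<psi>(2) by (simp only: agree_on_pullback)
      then show "\<theta> = (\<lambda>x. \<eta> (A x))" using \<eta>(3) \<eta>' by blast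
    qed
  next
    case False
    then obtain a where a: "a \<in> hom_ker A" "\<xi> a \<noteq> 1" by blast
    have nontriv: "\<exists>a\<in>hom_ker A. \<eta> a \<noteq> 1" if "agree_on (K (Suc j)) \<xi> \<eta>" for \<eta>
      using a that ker_subset_K[of j] unfolding agree_on_def by (metis subsetD)
    obtain \<theta> where \<theta>: "\<theta> \<in> least_reps (Suc j)" "agree_on (K (Suc j)) \<xi> \<theta>"
      using ex_least_rep[OF \<xi>] by blast
    show ?thesis
    proof (rule ex1I[of _ \<theta>])
      show "\<theta> \<in> freqs (Suc j) \<and> agree_on (K (Suc j)) \<xi> \<theta>" using \<theta> nontriv by auto
      fix \<theta>' assume \<theta>': "\<theta>' \<in> freqs (Suc j) \<and> agree_on (K (Suc j)) \<xi> \<theta>'"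
      obtain b where b: "b \<in> hom_ker A" "\<theta>' b \<noteq> 1" using nontriv \<theta>' by blast
      have "\<theta>' \<notin> (\<lambda>\<psi> x. \<psi> (A x)) ` freqs j"
        using b freqs_dual[of j] by (auto simp: hom_ker_def dual_zero)
      then have "\<theta>' \<in> least_reps (Suc j)" using \<theta>' by auto
      moreover have "agree_on (K (Suc j)) \<theta> \<theta>'" "agree_on (K (Suc j)) \<theta>' \<theta>"
        using \<theta>(2) \<theta>' agree_on_sym agree_on_trans by blast+
      ultimately have "to_nat_on dual_group \<theta> = to_nat_on dual_group \<theta>'" "\<theta> \<in> dual_group" "\<theta>' \<in> dual_group"
        using \<theta>(1) by (auto simp: least_reps_def intro!: antisym)
      then show "\<theta>' = \<theta>" using enum_inj by (metis inj_onD)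
    qed
  qed
  then show ?case using freqs_dual[of "Suc j"] unfolding transversal_def by blast
qed

lemma least_reps_mono: "i \<le> j \<Longrightarrow> least_reps i \<subseteq> least_reps j"
  using agree_on_mono[OF _ K_le] by (auto simp: least_reps_def)

lemma freqs_mono: "freqs j \<subseteq> freqs (Suc j)"
proof (induction j)
  case 0
  show ?case by auto
next
  case (Suc j)
  then show ?case using least_reps_mono[of "Suc j" "Suc (Suc j)"] by auto
qed

lemma freqs_pullback: "\<psi> \<in> freqs j \<Longrightarrow> (\<lambda>x. \<psi> (A x)) \<in> freqs (Suc j)"
  by simp

lemma freqs_pullbackD:
  assumes \<psi>: "\<psi> \<in> dual_group" and "(\<lambda>x. \<psi> (A x)) \<in> freqs (Suc j)"
  shows "\<psi> \<in> freqs j"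
proof -
  have "\<not> (\<exists>a\<in>hom_ker A. \<psi> (A a) \<noteq> 1)" by (simp add: hom_ker_def dual_zero[OF \<psi>])
  then have "(\<lambda>x. \<psi> (A x)) \<in> (\<lambda>\<psi> x. \<psi> (A x)) ` freqs j" using assms(2) by simp
  then show ?thesis using dual_pullback_inj by blast
qed

lemma agree_on_all:
  assumes "\<xi> \<in> dual_group" "\<eta> \<in> dual_group" "\<And>j. agree_on (K j) \<xi> \<eta>"
  shows "\<xi> = \<eta>"
proof -
  have "closed {x. \<xi> x = \<eta> x}" by (intro closed_Collect_eq dual_groupD(1) assms(1,2))
  then have "closure (\<Union>j. K j) \<subseteq> {x. \<xi> x = \<eta> x}"
    by (intro closure_minimal) (use assms(3) in \<open>auto simp: agree_on_def\<close>)
  then show ?thesis unfolding ker_dense by auto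
qed

lemma least_reps_exhaust:
  assumes \<xi>: "\<xi> \<in> dual_group"
  shows "\<exists>j. \<xi> \<in> least_reps j"
proof -
  define E where "E = {\<eta> :: 'a \<Rightarrow> complex. \<eta> \<in> dual_group \<and> to_nat_on dual_group \<eta> < to_nat_on dual_group \<xi>}"
  have "finite (to_nat_on dual_group ` E)"
    by (rule finite_subset[of _ "{..<to_nat_on dual_group \<xi>}"]) (auto simp: E_def)
  then have fin: "finite E"
    by (rule finite_imageD) (rule inj_on_subset[OF enum_inj], auto simp: E_def)
  have "\<forall>\<eta>\<in>E. \<exists>j. \<not> agree_on (K j) \<xi> \<eta>"
  proof (rule ballI, rule ccontr)
    fix \<eta> assume \<eta>: "\<eta> \<in> E" "\<nexists>j. \<not> agree_on (K j) \<xi> \<eta>"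
    then have "\<xi> = \<eta>" using agree_on_all[OF \<xi>, of \<eta>] by (auto simp: E_def)
    then show False using \<eta>(1) by (simp add: E_def)
  qed
  then obtain i where i: "\<And>\<eta>. \<eta> \<in> E \<Longrightarrow> \<not> agree_on (K (i \<eta>)) \<xi> \<eta>" by metis
  define j where "j = Max (insert 0 (i ` E))"
  have "\<xi> \<in> least_reps j" unfolding least_reps_def
  proof (intro CollectI conjI \<xi> ballI impI, rule ccontr)
    fix \<eta> :: "'a \<Rightarrow> complex"
    assume \<eta>: "\<eta> \<in> dual_group" "agree_on (K j) \<xi> \<eta>" "\<not> to_nat_on dual_group \<xi> \<le> to_nat_on dual_group \<eta>"
    then have "\<eta> \<in> E" by (simp add: E_def)
    moreover from this have "i \<eta> \<le> j" using fin by (simp add: j_def)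
    ultimately show False using i agree_on_mono[OF \<eta>(2) K_le] by blast
  qed
  then show ?thesis ..
qed

text \<open>
  A character outside the range of the pullback has only finitely many predecessors in the
  enumeration, and each of them is separated from it by some \<open>K\<^sub>j\<close>, so it is eventually the least
  of its class. A character missed by all \<open>freqs j\<close> would then be a pullback of a missed character,
  and, by iteration, trivial on every \<open>K\<^sub>j\<close>; but the trivial character belongs to \<open>freqs 0\<close>.
\<close>

lemma freqs_exhaust:
  assumes \<xi>: "\<xi> \<in> dual_group"
  shows "\<exists>j. \<xi> \<in> freqs j"
proof (rule ccontr)
  assume none: "\<nexists>j. \<xi> \<in> freqs j"
  have step: "\<exists>\<psi>\<in>dual_group. (\<nexists>j. \<psi> \<in> freqs j) \<and> \<eta> = (\<lambda>x. \<psi> (A x))"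
    if \<eta>: "\<eta> \<in> dual_group" and no: "\<nexists>j. \<eta> \<in> freqs j" for \<eta>
  proof -
    obtain j where "\<eta> \<in> least_reps j" using least_reps_exhaust[OF \<eta>] by blast
    then have "\<eta> \<in> least_reps (Suc j)" using least_reps_mono[of j "Suc j"] by auto
    then have "\<forall>a\<in>hom_ker A. \<eta> a = 1" using no by (metis (mono_tags, lifting) UnI2 freqs.simps(2) mem_Collect_eq)
    then obtain \<psi> where \<psi>: "\<psi> \<in> dual_group" "\<eta> = (\<lambda>x. \<psi> (A x))"
      using dual_pullback_iff[OF \<eta>] by blast
    moreover have "\<nexists>j. \<psi> \<in> freqs j" using no freqs_pullback unfolding \<psi>(2) by blast
    ultimately show ?thesis by blast
  qed
  have "\<exists>\<psi>\<in>dual_group. (\<nexists>j. \<psi> \<in> freqs j) \<and> \<xi> = (\<lambda>x. \<psi> ((A ^^ k) x))" for k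
  proof (induction k)
    case 0
    then show ?case using \<xi> none by auto
  next
    case (Suc k)
    then obtain \<psi> where "\<psi> \<in> dual_group" "\<nexists>j. \<psi> \<in> freqs j" "\<xi> = (\<lambda>x. \<psi> ((A ^^ k) x))" by blast
    moreover from step[OF this(1,2)] obtain \<psi>' where
      "\<psi>' \<in> dual_group" "\<nexists>j. \<psi>' \<in> freqs j" "\<psi> = (\<lambda>x. \<psi>' (A x))" by blast
    ultimately show ?case by (intro bexI[of _ \<psi>']) (auto simp: funpow.simps(2))
  qed
  then have "agree_on (K k) \<xi> (\<lambda>_. 1)" for k
    unfolding agree_on_def hom_ker_def by (metis (mono_tags, lifting) dual_zero mem_Collect_eq)
  then have "\<xi> = (\<lambda>_. 1)" by (rule agree_on_all[OF \<xi> dual_one])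
  then have "\<xi> \<in> freqs 0" by simp
  then show False using none by blast
qed

text \<open>
  Vanishing coefficients, rather than linear combinations, define the space: this makes
  closedness and stability under almost-everywhere equality immediate.
\<close>

definition spectral_space :: "('a \<Rightarrow> complex) set \<Rightarrow> ('a \<Rightarrow> complex) set" where
  "spectral_space S = {f \<in> L2 M. \<forall>\<xi>\<in>dual_group - S. fourier M f \<xi> = 0}"

lemma spectral_space_closed: "closed_L2_subspace M (spectral_space S)"
  unfolding closed_L2_subspace_def
proof (intro conjI ballI allI subsetI)
  show "(\<lambda>x. 0) \<in> spectral_space S"
    using L2_bounded[of "\<lambda>_. 0" 0] by (simp add: spectral_space_def fourier_def)
  show "(\<lambda>x. f x + g x) \<in> spectral_space S" if "f \<in> spectral_space S" "g \<in> spectral_space S" for f g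
    using that by (simp add: spectral_space_def L2_add fourier_add)
  show "(\<lambda>x. c * f x) \<in> spectral_space S" if "f \<in> spectral_space S" for f c
    using that by (simp add: spectral_space_def L2_scale fourier_scale)
  fix f assume f: "f \<in> L2_closure M (spectral_space S)"
  then have fL: "f \<in> L2 M" by (simp add: L2_closure_def)
  have "fourier M f \<xi> = 0" if \<xi>: "\<xi> \<in> dual_group - S" for \<xi>
  proof (rule ccontr)
    assume "fourier M f \<xi> \<noteq> 0"
    then have "0 < cmod (fourier M f \<xi>)" by simp
    with f have "\<exists>g\<in>spectral_space S. L2_norm M (\<lambda>x. f x - g x) < cmod (fourier M f \<xi>)"
      unfolding L2_closure_def by simp
    then obtain g where g: "g \<in> spectral_space S" "L2_norm M (\<lambda>x. f x - g x) < cmod (fourier M f \<xi>)" ..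
    have gL: "g \<in> L2 M" and "fourier M g \<xi> = 0" using g(1) \<xi> by (auto simp: spectral_space_def)
    then have "cmod (fourier M f \<xi>) \<le> L2_norm M (\<lambda>x. f x - g x)"
      using fourier_le[OF L2_diff[OF fL gL], of \<xi>] fourier_diff[OF fL gL, of \<xi>] \<xi> by simp
    then show False using g(2) by simp
  qed
  then show "f \<in> spectral_space S" using fL by (simp add: spectral_space_def)
qed (simp add: spectral_space_def)

lemma spectral_space_mono: "S \<subseteq> T \<Longrightarrow> spectral_space S \<subseteq> spectral_space T"
  by (auto simp: spectral_space_def)

lemma character_in_spectral_space: "S \<subseteq> dual_group \<Longrightarrow> \<xi> \<in> S \<Longrightarrow> \<xi> \<in> spectral_space S"
  using dual_L2[of \<xi>] fourier_character[of \<xi>] by (auto simp: spectral_space_def)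

lemma spectral_space_translate_iff:
  assumes f: "f \<in> L2 M"
  shows "translate \<gamma> f \<in> spectral_space S \<longleftrightarrow> f \<in> spectral_space S"
proof -
  have "cnj (\<xi> \<gamma>) \<noteq> 0" if "\<xi> \<in> dual_group" for \<xi>
    using dual_groupD(2)[OF that, of \<gamma>] by auto
  then show ?thesis
    using f by (auto simp: spectral_space_def L2_translate fourier_translate)
qed

lemma fourier_cong_AE:
  assumes "f \<in> L2 M" "g \<in> L2 M" "\<xi> \<in> dual_group" "AE x in M. f x = g x"
  shows "fourier M f \<xi> = fourier M g \<xi>"
  unfolding fourier_def
proof (rule integral_cong_AE)
  show "AE x in M. f x * cnj (\<xi> x) = g x * cnj (\<xi> x)" using assms(4) by eventually_elim simp
qed (use L2_mult_cnj_integrable[OF assms(1,3)] L2_mult_cnj_integrable[OF assms(2,3)] in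
      \<open>auto dest: borel_measurable_integrable simp del: measurable_M\<close>)

lemma fourier_trig_sum:
  assumes "finite S" "S \<subseteq> dual_group" "\<eta> \<in> dual_group"
  shows "(\<lambda>x. \<Sum>\<xi>\<in>S. c \<xi> * \<xi> x) \<in> L2 M"
    and "fourier M (\<lambda>x. \<Sum>\<xi>\<in>S. c \<xi> * \<xi> x) \<eta> = (if \<eta> \<in> S then c \<eta> else 0)"
proof -
  have L: "(\<lambda>x. c \<xi> * \<xi> x) \<in> L2 M" if "\<xi> \<in> S" for \<xi>
    using that assms(2) by (intro L2_scale dual_L2) auto
  have fs: "(\<lambda>x. \<Sum>\<xi>\<in>S. c \<xi> * \<xi> x) \<in> L2 M \<and>
      fourier M (\<lambda>x. \<Sum>\<xi>\<in>S. c \<xi> * \<xi> x) \<eta> = (\<Sum>\<xi>\<in>S. fourier M (\<lambda>x. c \<xi> * \<xi> x) \<eta>)"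
    by (rule fourier_sum[OF assms(1) L assms(3)])
  show "(\<lambda>x. \<Sum>\<xi>\<in>S. c \<xi> * \<xi> x) \<in> L2 M" using fs by blast
  have "fourier M (\<lambda>x. \<Sum>\<xi>\<in>S. c \<xi> * \<xi> x) \<eta> = (\<Sum>\<xi>\<in>S. if \<xi> = \<eta> then c \<xi> else 0)"
    unfolding fs[THEN conjunct2] fourier_scale
    by (intro sum.cong refl) (use assms fourier_character in auto)
  then show "fourier M (\<lambda>x. \<Sum>\<xi>\<in>S. c \<xi> * \<xi> x) \<eta> = (if \<eta> \<in> S then c \<eta> else 0)"
    using assms(1) by simp
qed

text \<open>
  The difference of the two sides has no nonzero Fourier coefficient.
\<close>

lemma spectral_space_expansion:
  assumes S: "finite S" "S \<subseteq> dual_group" and f: "f \<in> spectral_space S"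
  shows "AE x in M. f x = (\<Sum>\<xi>\<in>S. fourier M f \<xi> * \<xi> x)"
proof -
  have fL: "f \<in> L2 M" using f by (simp add: spectral_space_def)
  have sL: "(\<lambda>x. \<Sum>\<xi>\<in>S. fourier M f \<xi> * \<xi> x) \<in> L2 M"
    by (rule fourier_trig_sum(1)[OF S dual_one])
  have "AE x in M. f x - (\<Sum>\<xi>\<in>S. fourier M f \<xi> * \<xi> x) = 0"
  proof (rule fourier_uniqueness[OF separates L2_diff[OF fL sL]])
    fix \<eta> :: "'a \<Rightarrow> complex" assume \<eta>: "\<eta> \<in> dual_group"
    then show "fourier M (\<lambda>x. f x - (\<Sum>\<xi>\<in>S. fourier M f \<xi> * \<xi> x)) \<eta> = 0"
      using f by (simp add: fourier_diff[OF fL sL] fourier_trig_sum(2)[OF S] spectral_space_def)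
  qed
  then show ?thesis by eventually_elim simp
qed

lemma fourier_translates_sum:
  assumes K: "finite K'" and g: "g \<in> L2 M" and \<xi>: "\<xi> \<in> dual_group"
  shows "(\<lambda>x. \<Sum>a\<in>K'. c a * translate a g x) \<in> L2 M"
    and "fourier M (\<lambda>x. \<Sum>a\<in>K'. c a * translate a g x) \<xi> = (\<Sum>a\<in>K'. c a * cnj (\<xi> a)) * fourier M g \<xi>"
proof -
  note fs = fourier_sum[of K' "\<lambda>a x. c a * translate a g x", OF K L2_scale[OF L2_translate[OF g]] \<xi>]
  show "(\<lambda>x. \<Sum>a\<in>K'. c a * translate a g x) \<in> L2 M" using fs by blast
  show "fourier M (\<lambda>x. \<Sum>a\<in>K'. c a * translate a g x) \<xi> = (\<Sum>a\<in>K'. c a * cnj (\<xi> a)) * fourier M g \<xi>"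
    unfolding fs[THEN conjunct2] fourier_scale fourier_translate[OF g \<xi>] sum_distrib_right
    by (simp add: mult.assoc)
qed

text \<open>
  In the coordinates given by Fourier coefficients, the translates of \<open>g\<close> by \<open>a \<in> K'\<close> are the columns
  of the matrix with entries \<open>cnj (\<xi> a)\<close>. Its rows and its columns are orthogonal, so it is
  invertible with an explicit inverse.
\<close>

lemma transversal_translates_basis:
  assumes K': "finite_subgroup K'" and S: "transversal K' S"
  defines "g \<equiv> \<lambda>x. \<Sum>\<xi>\<in>S. 1 * \<xi> x"
  shows "g \<in> spectral_space S" and "L2_basis M K' (\<lambda>a. translate a g) (spectral_space S)"
proof -
  note fK = finite_subgroupD[OF K']
  have Sd: "S \<subseteq> dual_group" using S by (simp add: transversal_def)
  have fin: "finite S" by (rule transversal_finite[OF K' S])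
  have card: "card S = card K'" by (rule transversal_card[OF K' S separates])
  have cardpos: "card K' \<noteq> 0" using fK(1,2) by auto
  have gL: "g \<in> L2 M" unfolding g_def by (rule fourier_trig_sum(1)[OF fin Sd dual_one])
  have gF: "fourier M g \<xi> = (if \<xi> \<in> S then 1 else 0)" if "\<xi> \<in> dual_group" for \<xi>
    unfolding g_def by (rule fourier_trig_sum(2)[OF fin Sd that])
  show gV: "g \<in> spectral_space S" using gL gF by (simp add: spectral_space_def)
  have col: "(\<Sum>\<xi>\<in>S. \<xi> b * cnj (\<xi> a)) = (if a = b then of_nat (card K') else 0)"
    if "a \<in> K'" "b \<in> K'" for a b
  proof -
    have "(\<Sum>\<xi>\<in>S. \<xi> b * cnj (\<xi> a)) = (\<Sum>\<xi>\<in>S. \<xi> (b - a))"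
      using Sd by (intro sum.cong refl) (auto simp: dual_diff)
    also have "\<dots> = (if a = b then of_nat (card K') else 0)"
    proof (cases "a = b")
      case True
      have "(\<Sum>\<xi>\<in>S. \<xi> 0) = (\<Sum>\<xi>\<in>S. 1)"
        using Sd by (intro sum.cong refl) (auto simp: dual_zero)
      then show ?thesis using True card by simp
    next
      case False
      then show ?thesis
        using transversal_column_sum[OF K' S _ fK(4)[OF that(2,1)]] separates[of "b - a"] by auto
    qed
    finally show ?thesis .
  qed
  show "L2_basis M K' (\<lambda>a. translate a g) (spectral_space S)" unfolding L2_basis_def
  proof (intro conjI ballI allI impI)
    show "finite K'" by (rule fK(1))
    show "translate a g \<in> spectral_space S" for a
      using gV spectral_space_translate_iff[OF gL] by blast
    fix c b assume zero: "AE x in M. (\<Sum>a\<in>K'. c a * translate a g x) = 0" and b: "b \<in> K'"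
    have row: "(\<Sum>a\<in>K'. c a * cnj (\<xi> a)) = 0" if \<xi>: "\<xi> \<in> S" for \<xi>
    proof -
      have \<xi>d: "\<xi> \<in> dual_group" using \<xi> Sd by auto
      have "fourier M (\<lambda>x. \<Sum>a\<in>K'. c a * translate a g x) \<xi> = fourier M (\<lambda>x. 0) \<xi>"
        by (rule fourier_cong_AE[OF fourier_translates_sum(1)[OF fK(1) gL \<xi>d] _ \<xi>d zero])
           (simp add: L2_bounded[of "\<lambda>_. 0" 0])
      then show ?thesis
        unfolding fourier_translates_sum(2)[OF fK(1) gL \<xi>d] gF[OF \<xi>d] using \<xi> by (simp add: fourier_def)
    qed
    have "0 = (\<Sum>\<xi>\<in>S. \<xi> b * (\<Sum>a\<in>K'. c a * cnj (\<xi> a)))" by (simp add: row)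
    also have "\<dots> = (\<Sum>\<xi>\<in>S. \<Sum>a\<in>K'. c a * (\<xi> b * cnj (\<xi> a)))"
      by (simp add: sum_distrib_left mult.left_commute)
    also have "\<dots> = (\<Sum>a\<in>K'. \<Sum>\<xi>\<in>S. c a * (\<xi> b * cnj (\<xi> a)))" by (rule sum.swap)
    also have "\<dots> = (\<Sum>a\<in>K'. c a * (if a = b then of_nat (card K') else 0))"
      unfolding sum_distrib_left[symmetric] by (intro sum.cong refl) (simp add: col b)
    also have "\<dots> = c b * of_nat (card K')"
      using b fK(1) by (simp add: if_distrib[of "(*) _"] cong: if_cong)
    finally show "c b = 0" using cardpos by simp
  next
    fix f assume f: "f \<in> spectral_space S"
    define n where "n = complex_of_nat (card K')"
    have n: "n \<noteq> 0" using cardpos by (simp add: n_def)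
    define c where "c = (\<lambda>a. (\<Sum>\<xi>\<in>S. fourier M f \<xi> * \<xi> a) / n)"
    have row: "(\<Sum>a\<in>K'. \<xi> a * cnj (\<eta> a)) = (if \<xi> = \<eta> then n else 0)" if "\<xi> \<in> S" "\<eta> \<in> S" for \<xi> \<eta>
    proof -
      have "\<xi> \<in> dual_group" "\<eta> \<in> dual_group" using that Sd by auto
      moreover have "agree_on K' \<xi> \<eta> \<longleftrightarrow> \<xi> = \<eta>" using transversal_unique[OF S that] by auto
      ultimately show ?thesis using sum_character_mult_cnj[OF K', of \<xi> \<eta>] by (simp add: n_def)
    qed
    have "(\<Sum>a\<in>K'. c a * translate a g x) = (\<Sum>\<eta>\<in>S. fourier M f \<eta> * \<eta> x)" for x
    proof -
      have "(\<Sum>a\<in>K'. c a * translate a g x) = (\<Sum>a\<in>K'. \<Sum>\<eta>\<in>S. \<eta> x * (c a * cnj (\<eta> a)))"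
        unfolding translate_def g_def sum_distrib_left
        by (intro sum.cong refl) (use Sd in \<open>auto simp: dual_diff mult_ac\<close>)
      also have "\<dots> = (\<Sum>\<eta>\<in>S. \<eta> x * (\<Sum>a\<in>K'. c a * cnj (\<eta> a)))"
        unfolding sum_distrib_left by (rule sum.swap)
      also have "\<dots> = (\<Sum>\<eta>\<in>S. fourier M f \<eta> * \<eta> x)"
      proof (rule sum.cong[OF refl])
        fix \<eta> assume \<eta>: "\<eta> \<in> S"
        have "(\<Sum>a\<in>K'. c a * cnj (\<eta> a)) = (\<Sum>a\<in>K'. \<Sum>\<xi>\<in>S. fourier M f \<xi> * (\<xi> a * cnj (\<eta> a))) / n"
          unfolding c_def by (simp add: sum_divide_distrib sum_distrib_right mult.assoc)
        also have "\<dots> = (\<Sum>\<xi>\<in>S. fourier M f \<xi> * (\<Sum>a\<in>K'. \<xi> a * cnj (\<eta> a))) / n"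
          unfolding sum_distrib_left by (subst sum.swap) simp
        also have "(\<Sum>\<xi>\<in>S. fourier M f \<xi> * (\<Sum>a\<in>K'. \<xi> a * cnj (\<eta> a))) = (\<Sum>\<xi>\<in>S. if \<xi> = \<eta> then fourier M f \<xi> * n else 0)"
          by (intro sum.cong refl) (simp add: row \<eta>)
        also have "\<dots> / n = fourier M f \<eta>" using fin \<eta> n by simp
        finally show "\<eta> x * (\<Sum>a\<in>K'. c a * cnj (\<eta> a)) = fourier M f \<eta> * \<eta> x" by simp
      qed
      finally show ?thesis .
    qed
    then show "\<exists>c. AE x in M. f x = (\<Sum>a\<in>K'. c a * translate a g x)"
      using spectral_space_expansion[OF fin Sd f] by (intro exI[of _ c]) simp
  qed
qed

text \<open>
  Each coefficient of a combination of translates of \<open>g\<close> is a multiple of that of \<open>g\<close>, while the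
  characters in \<open>S\<close>, being members of the space, have nonzero coefficients.
\<close>

lemma fourier_supp_of_basis:
  assumes S: "S \<subseteq> dual_group" and g: "g \<in> spectral_space S"
    and basis: "L2_basis M K' (\<lambda>a. translate a g) (spectral_space S)"
  shows "fourier_supp M g = S"
proof
  have gL: "g \<in> L2 M" using g by (simp add: spectral_space_def)
  show "fourier_supp M g \<subseteq> S" using g by (auto simp: fourier_supp_def spectral_space_def)
  show "S \<subseteq> fourier_supp M g"
  proof
    fix \<xi> assume \<xi>: "\<xi> \<in> S"
    have \<xi>d: "\<xi> \<in> dual_group" using S \<xi> by auto
    have fin: "finite K'" using basis by (simp add: L2_basis_def)
    obtain c where c: "AE x in M. \<xi> x = (\<Sum>a\<in>K'. c a * translate a g x)"
      using basis character_in_spectral_space[OF S \<xi>] unfolding L2_basis_def by blast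
    have "fourier M \<xi> \<xi> = (\<Sum>a\<in>K'. c a * cnj (\<xi> a)) * fourier M g \<xi>"
      using fourier_cong_AE[OF dual_L2[OF \<xi>d] fourier_translates_sum(1)[OF fin gL \<xi>d] \<xi>d c]
      unfolding fourier_translates_sum(2)[OF fin gL \<xi>d] .
    then have "fourier M g \<xi> \<noteq> 0" using fourier_character[OF \<xi>d \<xi>d] by auto
    then show "\<xi> \<in> fourier_supp M g" using \<xi>d by (simp add: fourier_supp_def)
  qed
qed

lemma Union_spectral_spaces_dense: "L2_closure M (\<Union>j. spectral_space (freqs j)) = L2 M"
proof
  show "L2_closure M (\<Union>j. spectral_space (freqs j)) \<subseteq> L2 M" by (auto simp: L2_closure_def)
  have mono: "spectral_space (freqs i) \<subseteq> spectral_space (freqs j)" if "i \<le> j" for i j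
    using that by (intro spectral_space_mono lift_Suc_mono_le[of freqs, OF freqs_mono])
  have "p \<in> (\<Union>j. spectral_space (freqs j))" if "p \<in> trig" for p
    using that
  proof induction
    case (trig_char \<xi>)
    then show ?case
      using freqs_exhaust[OF trig_char] character_in_spectral_space[OF freqs_dual] by blast
  next
    case (trig_add p q)
    then obtain i j where "p \<in> spectral_space (freqs i)" "q \<in> spectral_space (freqs j)" by blast
    then have "p \<in> spectral_space (freqs (max i j))" "q \<in> spectral_space (freqs (max i j))"
      using mono[of i "max i j"] mono[of j "max i j"] by auto
    then have "(\<lambda>x. p x + q x) \<in> spectral_space (freqs (max i j))"
      using spectral_space_closed[of "freqs (max i j)"] unfolding closed_L2_subspace_def by blast
    then show ?case by blast
  next
    case (trig_scale p c)
    then obtain i where "p \<in> spectral_space (freqs i)" by blast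
    then have "(\<lambda>x. c * p x) \<in> spectral_space (freqs i)"
      using spectral_space_closed[of "freqs i"] unfolding closed_L2_subspace_def by blast
    then show ?case by blast
  qed
  then have "L2_closure M trig \<subseteq> L2_closure M (\<Union>j. spectral_space (freqs j))"
    unfolding L2_closure_def by blast
  then show "L2 M \<subseteq> L2_closure M (\<Union>j. spectral_space (freqs j))"
    using trig_dense[OF separates] by simp
qed

lemma spectral_space_pullback:
  assumes f: "f \<in> spectral_space (freqs j)"
  shows "(\<lambda>x. f (A x)) \<in> spectral_space (freqs (Suc j))"
proof -
  have fL: "f \<in> L2 M" using f by (simp add: spectral_space_def)
  have "fourier M (\<lambda>x. f (A x)) \<xi> = 0" if \<xi>: "\<xi> \<in> dual_group" "\<xi> \<notin> freqs (Suc j)" for \<xi>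
  proof (cases "\<forall>a\<in>hom_ker A. \<xi> a = 1")
    case True
    then obtain \<psi> where \<psi>: "\<psi> \<in> dual_group" "\<xi> = (\<lambda>x. \<psi> (A x))"
      using dual_pullback_iff[OF \<xi>(1)] by blast
    have "\<psi> \<notin> freqs j" using freqs_pullback \<xi>(2) unfolding \<psi>(2) by blast
    then show ?thesis
      unfolding \<psi>(2) fourier_pullback[OF fL \<psi>(1)] using f \<psi>(1) by (simp add: spectral_space_def)
  next
    case False
    then show ?thesis using fourier_pullback_eq_0[OF fL \<xi>(1)] by blast
  qed
  then show ?thesis using L2_pullback[OF fL] by (simp add: spectral_space_def)
qed

lemma spectral_space_periodize:
  assumes f: "f \<in> spectral_space (freqs (Suc j))"
  shows "periodize A f \<in> spectral_space (freqs j)"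
proof -
  have fL: "f \<in> L2 M" using f by (simp add: spectral_space_def)
  have "fourier M (periodize A f) \<psi> = 0" if \<psi>: "\<psi> \<in> dual_group" "\<psi> \<notin> freqs j" for \<psi>
  proof -
    have "(\<lambda>x. \<psi> (A x)) \<in> dual_group - freqs (Suc j)"
      using dual_pullback[OF \<psi>(1)] freqs_pullbackD[OF \<psi>(1)] \<psi>(2) by blast
    then have "fourier M f (\<lambda>x. \<psi> (A x)) = 0" using f by (simp add: spectral_space_def)
    then show ?thesis by (simp add: fourier_periodize[OF fL \<psi>(1)])
  qed
  then show ?thesis using L2_periodize[OF fL] by (simp add: spectral_space_def)
qed

theorem spectral_msf_mra: "msf_mra M A (\<lambda>j. spectral_space (freqs j))"
  unfolding msf_mra_def
proof (intro conjI allI impI)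
  show "mra M A (\<lambda>j. spectral_space (freqs j))" unfolding mra_def
  proof (intro conjI allI ballI)
    show "spectral_space (freqs j) \<subseteq> spectral_space (freqs (Suc j))" for j
      by (rule spectral_space_mono[OF freqs_mono])
    show "\<exists>g\<in>spectral_space (freqs j). L2_basis M (K j) (\<lambda>a. translate a g) (spectral_space (freqs j))" for j
      using transversal_translates_basis[OF K_subgroup freqs_transversal] by blast
  qed (simp_all only: spectral_space_closed Union_spectral_spaces_dense spectral_space_translate_iff
        spectral_space_pullback spectral_space_periodize)
  fix \<phi> j assume "scaling_sequence M A (\<lambda>j. spectral_space (freqs j)) \<phi>"
  then have "fourier_supp M (\<phi> j) = freqs j"
    unfolding scaling_sequence_def using fourier_supp_of_basis[OF freqs_dual] by blast
  then show "card (fourier_supp M (\<phi> j)) = card (hom_ker A) ^ j"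
    using transversal_card[OF K_subgroup freqs_transversal separates, of j] K_finite_card[of j] by simp
qed

end

theorem theorem4p5:
  fixes A :: "'a::{topological_ab_group_add, second_countable_topology, t2_space} \<Rightarrow> 'a"
    and M :: "'a measure"
  assumes "compact (UNIV :: 'a set)"
    and "normalized_haar_measure M"
    and "\<And>x y. A (x + y) = A x + A y"
    and "continuous_on UNIV A"
    and "surj A"
    and "finite (hom_ker A)"
    and "closure (\<Union>j. hom_ker (A ^^ j)) = UNIV"
  shows "\<exists>V. msf_mra M A V"
proof -
  interpret dilation M A by unfold_locales (fact assms)+
  show ?thesis using spectral_msf_mra by blast
qed

end
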